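(* Let $S$ be a closed semi-arithmetic Riemann surface. There exists a sequence of congruence coverings $S_i\to S$ of arbitrarily large degree such that $$\mathrm{sys}(S_i)\ \ge\ \lambda\log(\mathrm{area}(S_i))-c \qquad\text{for all } i,$$ where $\lambda>0$ and $c$ are constants depending only on $S$.
   Context: $\mathbb{H}$ is the upper half-plane with the hyperbolic metric. A closed Riemann surface of genus at least $2$ is $S=\Gamma\backslash\mathbb{H}$ for a Fuchsian group (discrete subgroup) $\Gamma<\mathrm{PSL}(2,\mathbb{R})$, and carries the induced hyperbolic metric; $\mathrm{area}$ is hyperbolic area and $\mathrm{sys}(S)$ (the systole) is the minimal length of a closed geodesic of $S$. Semi-arithmetic: for $\gamma\in\mathrm{PSL}(2,\mathbb{R})$, $\mathrm{Tr}\,\gamma$ is the absolute value of the trace of a lift of $\gamma$ to $\mathrm{SL}(2,\mathbb{R})$. For a Fuchsian group $\Gamma$, $\Gamma^{(2)}$ is the subgroup generated by $\{\gamma^2\mid\gamma\in\Gamma\}$, and $k\Gamma=\mathbb{Q}(\mathrm{Tr}\,\gamma\mid\gamma\in\Gamma^{(2)})$ is the invariant trace field. A cofinite Fuchsian group $\Gamma$ is semi-arithmetic if $k\Gamma$ is a totally real number field and $\mathrm{Tr}\,\gamma$ lies in the ring of integers of $k\Gamma$ for all $\gamma\in\Gamma^{(2)}$. $S=\Gamma\backslash\mathbb{H}$ is semi-arithmetic if $\Gamma$ is. Congruence subgroups and coverings: let $\Gamma$ be semi-arithmetic with $K=k\Gamma$ and ring of integers $\mathcal{O}_K$, let $P:\mathrm{SL}(2,\mathbb{R})\to\mathrm{PSL}(2,\mathbb{R})$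 be the projection, and let $\tilde\Gamma,\tilde\Gamma^{(2)}$ be the preimages of $\Gamma,\Gamma^{(2)}$ under $P$. It is known that there exist a quaternion algebra $B$ over $K$, a maximal order $\mathfrak{O}<B$ and an injective morphism of $K$-algebras $\xi:B\to\mathrm{M}(2,\mathbb{R})$ such that $\xi(\mathfrak{O}^1)<\mathrm{SL}(2,\mathbb{R})$ contains $\tilde\Gamma$ or $\tilde\Gamma^{(2)}$, where $\mathfrak{O}^1$ is the group of elements of $\mathfrak{O}$ of reduced norm $1$; these data are fixed. For a nonzero ideal $\mathfrak{a}\subset\mathcal{O}_K$ put $\mathfrak{a}\mathfrak{O}=\{\sum_j a_j\omega_j\mid a_j\in\mathfrak{a},\ \omega_j\in\mathfrak{O}\}$ and $\mathfrak{O}^1(\mathfrak{a})=\{D\in\mathfrak{O}^1\mid D-1\in\mathfrak{a}\mathfrak{O}\}$. The congruence subgroup of $\Gamma$ of level $\mathfrak{a}$ is $\Gamma(\mathfrak{a})=P(\tilde\Gamma\cap\xi(\mathfrak{O}^1(\mathfrak{a})))$, a finite-index subgroup of $\Gamma$. A congruence covering of $S=\Gamma\backslash\mathbb{H}$ is a covering $\Gamma(\mathfrak{a})\backslash\mathbb{H}\to\Gamma\backslash\mathbb{H}$. *)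

theory Defs
  imports
    "HOL-Analysis.Analysis"
    "HOL-Algebra.Algebra"
    "HOL-Algebra.Algebraic_Closure_Type"
    "HOL-Computational_Algebra.Polynomial"
begin

unbundle no Formal_Power_Series.fps_syntax

section \<open>The groups SL(2,R) and PSL(2,R)\<close>

definition SL2R :: "(real^2^2) monoid" where
  "SL2R = \<lparr>carrier = {A. det A = 1}, mult = (**), one = mat 1\<rparr>"

text \<open>Elements of PSL(2,R) are cosets, i.e. two-element sets of matrices
  consisting of a matrix and its negative.\<close>

definition PSL2R :: "(real^2^2) set monoid" where
  "PSL2R = SL2R Mod {mat 1, - mat 1}"

definition proj :: "real^2^2 \<Rightarrow> (real^2^2) set" where
  "proj A = {mat 1, - mat 1} #>\<^bsub>SL2R\<^esub> A"

definition preim :: "(real^2^2) set set \<Rightarrow> (real^2^2) set" where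
  "preim \<Gamma> = {A \<in> carrier SL2R. proj A \<in> \<Gamma>}"

text \<open>The functions mapped over a coset in \<open>abs_tr\<close> and \<open>act\<close> are constant on it.\<close>

definition abs_tr :: "(real^2^2) set \<Rightarrow> real" where
  "abs_tr \<gamma> = the_elem ((\<lambda>A. \<bar>trace A\<bar>) ` \<gamma>)"

definition mobius :: "real^2^2 \<Rightarrow> complex \<Rightarrow> complex" where
  "mobius A z = (of_real (A$1$1) * z + of_real (A$1$2)) / (of_real (A$2$1) * z + of_real (A$2$2))"

definition act :: "(real^2^2) set \<Rightarrow> complex \<Rightarrow> complex" where
  "act \<gamma> z = the_elem ((\<lambda>A. mobius A z) ` \<gamma>)"


section \<open>The hyperbolic plane and its quotients\<close>

definition upper_half_plane :: "complex set"  (\<open>\<H>\<close>) where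
  "\<H> = {z. 0 < Im z}"

text \<open>The distance and area of the metric \<open>(dx\<^sup>2 + dy\<^sup>2) / y\<^sup>2\<close>.\<close>

definition hyp_dist :: "complex \<Rightarrow> complex \<Rightarrow> real" where
  "hyp_dist z w = arcosh (1 + (cmod (z - w))\<^sup>2 / (2 * Im z * Im w))"

definition hyp_measure :: "complex measure" where
  "hyp_measure = density lborel (\<lambda>z. ennreal (indicator \<H> z / (Im z)\<^sup>2))"

text \<open>Points of \<open>\<Gamma>\<setminus>\<H>\<close> are the orbits of \<open>\<Gamma>\<close>, as subsets of \<open>\<H>\<close>.\<close>

definition orb :: "(real^2^2) set set \<Rightarrow> complex \<Rightarrow> complex set" where
  "orb \<Gamma> z = orbit (PSL2R\<lparr>carrier := \<Gamma>\<rparr>) act z"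

definition surface :: "(real^2^2) set set \<Rightarrow> complex set set" where
  "surface \<Gamma> = orbits (PSL2R\<lparr>carrier := \<Gamma>\<rparr>) \<H> act"

definition surface_topology :: "(real^2^2) set set \<Rightarrow> complex set topology" where
  "surface_topology \<Gamma> = topology (\<lambda>U. U \<subseteq> surface \<Gamma> \<and> open (\<Union>U))"

text \<open>\<open>PSL2R\<close> is the quotient of \<open>SL2R\<close> by a finite group, so a subgroup is discrete
  iff its preimage is a discrete set of matrices.\<close>

definition fuchsian :: "(real^2^2) set set \<Rightarrow> bool" where
  "fuchsian \<Gamma> \<longleftrightarrow> subgroup \<Gamma> PSL2R \<and> discrete (preim \<Gamma>)"

text \<open>\<open>\<Gamma>\<setminus>\<H>\<close> is a closed Riemann surface with universal covering \<open>\<H>\<close> and deck group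
  \<open>\<Gamma>\<close>; its genus is then automatically at least 2.\<close>

definition closed_surface_group :: "(real^2^2) set set \<Rightarrow> bool" where
  "closed_surface_group \<Gamma> \<longleftrightarrow> fuchsian \<Gamma> \<and>
     (\<forall>\<gamma>\<in>\<Gamma>. \<forall>z\<in>\<H>. act \<gamma> z = z \<longrightarrow> \<gamma> = \<one>\<^bsub>PSL2R\<^esub>) \<and>
     compact_space (surface_topology \<Gamma>)"

text \<open>The area of \<open>\<Gamma>\<setminus>\<H>\<close> is the hyperbolic area of any Borel set
  containing exactly one point of each orbit.\<close>

definition fundamental_set :: "(real^2^2) set set \<Rightarrow> complex set \<Rightarrow> bool" where
  "fundamental_set \<Gamma> F \<longleftrightarrow> F \<in> sets borel \<and> F \<subseteq> \<H> \<and> (\<forall>p\<in>surface \<Gamma>. \<exists>!z. z \<in> F \<inter> p)"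

definition area :: "(real^2^2) set set \<Rightarrow> ennreal" where
  "area \<Gamma> = (THE a. \<exists>F. fundamental_set \<Gamma> F \<and> a = emeasure hyp_measure F)"

definition cofinite_fuchsian :: "(real^2^2) set set \<Rightarrow> bool" where
  "cofinite_fuchsian \<Gamma> \<longleftrightarrow> fuchsian \<Gamma> \<and> area \<Gamma> < \<infinity>"

text \<open>Complete unit speed geodesics of \<open>\<H>\<close>. Since \<open>\<H> \<rightarrow> \<Gamma>\<setminus>\<H>\<close> is a locally
  isometric covering, the complete geodesics of \<open>\<Gamma>\<setminus>\<H>\<close> are their images.\<close>

definition hyp_geodesic :: "(real \<Rightarrow> complex) \<Rightarrow> bool" where
  "hyp_geodesic c \<longleftrightarrow> range c \<subseteq> \<H> \<and> (\<forall>s t. hyp_dist (c s) (c t) = \<bar>s - t\<bar>)"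

definition surface_geodesic :: "(real^2^2) set set \<Rightarrow> (real \<Rightarrow> complex set) \<Rightarrow> bool" where
  "surface_geodesic \<Gamma> p \<longleftrightarrow> (\<exists>c. hyp_geodesic c \<and> p = (\<lambda>t. orb \<Gamma> (c t)))"

definition closed_geodesic_of_length ::
  "(real^2^2) set set \<Rightarrow> (real \<Rightarrow> complex set) \<Rightarrow> real \<Rightarrow> bool" where
  "closed_geodesic_of_length \<Gamma> p l \<longleftrightarrow>
     surface_geodesic \<Gamma> p \<and> 0 < l \<and> (\<forall>t. p (t + l) = p t)"

definition systole :: "(real^2^2) set set \<Rightarrow> real" where
  "systole \<Gamma> = Inf {l. \<exists>p. closed_geodesic_of_length \<Gamma> p l}"

text \<open>For \<open>\<Delta> \<subseteq> \<Gamma>\<close>, the covering \<open>\<Delta>\<setminus>\<H> \<rightarrow> \<Gamma>\<setminus>\<H>\<close> sends a \<open>\<Delta>\<close>-orbit to the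
  \<open>\<Gamma>\<close>-orbit that contains it; its degree is the common cardinality of the fibres.\<close>

definition covering_degree :: "(real^2^2) set set \<Rightarrow> (real^2^2) set set \<Rightarrow> nat" where
  "covering_degree \<Delta> \<Gamma> = (THE n. \<forall>p\<in>surface \<Gamma>. card {q \<in> surface \<Delta>. q \<subseteq> p} = n)"


section \<open>Semi-arithmetic groups\<close>

definition square_subgroup :: "(real^2^2) set set \<Rightarrow> (real^2^2) set set" where
  "square_subgroup \<Gamma> = generate PSL2R {\<gamma> \<otimes>\<^bsub>PSL2R\<^esub> \<gamma> | \<gamma>. \<gamma> \<in> \<Gamma>}"

definition invariant_trace_field :: "(real^2^2) set set \<Rightarrow> real set" where
  "invariant_trace_field \<Gamma> =
     generate_field ring_of_type_algebra (abs_tr ` square_subgroup \<Gamma>)"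

definition number_field :: "real set \<Rightarrow> bool" where
  "number_field K \<longleftrightarrow> subfield K ring_of_type_algebra \<and>
     (\<exists>n. ring.dimension ring_of_type_algebra n \<rat> K)"

definition totally_real :: "real set \<Rightarrow> bool" where
  "totally_real K \<longleftrightarrow>
     (\<forall>\<sigma> :: real \<Rightarrow> complex.
        \<sigma> \<in> ring_hom (ring_of_type_algebra\<lparr>carrier := K\<rparr>) ring_of_type_algebra \<longrightarrow> \<sigma> ` K \<subseteq> \<real>)"

definition int_ring :: "real set \<Rightarrow> real set" where
  "int_ring K = {x \<in> K. algebraic_int x}"

definition semi_arithmetic :: "(real^2^2) set set \<Rightarrow> bool" where
  "semi_arithmetic \<Gamma> \<longleftrightarrow> cofinite_fuchsian \<Gamma> \<and>
     number_field (invariant_trace_field \<Gamma>) \<and> totally_real (invariant_trace_field \<Gamma>) \<and>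
     (\<forall>\<gamma>\<in>square_subgroup \<Gamma>. abs_tr \<gamma> \<in> int_ring (invariant_trace_field \<Gamma>))"


section \<open>Quaternion algebras and orders\<close>

text \<open>The quaternion algebra \<open>(\<alpha>, \<beta>) / K\<close> with basis \<open>1, i, j, ij\<close>, \<open>i\<^sup>2 = \<alpha>\<close>, \<open>j\<^sup>2 = \<beta>\<close>,
  \<open>ji = - ij\<close>: its elements are the vectors with all coordinates in \<open>K\<close>. Every quaternion
  algebra over a field of characteristic 0 is of this form.\<close>

definition quat_mult :: "real \<Rightarrow> real \<Rightarrow> real^4 \<Rightarrow> real^4 \<Rightarrow> real^4" where
  "quat_mult \<alpha> \<beta> x y = vector
     [x$1 * y$1 + \<alpha> * (x$2 * y$2) + \<beta> * (x$3 * y$3) - \<alpha> * \<beta> * (x$4 * y$4),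
      x$1 * y$2 + x$2 * y$1 - \<beta> * (x$3 * y$4) + \<beta> * (x$4 * y$3),
      x$1 * y$3 + x$3 * y$1 + \<alpha> * (x$2 * y$4) - \<alpha> * (x$4 * y$2),
      x$1 * y$4 + x$4 * y$1 + x$2 * y$3 - x$3 * y$2]"

definition quaternion_algebra :: "real set \<Rightarrow> real \<Rightarrow> real \<Rightarrow> (real^4) ring" where
  "quaternion_algebra K \<alpha> \<beta> =
     \<lparr>carrier = {x. \<forall>i. x$i \<in> K}, mult = quat_mult \<alpha> \<beta>, one = axis 1 1, ring.zero = 0, ring.add = (+)\<rparr>"

definition reduced_norm :: "real \<Rightarrow> real \<Rightarrow> real^4 \<Rightarrow> real" where
  "reduced_norm \<alpha> \<beta> x = (x$1)\<^sup>2 - \<alpha> * (x$2)\<^sup>2 - \<beta> * (x$3)\<^sup>2 + \<alpha> * \<beta> * (x$4)\<^sup>2"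

text \<open>All finite sums of products \<open>a \<omega>\<close> with \<open>a \<in> A\<close> and \<open>\<omega> \<in> W\<close>, provided \<open>A\<close> is closed
  under addition (so that repeated elements of \<open>W\<close> may be collected).\<close>

definition combinations :: "real set \<Rightarrow> (real^4) set \<Rightarrow> (real^4) set" where
  "combinations A W = {\<Sum>\<omega>\<in>T. a \<omega> *\<^sub>R \<omega> | T a. finite T \<and> T \<subseteq> W \<and> a ` T \<subseteq> A}"

definition quaternion_order :: "real set \<Rightarrow> real \<Rightarrow> real \<Rightarrow> (real^4) set \<Rightarrow> bool" where
  "quaternion_order K \<alpha> \<beta> \<OO> \<longleftrightarrow>
     subring \<OO> (quaternion_algebra K \<alpha> \<beta>) \<and>
     (\<exists>W. finite W \<and> \<OO> = combinations (int_ring K) W) \<and>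
     combinations K \<OO> = carrier (quaternion_algebra K \<alpha> \<beta>)"

definition maximal_order :: "real set \<Rightarrow> real \<Rightarrow> real \<Rightarrow> (real^4) set \<Rightarrow> bool" where
  "maximal_order K \<alpha> \<beta> \<OO> \<longleftrightarrow> quaternion_order K \<alpha> \<beta> \<OO> \<and>
     (\<forall>\<OO>'. quaternion_order K \<alpha> \<beta> \<OO>' \<and> \<OO> \<subseteq> \<OO>' \<longrightarrow> \<OO>' = \<OO>)"

definition norm_one_group :: "real \<Rightarrow> real \<Rightarrow> (real^4) set \<Rightarrow> (real^4) set" where
  "norm_one_group \<alpha> \<beta> \<OO> = {x \<in> \<OO>. reduced_norm \<alpha> \<beta> x = 1}"

definition mat_ring :: "(real^2^2) ring" where
  "mat_ring = \<lparr>carrier = UNIV, mult = (**), one = mat 1, ring.zero = 0, ring.add = (+)\<rparr>"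

definition alg_embedding :: "real set \<Rightarrow> real \<Rightarrow> real \<Rightarrow> (real^4 \<Rightarrow> real^2^2) \<Rightarrow> bool" where
  "alg_embedding K \<alpha> \<beta> \<xi> \<longleftrightarrow>
     \<xi> \<in> ring_hom (quaternion_algebra K \<alpha> \<beta>) mat_ring \<and>
     (\<forall>k\<in>K. \<forall>x\<in>carrier (quaternion_algebra K \<alpha> \<beta>). \<xi> (k *\<^sub>R x) = k *\<^sub>R \<xi> x) \<and>
     inj_on \<xi> (carrier (quaternion_algebra K \<alpha> \<beta>))"

text \<open>The data \<open>B = (\<alpha>, \<beta>) / K\<close>, \<open>\<OO>\<close>, \<open>\<xi>\<close> from which congruence subgroups are built,
  for \<open>K\<close> the invariant trace field.\<close>

definition congruence_data ::
  "(real^2^2) set set \<Rightarrow> real \<Rightarrow> real \<Rightarrow> (real^4) set \<Rightarrow> (real^4 \<Rightarrow> real^2^2) \<Rightarrow> bool" where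
  "congruence_data \<Gamma> \<alpha> \<beta> \<OO> \<xi> \<longleftrightarrow> (let K = invariant_trace_field \<Gamma> in
     \<alpha> \<in> K - {0} \<and> \<beta> \<in> K - {0} \<and> maximal_order K \<alpha> \<beta> \<OO> \<and> alg_embedding K \<alpha> \<beta> \<xi> \<and>
     \<xi> ` norm_one_group \<alpha> \<beta> \<OO> \<subseteq> carrier SL2R \<and>
     (preim \<Gamma> \<subseteq> \<xi> ` norm_one_group \<alpha> \<beta> \<OO> \<or>
      preim (square_subgroup \<Gamma>) \<subseteq> \<xi> ` norm_one_group \<alpha> \<beta> \<OO>))"

definition nonzero_ideal :: "real set \<Rightarrow> real set \<Rightarrow> bool" where
  "nonzero_ideal K \<aa> \<longleftrightarrow> ideal \<aa> (ring_of_type_algebra\<lparr>carrier := int_ring K\<rparr>) \<and> \<aa> \<noteq> {0}"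

definition principal_congruence ::
  "real \<Rightarrow> real \<Rightarrow> (real^4) set \<Rightarrow> real set \<Rightarrow> (real^4) set" where
  "principal_congruence \<alpha> \<beta> \<OO> \<aa> =
     {D \<in> norm_one_group \<alpha> \<beta> \<OO>. D - axis 1 1 \<in> combinations \<aa> \<OO>}"

definition congruence_subgroup ::
  "(real^2^2) set set \<Rightarrow> real \<Rightarrow> real \<Rightarrow> (real^4) set \<Rightarrow> (real^4 \<Rightarrow> real^2^2) \<Rightarrow> real set
     \<Rightarrow> (real^2^2) set set" where
  "congruence_subgroup \<Gamma> \<alpha> \<beta> \<OO> \<xi> \<aa> = proj ` (preim \<Gamma> \<inter> \<xi> ` principal_congruence \<alpha> \<beta> \<OO> \<aa>)"

end

theory Submission
  imports Defs "Jordan_Normal_Form.Char_Poly"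
begin

text \<open>Let \<open>\<Gamma>(m)\<close> be the congruence subgroup whose level is generated by the integer \<open>m\<close>. If \<open>A\<close> lifts an
  element of \<open>\<Gamma>(m)\<close> then \<open>A\<^sup>2 = \<xi> (1 + m w)\<close> with \<open>w\<close> in the order, so \<open>tr A\<^sup>2 - 2\<close> is \<open>m\<close> times the
  reduced trace of \<open>w\<close>. It is nonzero for \<open>A \<noteq> \<plusminus>1\<close>, since a cocompact group without elliptic elements has no
  parabolic ones, and reduced traces of elements of the order form a lattice in the invariant trace field
  \<open>K\<close>. Hence \<open>tr A\<^sup>2 - 2\<close> has size at least a multiple of \<open>m\<close>, for any submultiplicative size on the rational
  vector space \<open>K\<close>.

  Conversely, if \<open>A\<close> moves some point by the distance \<open>l\<close>, then a conjugate of \<open>A\<^sup>2\<close> is a word of length \<open>O(l + 1)\<close> in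
  fixed generators of \<open>\<Gamma>\<^sup>(\<^sup>2\<^sup>)\<close>. These generators embed in a quaternion algebra over \<open>K\<close>, so the size of \<open>tr A\<^sup>2\<close>
  is at most exponential in \<open>l\<close>. Comparing the two bounds gives a systole of at least a multiple of \<open>log m\<close>,
  whereas counting residues of the coordinates in the order bounds the index, and with it the area, by a
  power of \<open>m\<close> that depends only on the degree of \<open>K\<close>. Traces do not depend on the congruence data, so the upper bound may be
  taken from one fixed choice of the data; the constants that depend on the data are absorbed by taking
  \<open>m\<close> large.\<close>

section \<open>Algebraic integers\<close>

text \<open>The constants \<open>\<kappa>\<close> and \<open>c\<close> are fixed before the
  quaternion data, whereas the denominators of the order (\<open>M\<close>) and the gap
  \<open>\<delta>\<close> of its reduced traces belong to the data. For \<open>m\<close> beyond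
  \<open>M\<close> and \<open>1 / \<delta>^2\<close>, the estimates
  \<open>(m M)^(4 n) \<le> m^(8 n)\<close> and \<open>m \<delta> \<ge> sqrt m\<close> remove both at
  the price of a factor 2 in each exponent, where \<open>n\<close> is the degree of
  \<open>K\<close>. Squares enter for two reasons. The data only guarantee that the lifts of
  elements of the group generated by squares lie in the image of the order, and only one of the two
  lifts of an element of a congruence subgroup need be congruent to 1; both lifts have the same
  square. That the squares generate a subgroup of finite index follows from finite generation, since
  the quotient is abelian of exponent 2. Areas are only estimated from above, by covering a
  fundamental set with translates of a compact region that meets every orbit. The same region yields
  the finite generating set and the uniform lower bound for displacements.\<close>

lemma algebraic_int_if_stable_span:
  fixes x :: real
  assumes fin: "finite S" and s0: "s0 \<in> S" "s0 \<noteq> 0"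
    and st: "\<And>s. s \<in> S \<Longrightarrow> \<exists>c :: real \<Rightarrow> int. x * s = (\<Sum>t\<in>S. of_int (c t) * t)"
  shows "algebraic_int x"
proof -
  obtain c :: "real \<Rightarrow> real \<Rightarrow> int" where c: "\<And>s. s \<in> S \<Longrightarrow> x * s = (\<Sum>t\<in>S. of_int (c s t) * t)"
    using st by metis
  obtain l where l: "set l = S" "distinct l" using finite_distinct_list[OF fin] by blast
  define n where "n = length l"
  \<comment> \<open>Multiplication by \<open>x\<close> acts on the family \<open>S\<close> through
    this integer matrix, so the family itself is an eigenvector for \<open>x\<close>, nonzero
    because of \<open>s0\<close>. Hence \<open>x\<close> is a root of a monic integer
    polynomial.\<close>
  define A :: "int Matrix.mat" where "A = Matrix.mat n n (\<lambda>(i, j). c (l ! i) (l ! j))"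
  define B :: "real Matrix.mat" where "B = map_mat of_int A"
  define v where "v = Matrix.vec n (\<lambda>i. l ! i)"
  have A: "A \<in> carrier_mat n n" by (simp add: A_def)
  have B: "B \<in> carrier_mat n n" using A by (simp add: B_def)
  obtain i0 where i0: "i0 < n" "l ! i0 = s0" using s0 l n_def by (metis in_set_conv_nth)
  have vne: "v \<noteq> 0\<^sub>v n"
  proof
    assume "v = 0\<^sub>v n"
    hence "vec_index v i0 = 0" using i0 by simp
    thus False using i0 s0 by (simp add: v_def)
  qed
  have "eigenvector B v x"
    unfolding eigenvector_def
  proof (intro conjI)
    show "v \<in> carrier_vec (dim_row B)" using B by (simp add: v_def)
    show "v \<noteq> 0\<^sub>v (dim_row B)" using vne B by simp
    show "B *\<^sub>v v = x \<cdot>\<^sub>v v"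
    proof (rule eq_vecI)
      show "dim_vec (B *\<^sub>v v) = dim_vec (x \<cdot>\<^sub>v v)" using B by (simp add: v_def)
      fix i assume "i < dim_vec (x \<cdot>\<^sub>v v)"
      hence i: "i < n" by (simp add: v_def)
      hence li: "l ! i \<in> S" using l n_def by auto
      have "vec_index (B *\<^sub>v v) i = (\<Sum>j<n. of_int (c (l ! i) (l ! j)) * (l ! j))"
        using i by (simp add: B_def A_def v_def scalar_prod_def atLeast0LessThan)
      also have "\<dots> = (\<Sum>t\<in>S. of_int (c (l ! i) t) * t)"
        using l bij_betw_nth[OF l(2), of "{..<n}" S]
        by (intro sum.reindex_bij_betw) (auto simp: n_def)
      also have "\<dots> = x * (l ! i)" using c[OF li] by simp
      finally show "vec_index (B *\<^sub>v v) i = vec_index (x \<cdot>\<^sub>v v) i" using i by (simp add: v_def)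
    qed
  qed
  hence "poly (char_poly B) x = 0"
    using eigenvalue_root_char_poly[OF B] eigenvalue_def by blast
  moreover have "char_poly B = map_poly of_int (char_poly A)"
    unfolding B_def by (rule of_int_hom.char_poly_hom[OF A])
  moreover have "Polynomial.lead_coeff (char_poly A) = 1"
    using degree_monic_char_poly[OF A] by simp
  ultimately show ?thesis
    unfolding algebraic_int_altdef_ipoly by auto
qed

no_notation vec_index (infixl \<open>$\<close> 100)
no_notation index_mat (infixl \<open>$$\<close> 100)
hide_const (open) Matrix.mat Matrix.vec Determinant.det Matrix.row Matrix.col Char_Poly.eigenvalue
  Char_Poly.eigenvector
unbundle no Formal_Power_Series.fps_syntax

interpretation zmod: Modules.module "\<lambda>(n::int) (x::real). of_int n * x"
  by unfold_locales (simp_all add: algebra_simps)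

lemma algebraic_int_if_stable_zspan:
  fixes x :: real
  assumes fin: "finite S" and s0: "s0 \<in> S" "s0 \<noteq> 0"
    and st: "\<And>s. s \<in> S \<Longrightarrow> x * s \<in> zmod.span S"
  shows "algebraic_int x"
  using algebraic_int_if_stable_span[OF fin s0] st zmod.span_finite[OF fin] by fastforce

lemma zspan_stable:
  assumes st: "\<And>s. s \<in> S \<Longrightarrow> x * s \<in> zmod.span S" and y: "y \<in> zmod.span S"
  shows "x * y \<in> zmod.span S"
  using y
proof (induction rule: zmod.span_induct_alt)
  case base
  show ?case by (simp add: zmod.span_zero)
next
  case (step c s y)
  have "x * (of_int c * s + y) = of_int c * (x * s) + x * y" by (simp add: algebra_simps)
  thus ?case using step st by (auto intro!: zmod.span_add zmod.span_scale)
qed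

lemma algebraic_int_power_reduce:
  fixes x :: real
  assumes "algebraic_int x"
  obtains d :: nat and c :: "nat \<Rightarrow> int" where "0 < d" "x ^ d = (\<Sum>i<d. of_int (c i) * x ^ i)"
proof -
  obtain p where p: "poly (map_poly real_of_int p) x = 0" "Polynomial.lead_coeff p = 1"
    using assms unfolding algebraic_int_altdef_ipoly by blast
  define d where "d = Polynomial.degree p"
  have dg: "Polynomial.degree (map_poly real_of_int p) = d" by (simp add: d_def degree_map_poly)
  have "0 = (\<Sum>i\<le>d. real_of_int (Polynomial.coeff p i) * x ^ i)"
    using p(1) by (simp add: poly_altdef dg coeff_map_poly flip: d_def)
  also have "\<dots> = (\<Sum>i<d. real_of_int (Polynomial.coeff p i) * x ^ i) + x ^ d"
    using p(2) by (simp add: lessThan_Suc_atMost[symmetric] d_def)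
  finally have eq: "x ^ d = (\<Sum>i<d. real_of_int (- Polynomial.coeff p i) * x ^ i)"
    by (simp add: sum_negf)
  \<comment> \<open>For \<open>d = 0\<close> the relation would read 1 = 0.\<close>
  moreover have "0 < d"
    using eq by (cases d) auto
  ultimately show ?thesis using that[of d "\<lambda>i. - Polynomial.coeff p i"] by blast
qed

text \<open>The monomials \<open>x^i y^j\<close> with \<open>i < d\<close> and \<open>j < e\<close>
  span an additive group that is stable under multiplication by \<open>x\<close> and by
  \<open>y\<close>, hence also by their sum and product.\<close>

lemma
  fixes x y :: real
  assumes x: "algebraic_int x" and y: "algebraic_int y"
  shows algebraic_int_add: "algebraic_int (x + y)"
    and algebraic_int_mult: "algebraic_int (x * y)"
proof -
  obtain d c where d: "0 < d" "x ^ d = (\<Sum>i<d. of_int (c i) * x ^ i)"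
    using algebraic_int_power_reduce[OF x] .
  obtain e b where e: "0 < e" "y ^ e = (\<Sum>i<e. of_int (b i) * y ^ i)"
    using algebraic_int_power_reduce[OF y] .
  define S where "S = (\<lambda>(i, j). x ^ i * y ^ j) ` ({..<d} \<times> {..<e})"
  have fin: "finite S" by (simp add: S_def)
  have S: "x ^ i * y ^ j \<in> zmod.span S" if "i < d" "j < e" for i j
    using that by (intro zmod.span_base) (force simp: S_def)
  have one: "1 \<in> S" unfolding S_def using d e by (intro image_eqI[of _ _ "(0, 0)"]) auto
  have xs: "x * s \<in> zmod.span S" if s: "s \<in> S" for s
  proof -
    obtain i j where ij: "i < d" "j < e" "s = x ^ i * y ^ j" using s unfolding S_def by fast
    show ?thesis
    proof (cases "Suc i < d")
      case True
      thus ?thesis using S[of "Suc i" j] ij by (simp add: mult.assoc)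
    next
      case False
      hence "Suc i = d" using ij by simp
      hence "x * s = x ^ d * y ^ j" using ij by (auto simp: mult.assoc)
      also have "\<dots> = (\<Sum>i<d. of_int (c i) * (x ^ i * y ^ j))"
        by (simp add: d(2) sum_distrib_right mult.assoc)
      finally show ?thesis using S ij by (auto intro!: zmod.span_sum zmod.span_scale)
    qed
  qed
  have ys: "y * s \<in> zmod.span S" if s: "s \<in> S" for s
  proof -
    obtain i j where ij: "i < d" "j < e" "s = x ^ i * y ^ j" using s unfolding S_def by fast
    show ?thesis
    proof (cases "Suc j < e")
      case True
      thus ?thesis using S[of i "Suc j"] ij by (simp add: mult_ac)
    next
      case False
      hence "Suc j = e" using ij by simp
      hence "y * s = x ^ i * y ^ e" using ij by (auto simp: mult_ac)
      also have "\<dots> = (\<Sum>j<e. of_int (b j) * (x ^ i * y ^ j))"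
        by (simp add: e(2) sum_distrib_left mult_ac)
      finally show ?thesis using S ij by (auto intro!: zmod.span_sum zmod.span_scale)
    qed
  qed
  show "algebraic_int (x + y)"
    by (rule algebraic_int_if_stable_zspan[OF fin one])
      (auto simp: distrib_right intro!: zmod.span_add xs ys)
  show "algebraic_int (x * y)"
  proof (rule algebraic_int_if_stable_zspan[OF fin one])
    show "x * y * s \<in> zmod.span S" if "s \<in> S" for s
      using zspan_stable[OF xs ys[OF that]] by (simp add: mult.assoc)
  qed simp
qed

section \<open>Two by two matrices and their adjugates\<close>

lemma mat2_eq_iff: "(A :: real^2^2) = B \<longleftrightarrow>
    A$1$1 = B$1$1 \<and> A$1$2 = B$1$2 \<and> A$2$1 = B$2$1 \<and> A$2$2 = B$2$2"
  by (auto simp: Finite_Cartesian_Product.vec_eq_iff forall_2)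

lemma mult2_nth: "((A :: real^2^2) ** B)$i$j = A$i$1 * B$1$j + A$i$2 * B$2$j"
  by (simp add: matrix_matrix_mult_def sum_2)

lemma mat1_nth [simp]:
  "(mat 1 :: real^2^2)$1$1 = 1" "(mat 1 :: real^2^2)$1$2 = 0"
  "(mat 1 :: real^2^2)$2$1 = 0" "(mat 1 :: real^2^2)$2$2 = 1"
  by (simp_all add: Finite_Cartesian_Product.mat_def)

definition mat2 :: "real \<Rightarrow> real \<Rightarrow> real \<Rightarrow> real \<Rightarrow> real^2^2" where
  "mat2 a b c d = vector [vector [a, b], vector [c, d]]"

lemma mat2_nth [simp]:
  "(mat2 a b c d)$1$1 = a" "(mat2 a b c d)$1$2 = b" "(mat2 a b c d)$2$1 = c" "(mat2 a b c d)$2$2 = d"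
  by (simp_all add: mat2_def)

text \<open>The adjugate, which is the inverse on SL(2,R). Being linear in the entries, it satisfies
  its algebraic rules without any condition on the determinant.\<close>

definition adj2 :: "real^2^2 \<Rightarrow> real^2^2" where
  "adj2 A = mat2 (A$2$2) (- A$1$2) (- A$2$1) (A$1$1)"

lemma adj2_nth [simp]:
  "(adj2 A)$1$1 = A$2$2" "(adj2 A)$1$2 = - A$1$2" "(adj2 A)$2$1 = - A$2$1" "(adj2 A)$2$2 = A$1$1"
  by (simp_all add: adj2_def)

lemma det_adj2 [simp]: "det (adj2 A) = det A"
  by (simp add: det_2)

lemma adj2_mult: assumes "det A = 1"
  shows "adj2 A ** A = mat 1" "A ** adj2 A = mat 1"
  using assms by (simp_all add: mat2_eq_iff mult2_nth det_2 algebra_simps)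

lemma adj2_adj2 [simp]: "adj2 (adj2 A) = A"
  by (simp add: mat2_eq_iff)

lemma adj2_matrix_mult: "adj2 (A ** B) = adj2 B ** adj2 A"
  by (simp add: mat2_eq_iff mult2_nth algebra_simps)

lemma det_minus2 [simp]: "det (- A :: real^2^2) = det A"
  by (simp add: det_2)

lemma trace2: "trace (A :: real^2^2) = A$1$1 + A$2$2"
  by (simp add: trace_def sum_2)

lemma minus_mult2 [simp]: "(- A) ** B = - ((A :: real^2^2) ** (B :: real^2^2))" "A ** (- B) = - ((A :: real^2^2) ** (B :: real^2^2))"
  by (simp_all add: mat2_eq_iff mult2_nth)

lemma adj2_one [simp]: "adj2 (mat 1) = mat 1"
  by (simp add: mat2_eq_iff)

lemma adj2_minus [simp]: "adj2 (- A) = - adj2 A"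
  by (simp add: mat2_eq_iff)


section \<open>Moebius transformations of the upper half-plane\<close>

text \<open>The automorphy factor \<open>c z + d\<close>: its inverse square is the derivative of
  the Moebius map, and the square of its modulus is the factor by which heights shrink.\<close>

definition cocycle :: "real^2^2 \<Rightarrow> complex \<Rightarrow> complex" where
  "cocycle A z = of_real (A$2$1) * z + of_real (A$2$2)"

lemma cocycle_nonzero: assumes "det A = 1" "z \<in> \<H>" shows "cocycle A z \<noteq> 0"
proof
  assume 0: "cocycle A z = 0"
  hence "Im (cocycle A z) = 0" by simp
  hence c: "A$2$1 = 0" using assms by (simp add: cocycle_def upper_half_plane_def)
  hence "A$2$2 = 0" using 0 by (simp add: cocycle_def)
  thus False using c assms by (simp add: det_2)
qed

lemma mobius_cocycle: "mobius A z = (of_real (A$1$1) * z + of_real (A$1$2)) / cocycle A z"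
  by (simp add: mobius_def cocycle_def)

lemma mobius_one [simp]: "mobius (mat 1) z = z"
  by (simp add: mobius_def)

lemma mobius_uminus [simp]: "mobius (- A) z = mobius A z"
proof -
  have "mobius (- A) z = (- (of_real (A$1$1) * z + of_real (A$1$2))) / (- (of_real (A$2$1) * z + of_real (A$2$2)))"
    by (simp add: mobius_def)
  thus ?thesis by (simp only: minus_divide_divide mobius_def)
qed

lemma mobius_diff:
  assumes "det A = 1" "z \<in> \<H>" "w \<in> \<H>"
  shows "mobius A z - mobius A w = (z - w) / (cocycle A z * cocycle A w)"
proof -
  have 1: "complex_of_real (A$1$1) * of_real (A$2$2) - of_real (A$1$2) * of_real (A$2$1) = 1"
    using arg_cong[OF assms(1), of complex_of_real] by (simp add: det_2)
  have "mobius A z - mobius A w =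
      ((of_real (A$1$1) * z + of_real (A$1$2)) * cocycle A w - (of_real (A$1$1) * w + of_real (A$1$2)) * cocycle A z)
       / (cocycle A z * cocycle A w)"
    unfolding mobius_cocycle
    using cocycle_nonzero[OF assms(1,2)] cocycle_nonzero[OF assms(1,3)]
    by (simp add: diff_frac_eq)
  also have "(of_real (A$1$1) * z + of_real (A$1$2)) * cocycle A w - (of_real (A$1$1) * w + of_real (A$1$2)) * cocycle A z
      = (of_real (A$1$1) * of_real (A$2$2) - of_real (A$1$2) * of_real (A$2$1)) * (z - w)"
    unfolding cocycle_def by (simp add: algebra_simps)
  finally show ?thesis unfolding 1 by simp
qed

lemma Im_mobius:
  assumes "det A = 1" "z \<in> \<H>"
  shows "Im (mobius A z) = Im z / (cmod (cocycle A z))\<^sup>2"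
proof -
  have "Im (mobius A z) = ((A$1$1 * A$2$2 - A$1$2 * A$2$1) * Im z) / (cmod (cocycle A z))\<^sup>2"
    by (simp add: mobius_cocycle Im_divide cmod_power2)
      (simp add: cocycle_def algebra_simps)
  thus ?thesis using assms by (simp add: det_2)
qed

lemma mobius_in_H [intro]:
  assumes "det A = 1" "z \<in> \<H>" shows "mobius A z \<in> \<H>"
  using Im_mobius[OF assms] cocycle_nonzero[OF assms] assms(2) by (simp add: upper_half_plane_def)

lemma mobius_mult:
  assumes "det B = 1" "z \<in> \<H>"
  shows "mobius (A ** B) z = mobius A (mobius B z)"
proof -
  note nz = cocycle_nonzero[OF assms]
  define u where "u = of_real (B$1$1) * z + of_real (B$1$2)"
  define v where "v = cocycle B z"
  have "v \<noteq> 0" using nz by (simp add: v_def)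
  have *: "x * (u / v) + y = (x * u + y * v) / v" for x y
    using \<open>v \<noteq> 0\<close> by (simp add: add_divide_distrib)
  have **: "(x / v) / (y / v) = x / y" for x y
    using \<open>v \<noteq> 0\<close> by simp
  have "mobius A (mobius B z) =
    (of_real (A$1$1) * u + of_real (A$1$2) * v) / (of_real (A$2$1) * u + of_real (A$2$2) * v)"
    unfolding mobius_def[of A] mobius_cocycle[of B] u_def[symmetric] v_def[symmetric] *
    by (rule **)
  thus ?thesis
    by (simp add: mobius_def[of "A ** B"] mult2_nth u_def v_def cocycle_def algebra_simps)
qed

lemma mobius_adj2 [simp]:
  assumes "det A = 1" "z \<in> \<H>"
  shows "mobius (adj2 A) (mobius A z) = z" "mobius A (mobius (adj2 A) z) = z"
  using assms mobius_mult[of A z "adj2 A"] mobius_mult[of "adj2 A" z A] by (simp_all add: adj2_mult)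

lemma continuous_on_mobius: "det A = 1 \<Longrightarrow> continuous_on \<H> (mobius A)"
  unfolding mobius_def[abs_def]
  using cocycle_nonzero by (intro continuous_intros) (auto simp: cocycle_def)

lemma open_H: "open \<H>"
  unfolding upper_half_plane_def by (rule open_halfspace_Im_gt)

text \<open>Turns images into preimages under the inverse map, so that images of open or Borel sets
  are seen to be open or Borel.\<close>

lemma mobius_image_eq:
  assumes "det A = 1" "E \<subseteq> \<H>"
  shows "mobius A ` E = {z \<in> \<H>. mobius (adj2 A) z \<in> E}"
  using assms mobius_adj2[OF assms(1)] by (force intro!: image_eqI[of _ "mobius A"])

lemma open_mobius_image:
  assumes "det A = 1" "E \<subseteq> \<H>" "open E"
  shows "open (mobius A ` E)"
proof -
  have "open (\<H> \<inter> mobius (adj2 A) -` E)"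
    using assms by (intro continuous_open_preimage continuous_on_mobius open_H) auto
  thus ?thesis unfolding mobius_image_eq[OF assms(1,2)] by (simp add: Collect_conj_eq vimage_def)
qed

lemma mobius_measurable [measurable]: "mobius A \<in> borel_measurable borel"
  unfolding mobius_def[abs_def] by measurable

lemma borel_mobius_image:
  assumes "det A = 1" "E \<subseteq> \<H>" "E \<in> sets borel"
  shows "mobius A ` E \<in> sets borel"
proof -
  have "mobius A ` E = \<H> \<inter> (mobius (adj2 A) -` E \<inter> space borel)"
    unfolding mobius_image_eq[OF assms(1,2)] by auto
  moreover have "mobius (adj2 A) -` E \<inter> space borel \<in> sets borel"
    using measurable_sets[OF mobius_measurable assms(3)] .
  ultimately show ?thesis using open_H by auto
qed

text \<open>This is \<open>2 (cosh d - 1)\<close> for the hyperbolic distance \<open>d\<close>; unlike \<open>d\<close> it is a rational function.\<close>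

definition hypQ :: "complex \<Rightarrow> complex \<Rightarrow> real" where
  "hypQ z w = (cmod (z - w))\<^sup>2 / (Im z * Im w)"

lemma hyp_dist_hypQ: "hyp_dist z w = arcosh (1 + hypQ z w / 2)"
  by (simp add: hyp_dist_def hypQ_def mult_ac)

lemma hypQ_nonneg: "z \<in> \<H> \<Longrightarrow> w \<in> \<H> \<Longrightarrow> 0 \<le> hypQ z w"
  by (simp add: hypQ_def upper_half_plane_def)

lemma hypQ_mobius:
  assumes "det A = 1" "z \<in> \<H>" "w \<in> \<H>"
  shows "hypQ (mobius A z) (mobius A w) = hypQ z w"
  using cocycle_nonzero[OF assms(1,2)] cocycle_nonzero[OF assms(1,3)] assms(2,3)
  unfolding hypQ_def mobius_diff[OF assms] Im_mobius[OF assms(1,2)] Im_mobius[OF assms(1,3)]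
  by (simp add: norm_divide norm_mult power_mult_distrib power_divide field_simps)

lemma hypQ_self [simp]: "hypQ z z = 0"
  by (simp add: hypQ_def)

lemma hypQ_commute: "hypQ z w = hypQ w z"
  by (simp add: hypQ_def norm_minus_commute mult.commute)

text \<open>The numerator is the quadratic polynomial whose zeros are the fixed points of
  \<open>A\<close>. The automorphy factor in the difference \<open>z - A z\<close> cancels against
  the one in the height of \<open>A z\<close>.\<close>

lemma hypQ_displacement:
  assumes "det A = 1" "z \<in> \<H>"
  shows "hypQ z (mobius A z) =
    (cmod (of_real (A$2$1) * z\<^sup>2 + of_real (A$2$2 - A$1$1) * z - of_real (A$1$2)))\<^sup>2 / (Im z)\<^sup>2"
proof -
  note nz = cocycle_nonzero[OF assms]
  have "z - mobius A z = (of_real (A$2$1) * z\<^sup>2 + of_real (A$2$2 - A$1$1) * z - of_real (A$1$2)) / cocycle A z"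
    using nz unfolding mobius_cocycle
    by (simp add: field_simps) (simp add: cocycle_def power2_eq_square algebra_simps)
  thus ?thesis
    unfolding hypQ_def Im_mobius[OF assms] using nz assms(2)
    by (simp add: norm_divide power_divide power2_eq_square)
qed

lemma mobius_fixed_iff:
  assumes "det A = 1" "z \<in> \<H>"
  shows "mobius A z = z \<longleftrightarrow> hypQ z (mobius A z) = 0"
  using assms mobius_in_H[OF assms] by (auto simp: hypQ_def upper_half_plane_def)


section \<open>The projective group\<close>

lemma SL2R_simps [simp]: "carrier SL2R = {A. det A = 1}" "A \<otimes>\<^bsub>SL2R\<^esub> B = A ** B" "\<one>\<^bsub>SL2R\<^esub> = mat 1"
  by (simp_all add: SL2R_def)

lemma group_SL2R: "group SL2R"
proof (rule groupI)
  fix A assume "A \<in> carrier SL2R"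
  thus "\<exists>y\<in>carrier SL2R. y \<otimes>\<^bsub>SL2R\<^esub> A = \<one>\<^bsub>SL2R\<^esub>"
    by (intro bexI[of _ "adj2 A"]) (auto simp: adj2_mult)
qed (auto simp: det_mul matrix_mul_assoc)

lemma proj_eq: "proj A = {A, - A}"
  by (auto simp: proj_def r_coset_def)

lemma normal_center: "{mat 1, - mat 1} \<lhd> SL2R"
proof -
  interpret group SL2R by (rule group_SL2R)
  have inv: "inv\<^bsub>SL2R\<^esub> A = adj2 A" if "det A = 1" for A
    using that by (intro inv_equality) (auto simp: adj2_mult)
  show ?thesis
    unfolding normal_inv_iff
  proof (intro conjI ballI)
    show "subgroup {mat 1, - mat 1} SL2R"
      by (rule subgroupI) (auto simp: inv)
    fix A H assume "A \<in> carrier SL2R" "H \<in> {mat 1, - mat 1 :: real^2^2}"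
    thus "A \<otimes>\<^bsub>SL2R\<^esub> H \<otimes>\<^bsub>SL2R\<^esub> inv\<^bsub>SL2R\<^esub> A \<in> {mat 1, - mat 1}"
      by (auto simp: inv adj2_mult)
  qed
qed

lemma group_PSL2R: "group PSL2R"
  unfolding PSL2R_def by (rule normal.factorgroup_is_group[OF normal_center])

lemma carrier_PSL2R: "carrier PSL2R = proj ` {A. det A = 1}"
  by (auto simp: PSL2R_def FactGroup_def RCOSETS_def proj_def)

lemma proj_mult: "proj A \<otimes>\<^bsub>PSL2R\<^esub> proj B = proj (A ** B)"
  by (auto simp: PSL2R_def FactGroup_def set_mult_def proj_eq)

lemma one_PSL2R: "\<one>\<^bsub>PSL2R\<^esub> = proj (mat 1)"
  by (simp add: PSL2R_def FactGroup_def proj_eq)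

lemma inv_PSL2R: "det A = 1 \<Longrightarrow> inv\<^bsub>PSL2R\<^esub> (proj A) = proj (adj2 A)"
  by (rule group.inv_equality[OF group_PSL2R])
    (auto simp: carrier_PSL2R proj_mult one_PSL2R adj2_mult)

lemma proj_eq_iff: "proj A = proj B \<longleftrightarrow> A = B \<or> A = - B"
  by (auto simp: proj_eq doubleton_eq_iff)

lemma act_proj: "act (proj A) z = mobius A z"
  by (simp add: act_def proj_eq)

text \<open>Subgroups of SL(2,R) that contain -1, that is, full preimages of subgroups of PSL(2,R).
  Working with them replaces cosets by matrices throughout.\<close>

definition matgroup :: "(real^2^2) set \<Rightarrow> bool" where
  "matgroup G \<longleftrightarrow> (\<forall>A\<in>G. det A = 1) \<and> mat 1 \<in> G \<and> (\<forall>A\<in>G. \<forall>B\<in>G. A ** B \<in> G) \<and>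
     (\<forall>A\<in>G. adj2 A \<in> G) \<and> (\<forall>A\<in>G. - A \<in> G)"

lemma matgroupD:
  assumes "matgroup G"
  shows "A \<in> G \<Longrightarrow> det A = 1" "mat 1 \<in> G" "A \<in> G \<Longrightarrow> B \<in> G \<Longrightarrow> A ** B \<in> G"
    "A \<in> G \<Longrightarrow> adj2 A \<in> G" "A \<in> G \<Longrightarrow> - A \<in> G"
  using assms by (auto simp: matgroup_def)

lemma matgroup_preim:
  assumes "subgroup \<Gamma> PSL2R"
  shows "matgroup (preim \<Gamma>)"
proof -
  note c = subgroup.m_closed[OF assms] subgroup.m_inv_closed[OF assms]
  have 1: "proj (A ** B) \<in> \<Gamma>" if "proj A \<in> \<Gamma>" "proj B \<in> \<Gamma>" for A B
    using c(1)[OF that] by (simp add: proj_mult)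
  have 2: "proj (adj2 A) \<in> \<Gamma>" if "proj A \<in> \<Gamma>" "det A = 1" for A
    using c(2)[OF that(1)] that(2) by (simp add: inv_PSL2R)
  have 3: "proj (- A) = proj A" for A by (simp add: proj_eq_iff)
  have 4: "proj (mat 1) \<in> \<Gamma>" using subgroup.one_closed[OF assms] by (simp add: one_PSL2R)
  show ?thesis
    unfolding matgroup_def preim_def by (simp add: 1 2 3 4 det_mul)
qed

lemma proj_preim:
  assumes "\<Gamma> \<subseteq> carrier PSL2R"
  shows "proj ` preim \<Gamma> = \<Gamma>"
  using assms by (auto simp: preim_def carrier_PSL2R)

lemma orb_proj: "orb (proj ` G) z = (\<lambda>A. mobius A z) ` G"
proof -
  have "orb (proj ` G) z = (\<lambda>g. act g z) ` proj ` G"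
    by (auto simp: orb_def orbit_def)
  thus ?thesis by (simp add: image_image act_proj)
qed

lemma surface_proj: "surface (proj ` G) = (\<lambda>z. (\<lambda>A. mobius A z) ` G) ` \<H>"
  unfolding surface_def orbits_def orb_proj[symmetric] orb_def by auto

lemma mobius_orbit_eq:
  assumes "matgroup G" "A \<in> G" "z \<in> \<H>"
  shows "(\<lambda>B. mobius B (mobius A z)) ` G = (\<lambda>B. mobius B z) ` G"
proof -
  note g = matgroupD[OF assms(1)]
  have "mobius B (mobius A z) \<in> (\<lambda>B. mobius B z) ` G" if "B \<in> G" for B
    using that g assms by (intro image_eqI[of _ _ "B ** A"]) (auto simp: mobius_mult)
  moreover have "mobius B z \<in> (\<lambda>B. mobius B (mobius A z)) ` G" if "B \<in> G" for B
    using that g assms mobius_adj2(1)[of A z] mobius_mult[of "adj2 A" "mobius A z" B]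
    by (intro image_eqI[of _ _ "B ** adj2 A"]) (simp_all add: mobius_in_H)
  ultimately show ?thesis by blast
qed

section \<open>Cocompact groups\<close>

text \<open>A compact exhaustion of the upper half-plane for growing \<open>r\<close>, with one
  parameter bounding the height from below and the modulus from above.\<close>

definition Reg :: "real \<Rightarrow> complex set" where
  "Reg r = {z. 1 / r \<le> Im z \<and> cmod z \<le> r}"

lemma Reg_subset_H: "0 < r \<Longrightarrow> Reg r \<subseteq> \<H>"
proof
  fix z assume "0 < r" "z \<in> Reg r"
  moreover from this have "0 < 1 / r" by simp
  ultimately have "0 < Im z" unfolding Reg_def by (blast intro: less_le_trans)
  thus "z \<in> \<H>" by (simp add: upper_half_plane_def)
qed

lemma compact_Reg: "compact (Reg r)"
proof -
  have "Reg r = {z. 1 / r \<le> Im z} \<inter> cball 0 r"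
    by (auto simp: Reg_def)
  thus ?thesis
    by (simp add: closed_Int_compact closed_halfspace_Im_ge)
qed

lemma Reg_mono: "0 < r \<Longrightarrow> r \<le> s \<Longrightarrow> Reg r \<subseteq> Reg s"
  unfolding Reg_def by (smt (verit) Collect_mono frac_le zero_le_one)

lemma ii_in_Reg: "1 \<le> r \<Longrightarrow> \<i> \<in> Reg r"
  by (simp add: Reg_def)

lemma ii_in_H: "\<i> \<in> \<H>"
  by (simp add: upper_half_plane_def)

text \<open>Since the height of \<open>A z\<close> is \<open>Im z / |c z + d|^2\<close>, the factor
  \<open>c z + d\<close> has modulus at most \<open>r\<close>. Its imaginary part bounds
  \<open>c\<close>, and then \<open>d\<close> is bounded as well. The numerator
  \<open>a z + b\<close> equals \<open>A z\<close> times this factor and is treated in the same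
  way.\<close>

lemma entries_bounded:
  assumes "det A = 1" "1 \<le> r" "z \<in> Reg r" "mobius A z \<in> Reg r"
  shows "\<bar>A$i$j\<bar> \<le> 2 * r ^ 4"
proof -
  have zH: "z \<in> \<H>" and wH: "mobius A z \<in> \<H>" using assms Reg_subset_H[of r] by auto
  define u where "u = cocycle A z"
  have u0: "u \<noteq> 0" using cocycle_nonzero[OF assms(1) zH] by (simp add: u_def)
  have Imz: "1 / r \<le> Im z" "Im z \<le> r" "cmod z \<le> r"
    using assms(3) abs_Im_le_cmod[of z] by (auto simp: Reg_def)
  have Imw: "1 / r \<le> Im z / (cmod u)\<^sup>2" "cmod (mobius A z) \<le> r"
    using assms(4) Im_mobius[OF assms(1) zH] by (auto simp: Reg_def u_def)
  have "(cmod u)\<^sup>2 \<le> r * Im z"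
    using Imw(1) u0 assms(2) by (simp add: field_simps)
  also have "\<dots> \<le> r * r" using Imz(2) assms(2) by (intro mult_left_mono) auto
  finally have u: "cmod u \<le> r"
    using assms(2) by (simp add: power2_eq_square[symmetric] power2_le_iff_abs_le)
  have r: "1 \<le> r" "r \<le> r ^ 2" "r ^ 2 \<le> r ^ 3" "r ^ 3 \<le> r ^ 4" "1 \<le> r ^ 2"
    using assms(2) by (auto intro: self_le_power power_increasing one_le_power)
  have bnd: "\<bar>p\<bar> \<le> s * r" "\<bar>q\<bar> \<le> s + s * r * r"
    if pq: "cmod (of_real p * z + of_real q) \<le> s" for p q s
  proof -
    have s0: "0 \<le> s" using pq norm_ge_zero order_trans by blast
    have "\<bar>p\<bar> * Im z = \<bar>Im (of_real p * z + of_real q)\<bar>"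
      using zH by (simp add: abs_mult upper_half_plane_def)
    also have "\<dots> \<le> s" using pq abs_Im_le_cmod order_trans by blast
    finally have "\<bar>p\<bar> * Im z \<le> s" .
    moreover have "\<bar>p\<bar> * (1 / r) \<le> \<bar>p\<bar> * Im z" using Imz(1) by (intro mult_left_mono) auto
    ultimately have "\<bar>p\<bar> / r \<le> s" by simp
    thus p: "\<bar>p\<bar> \<le> s * r" using assms(2) by (simp add: field_simps)
    have "\<bar>q\<bar> = cmod ((of_real p * z + of_real q) - of_real p * z)" by simp
    also have "\<dots> \<le> cmod (of_real p * z + of_real q) + cmod (of_real p * z)" by (rule norm_triangle_ineq4)
    also have "\<dots> \<le> s + \<bar>p\<bar> * cmod z" using pq by (simp add: norm_mult)
    also have "\<bar>p\<bar> * cmod z \<le> (s * r) * r"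
      using p Imz(3) s0 assms(2) by (intro mult_mono) auto
    finally show "\<bar>q\<bar> \<le> s + s * r * r" by simp
  qed
  have 1: "\<bar>A$2$1\<bar> \<le> r * r" "\<bar>A$2$2\<bar> \<le> r + r * r * r"
    using bnd[of "A$2$1" "A$2$2" r] u by (simp_all add: u_def cocycle_def)
  have "of_real (A$1$1) * z + of_real (A$1$2) = mobius A z * u"
    using u0 by (simp add: mobius_cocycle u_def)
  hence "cmod (of_real (A$1$1) * z + of_real (A$1$2)) \<le> r * r"
    using u Imw(2) assms(2) by (simp add: norm_mult mult_mono)
  from bnd[OF this] have 2: "\<bar>A$1$1\<bar> \<le> r * r * r" "\<bar>A$1$2\<bar> \<le> r * r + r * r * r * r" by auto
  have r': "r * r = r ^ 2" "r * r * r = r ^ 3" "r * r * r * r = r ^ 4"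
    by (simp_all add: power2_eq_square power3_eq_cube power4_eq_xxxx)
  have "\<forall>i j. \<bar>A$i$j\<bar> \<le> 2 * r ^ 4"
    unfolding forall_2 using 1 2 r r'
    by - (intro conjI; linarith)
  thus ?thesis by blast
qed

lemma norm_mat2_le: "norm (A :: real^2^2) \<le> \<bar>A$1$1\<bar> + \<bar>A$1$2\<bar> + \<bar>A$2$1\<bar> + \<bar>A$2$2\<bar>"
proof -
  have "norm A \<le> norm (A$1) + norm (A$2)"
    using L2_set_le_sum[of UNIV "\<lambda>i. norm (A$i)"] by (simp add: norm_vec_def sum_2)
  moreover have "norm (A$i) \<le> \<bar>A$i$1\<bar> + \<bar>A$i$2\<bar>" for i
    using norm_le_l1_cart[of "A$i"] by (simp add: sum_2)
  ultimately show ?thesis by (smt (verit))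
qed

lemma entry_le_norm: "\<bar>(A :: real^2^2)$i$j\<bar> \<le> norm A"
proof -
  have "\<bar>A$i$j\<bar> \<le> norm (A$i)" by (rule component_le_norm_cart)
  also have "\<dots> \<le> norm A" by (rule Finite_Cartesian_Product.norm_nth_le)
  finally show ?thesis .
qed

text \<open>If \<open>A\<close> and \<open>B\<close> are close and have bounded entries, then the
  quotient of \<open>A\<close> and \<open>B\<close> is close to 1 and hence equal to 1 by
  discreteness. So the set is uniformly discrete as well as bounded.\<close>

lemma discrete_matgroup_finite:
  assumes G: "matgroup G" and d: "discrete G"
  shows "finite {A \<in> G. \<forall>i j. \<bar>A$i$j\<bar> \<le> b}" (is "finite ?X")
proof (cases "0 < b")
  case False
  have "?X \<subseteq> {0}"
    using False by (auto simp: mat2_eq_iff) (smt (verit))+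
  thus ?thesis by (rule finite_subset) simp
next
  case b: True
  have "mat 1 isolated_in G"
    using d matgroupD(2)[OF G] by (rule discreteD)
  then obtain e where e: "e > 0" "\<forall>y\<in>G. dist (mat 1) y < e \<longrightarrow> y = mat 1"
    unfolding isolated_in_dist_Ex_iff by (metis dist_commute)
  have "uniform_discrete ?X"
    unfolding uniform_discrete_def
  proof (intro exI[of _ "e / (8 * b)"] conjI ballI impI)
    \<comment> \<open>Each of the four entries of \<open>D\<close> is at most \<open>2 b\<close>
      times the distance of \<open>A\<close> and \<open>B\<close>, whence the factor 8.\<close>
    show "0 < e / (8 * b)" using e b by simp
    fix A B assume A: "A \<in> ?X" and B: "B \<in> ?X" and AB: "dist A B < e / (8 * b)"
    define D where "D = adj2 A ** B - mat 1"
    have dA: "det A = 1" using A matgroupD(1)[OF G] by blast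
    have D: "D$i$j = (adj2 A)$i$1 * (B - A)$1$j + (adj2 A)$i$2 * (B - A)$2$j" for i j
      using arg_cong[OF adj2_mult(1)[OF dA], of "\<lambda>M. M$i$j"]
      by (simp add: D_def mult2_nth algebra_simps)
    have le: "\<bar>(B - A)$i$j\<bar> \<le> dist A B" for i j
      using entry_le_norm[of "B - A" i j] by (simp add: dist_norm norm_minus_commute)
    have "\<forall>i j. \<bar>(adj2 A)$i$j\<bar> \<le> b"
      using A by (simp add: forall_2)
    hence D': "\<bar>D$i$j\<bar> \<le> b * dist A B + b * dist A B" for i j
      unfolding D by (intro order_trans[OF abs_triangle_ineq] add_mono)
        (auto simp only: abs_mult intro!: mult_mono le, (use b in auto))
    have "norm D \<le> 8 * (b * dist A B)"
      using norm_mat2_le[of D] D'[of 1 1] D'[of 1 2] D'[of 2 1] D'[of 2 2] by linarith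
    also have "\<dots> < e" using AB b by (simp add: field_simps)
    finally have "dist (mat 1) (adj2 A ** B) < e"
      by (simp add: D_def dist_norm norm_minus_commute)
    hence "adj2 A ** B = mat 1"
      using e(2) A B matgroupD(3,4)[OF G] by auto
    hence "A ** (adj2 A ** B) = A" by simp
    thus "A = B" using adj2_mult(2)[OF dA] by (simp add: matrix_mul_assoc)
  qed
  moreover have "bounded ?X"
    unfolding bounded_iff
  proof (intro exI[of _ "4 * b"] ballI)
    fix A assume "A \<in> ?X"
    hence "\<bar>A$i$j\<bar> \<le> b" for i j by blast
    from this[of 1 1] this[of 1 2] this[of 2 1] this[of 2 2] show "norm A \<le> 4 * b"
      using norm_mat2_le[of A] by linarith
  qed
  ultimately show ?thesis using uniform_discrete_finite_iff by blast
qed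

lemma orbits_disjoint:
  assumes "matgroup G" "p \<in> surface (proj ` G)" "q \<in> surface (proj ` G)" "x \<in> p" "x \<in> q"
  shows "p = q"
  using assms(2-5) unfolding surface_proj
  by clarify (metis mobius_orbit_eq[OF assms(1)])

lemma surface_union:
  assumes "matgroup G"
  shows "\<Union>(surface (proj ` G)) = \<H>"
  unfolding surface_proj using matgroupD(1,2)[OF assms] by (force intro: mobius_in_H)

lemma surface_topology_open:
  assumes "matgroup G"
  shows "openin (surface_topology (proj ` G)) = (\<lambda>U. U \<subseteq> surface (proj ` G) \<and> open (\<Union>U))"
  unfolding surface_topology_def
proof (rule topology_inverse')
  \<comment> \<open>Distinct orbits are disjoint, so a point in both unions lies on one orbit
    belonging to both families.\<close>
  have 1: "\<Union>(U \<inter> V) = \<Union>U \<inter> \<Union>V" if "U \<subseteq> surface (proj ` G)" "V \<subseteq> surface (proj ` G)" for U V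
    using orbits_disjoint[OF assms] that by fast
  have 2: "\<Union>(\<Union>K) = \<Union>(Union ` K)" for K :: "complex set set set" by auto
  show "istopology (\<lambda>U. U \<subseteq> surface (proj ` G) \<and> open (\<Union>U))"
    unfolding istopology_def by (auto simp: 1 2 simp del: Union_Int_subset) 
qed

text \<open>The orbits meeting the members of an open exhaustion of the half-plane form an open
  cover of the quotient. A finite subcover has a largest member, whose closure lies in some
  \<open>Reg r\<close>.\<close>

lemma cocompact_region:
  assumes G: "matgroup G" and c: "compact_space (surface_topology (proj ` G))"
  obtains r where "1 \<le> r" "\<forall>z\<in>\<H>. \<exists>A\<in>G. mobius A z \<in> Reg r"
proof -
  let ?S = "surface (proj ` G)"
  note op = surface_topology_open[OF G]
  have ts: "topspace (surface_topology (proj ` G)) = ?S"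
  proof
    show "topspace (surface_topology (proj ` G)) \<subseteq> ?S"
      using openin_topspace[of "surface_topology (proj ` G)"] unfolding op by blast
    show "?S \<subseteq> topspace (surface_topology (proj ` G))"
      by (rule openin_subset) (simp add: op surface_union[OF G] open_H)
  qed
  define V where "V n = {z. 1 / real n < Im z \<and> cmod z < real n}" for n
  define U where "U n = {p \<in> ?S. p \<inter> V n \<noteq> {}}" for n
  have VH: "V n \<subseteq> \<H>" for n
  proof
    fix z assume "z \<in> V n"
    moreover have "0 \<le> 1 / real n" by simp
    ultimately have "0 < Im z" unfolding V_def by (blast intro: le_less_trans)
    thus "z \<in> \<H>" by (simp add: upper_half_plane_def)
  qed
  have openV: "open (V n)" for n
  proof -
    have "V n = {z. 1 / real n < Im z} \<inter> ball 0 (real n)" by (auto simp: V_def)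
    thus ?thesis by (simp add: open_Int open_halfspace_Im_gt)
  qed
  have UU: "\<Union>(U n) = (\<Union>A\<in>G. mobius A ` V n)" for n
  proof (intro equalityI subsetI)
    fix x assume "x \<in> \<Union>(U n)"
    then obtain p y where p: "p \<in> ?S" "y \<in> p" "y \<in> V n" "x \<in> p" by (auto simp: U_def)
    have "y \<in> \<H>" using p VH by auto
    have "p = (\<lambda>A. mobius A y) ` G"
    proof (rule orbits_disjoint[OF G p(1) _ p(2)])
      show "(\<lambda>A. mobius A y) ` G \<in> ?S" using \<open>y \<in> \<H>\<close> by (auto simp: surface_proj)
      show "y \<in> (\<lambda>A. mobius A y) ` G" by (rule image_eqI[of _ _ "mat 1"]) (auto simp: matgroupD(2)[OF G])
    qed
    thus "x \<in> (\<Union>A\<in>G. mobius A ` V n)" using p by auto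
  next
    fix x assume "x \<in> (\<Union>A\<in>G. mobius A ` V n)"
    then obtain A y where A: "A \<in> G" "y \<in> V n" "x = mobius A y" by auto
    let ?p = "(\<lambda>A. mobius A y) ` G"
    have "?p \<in> ?S" using A VH by (auto simp: surface_proj)
    moreover have "y \<in> ?p" by (rule image_eqI[of _ _ "mat 1"]) (auto simp: matgroupD(2)[OF G])
    ultimately show "x \<in> \<Union>(U n)" using A by (auto simp: U_def)
  qed
  have opU: "openin (surface_topology (proj ` G)) (U n)" for n
    unfolding op UU using openV VH matgroupD(1)[OF G]
    by (auto simp: U_def intro!: open_UN open_mobius_image)
  have cov: "?S \<subseteq> \<Union>(range U)"
  proof
    fix p assume p: "p \<in> ?S"
    then obtain z where z: "z \<in> \<H>" "p = (\<lambda>A. mobius A z) ` G" by (auto simp: surface_proj)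
    have zp: "z \<in> p" unfolding z by (rule image_eqI[of _ _ "mat 1"]) (auto simp: matgroupD(2)[OF G])
    obtain n where n: "max (cmod z) (1 / Im z) < real n" using reals_Archimedean2 by blast
    have "0 < real n" using n norm_ge_zero[of z] by linarith
    hence "1 / real n < Im z" using n z(1) by (simp add: upper_half_plane_def) (simp add: field_simps)
    hence "z \<in> V n" using n by (simp add: V_def)
    thus "p \<in> \<Union>(range U)" using p zp by (auto simp: U_def)
  qed
  obtain F where F: "finite F" "F \<subseteq> range U" "?S \<subseteq> \<Union>F"
    using c opU cov unfolding compact_space_def compactin_def ts by (metis (no_types, lifting) imageE)
  then obtain N where N: "finite N" "F = U ` N" by (metis finite_subset_image)
  \<comment> \<open>The extra element 1 keeps the maximum defined for empty \<open>N\<close> and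
    gives \<open>1 \<le> m\<close>.\<close>
  define m where "m = Max (insert 1 N)"
  have m1: "1 \<le> m" using N by (simp add: m_def)
  show ?thesis
  proof (rule that[of "real m"])
    show "1 \<le> real m" using m1 by simp
    show "\<forall>z\<in>\<H>. \<exists>A\<in>G. mobius A z \<in> Reg (real m)"
    proof
      fix z assume z: "z \<in> \<H>"
      let ?p = "(\<lambda>A. mobius A z) ` G"
      have "?p \<in> ?S" using z by (auto simp: surface_proj)
      then obtain n where n: "n \<in> N" "?p \<in> U n" using F N by auto
      then obtain A where A: "A \<in> G" "mobius A z \<in> V n" by (auto simp: U_def)
      have nm: "n \<le> m" using N n by (simp add: m_def)
      have n0: "0 < real n"
        using A(2) by (auto simp: V_def) (metis norm_ge_zero not_less_zero of_nat_0_less_iff order_le_less_trans)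
      have "1 / real m \<le> 1 / real n" using nm n0 by (intro divide_left_mono) auto
      hence "mobius A z \<in> Reg (real m)"
        using A(2) nm by (auto simp: V_def Reg_def)
      thus "\<exists>A\<in>G. mobius A z \<in> Reg (real m)" using A by blast
    qed
  qed
qed

section \<open>Chains of short hyperbolic steps\<close>

lemma hypQ_le_1_Reg:
  assumes "1 \<le> r" "z \<in> Reg r" "w \<in> \<H>" "hypQ z w \<le> 1"
  shows "w \<in> Reg (3 * r)"
proof -
  define u v where "u = Im z" and "v = Im w"
  have zH: "z \<in> \<H>" using assms Reg_subset_H[of r] by auto
  have uv: "0 < u" "0 < v" using zH assms by (auto simp: u_def v_def upper_half_plane_def)
  have z: "1 / r \<le> u" "cmod z \<le> r" "u \<le> r"
    using assms(2) abs_Im_le_cmod[of z] by (auto simp: Reg_def u_def)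
  have d: "(cmod (z - w))\<^sup>2 \<le> u * v"
    using assms(4) uv by (simp add: hypQ_def u_def v_def)
  have "(u - v)\<^sup>2 \<le> (cmod (z - w))\<^sup>2"
    using abs_Im_le_cmod[of "z - w"] by (simp add: u_def v_def flip: abs_le_square_iff)
  hence 1: "(u - v)\<^sup>2 \<le> u * v" using d by simp
  \<comment> \<open>The inequality \<open>(u - v)^2 \<le> u v\<close> means
    \<open>u^2 + v^2 \<le> 3 u v\<close>, so neither height exceeds three times the other.\<close>
  have v3: "v \<le> 3 * u"
  proof (rule ccontr)
    assume "\<not> ?thesis"
    hence "0 < v * (v - 3 * u)" using uv by simp
    moreover have "(u - v)\<^sup>2 - u * v = u * u + v * (v - 3 * u)" by (simp add: power2_eq_square algebra_simps)
    ultimately show False using 1 mult_pos_pos[of u u] uv by linarith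
  qed
  have u3: "u \<le> 3 * v"
  proof (rule ccontr)
    assume "\<not> ?thesis"
    hence "0 < u * (u - 3 * v)" using uv by simp
    moreover have "(u - v)\<^sup>2 - u * v = v * v + u * (u - 3 * v)" by (simp add: power2_eq_square algebra_simps)
    ultimately show False using 1 mult_pos_pos[of v v] uv by linarith
  qed
  have "(cmod (z - w))\<^sup>2 \<le> r * (3 * r)"
    using d mult_mono[of u r v "3 * r"] z v3 uv assms(1) by linarith
  also have "\<dots> \<le> (2 * r)\<^sup>2" by (simp add: power2_eq_square)
  finally have "cmod (z - w) \<le> 2 * r" by (rule power2_le_imp_le) (use assms(1) in simp)
  hence "cmod w \<le> 3 * r" using z(2) norm_triangle_ineq4[of z "z - w"] by simp
  moreover have "1 / (3 * r) = (1 / r) / 3" by simp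
  hence "1 / (3 * r) \<le> v" using z(1) u3 by linarith
  ultimately show ?thesis by (simp add: Reg_def v_def)
qed

text \<open>A discrete substitute for a geodesic segment: what matters is that two points can be
  joined by a number of bounded steps that is logarithmic in \<open>hypQ\<close>, hence linear in
  the distance.\<close>

inductive chain :: "nat \<Rightarrow> complex \<Rightarrow> complex \<Rightarrow> bool" where
  chain_0: "z \<in> \<H> \<Longrightarrow> chain 0 z z"
| chain_Suc: "chain k z w \<Longrightarrow> w' \<in> \<H> \<Longrightarrow> hypQ w w' \<le> 1 \<Longrightarrow> chain (Suc k) z w'"

lemma chain_in_H: "chain k z w \<Longrightarrow> z \<in> \<H> \<and> w \<in> \<H>"
  by (induction rule: chain.induct) auto

lemma chain_trans:
  assumes "chain l w v" "chain k z w" shows "chain (k + l) z v"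
  using assms by (induction rule: chain.induct) (auto intro: chain_Suc)

lemma chain_step: "z \<in> \<H> \<Longrightarrow> w \<in> \<H> \<Longrightarrow> hypQ z w \<le> 1 \<Longrightarrow> chain 1 z w"
  using chain_Suc[OF chain_0] by simp

lemma chain_sym: "chain k z w \<Longrightarrow> chain k w z"
proof (induction rule: chain.induct)
  case (chain_Suc k z w w')
  have "chain 1 w' w" 
    using chain_Suc chain_in_H[of k z w] by (intro chain_step) (simp_all add: hypQ_commute)
  from chain_trans[OF chain_Suc.IH this] show ?case by simp
qed (auto intro: chain_0)

lemma chain_mobius:
  assumes "det A = 1" shows "chain k z w \<Longrightarrow> chain k (mobius A z) (mobius A w)"
proof (induction rule: chain.induct)
  case (chain_Suc k z w w')
  thus ?case using assms chain_in_H[of k z w]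
    by (auto intro!: chain.chain_Suc mobius_in_H simp: hypQ_mobius)
qed (auto intro: chain_0 mobius_in_H assms)

lemma chain_vertical_aux:
  assumes "0 < s" "s \<le> t" "t \<le> 2 ^ k * s"
  shows "chain k (Complex u s) (Complex u t)"
  using assms
proof (induction k arbitrary: t)
  case 0
  thus ?case by (auto intro!: chain_0 simp: upper_half_plane_def)
next
  case (Suc k)
  \<comment> \<open>One step halves the height, but never goes below \<open>s\<close>; a ratio of
    heights of at most 2 keeps \<open>hypQ\<close> at most 1.\<close>
  define t' where "t' = max s (t / 2)"
  have t': "s \<le> t'" "t' \<le> t" "t / 2 \<le> t'" "0 < t" using Suc by (auto simp: t'_def)
  have "s \<le> 2 ^ k * s" using Suc.prems by simp
  hence "t' \<le> 2 ^ k * s" using Suc.prems by (simp add: t'_def)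
  hence "chain k (Complex u s) (Complex u t')" using t' Suc by blast
  moreover have "(t' - t)\<^sup>2 \<le> t' * t"
  proof -
    have "(t' - t)\<^sup>2 = (t - t') * (t - t')" by (simp add: power2_eq_square algebra_simps)
    also have "\<dots> \<le> t' * t" using t' Suc.prems by (intro mult_mono) auto
    finally show ?thesis .
  qed
  hence "hypQ (Complex u t') (Complex u t) \<le> 1"
    using t' Suc.prems by (simp add: hypQ_def cmod_power2)
  ultimately show ?case
    using Suc.prems by (auto intro!: chain_Suc simp: upper_half_plane_def)
qed

text \<open>The least possible number of doublings is taken, so \<open>2 ^ k\<close> overshoots the
  ratio of the heights by at most a factor 2. Minimality says nothing for \<open>k = 0\<close>,
  which is treated separately.\<close>

lemma chain_vertical:
  assumes "0 < s" "s \<le> t"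
  obtains k where "chain k (Complex u s) (Complex u t)" "2 ^ k \<le> 2 * t / s"
proof -
  define k where "k = (LEAST k. t / s \<le> 2 ^ k)"
  have "\<exists>k. t / s \<le> 2 ^ k" using real_arch_pow[of 2 "t / s"] by (auto intro: less_imp_le)
  hence k: "t / s \<le> 2 ^ k" unfolding k_def by (rule LeastI_ex)
  have "2 ^ k \<le> 2 * t / s"
  proof (cases k)
    case 0
    have "s \<le> 2 * t" using assms by linarith
    thus ?thesis using 0 assms by simp
  next
    case (Suc j)
    hence "\<not> t / s \<le> 2 ^ j" using not_less_Least[of j "\<lambda>k. t / s \<le> 2 ^ k"] by (simp add: k_def)
    thus ?thesis using Suc by simp
  qed
  moreover have "chain k (Complex u s) (Complex u t)"
    using k assms by (intro chain_vertical_aux) (simp_all add: field_simps)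
  ultimately show ?thesis using that by blast
qed

text \<open>Go up to the height \<open>max 1 (max v \<bar>u\<bar>)\<close>, make one horizontal step there, and go down again.\<close>

lemma chain_from_ii:
  assumes "w \<in> \<H>"
  obtains k where "chain k \<i> w" "2 ^ k \<le> 8 * (2 + hypQ \<i> w)"
proof -
  define u v h where "u = Re w" and "v = Im w" and "h = max 1 (max v \<bar>u\<bar>)"
  have v: "0 < v" using assms by (simp add: v_def upper_half_plane_def)
  have h: "1 \<le> h" "v \<le> h" "\<bar>u\<bar> \<le> h" "h \<in> {1, v, \<bar>u\<bar>}"
    by (auto simp: h_def max_def)
  obtain k1 where k1: "chain k1 (Complex 0 1) (Complex 0 h)" "2 ^ k1 \<le> 2 * h / 1"
    using chain_vertical[of 1 h] h by auto
  obtain k2 where k2: "chain k2 (Complex u v) (Complex u h)" "2 ^ k2 \<le> 2 * h / v"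
    using chain_vertical[of v h] h v by auto
  have "u\<^sup>2 \<le> h\<^sup>2" using h by (simp add: abs_le_square_iff[symmetric])
  hence "hypQ (Complex 0 h) (Complex u h) \<le> 1"
    using h by (simp add: hypQ_def cmod_power2) (simp add: power2_eq_square)
  hence c: "chain 1 (Complex 0 h) (Complex u h)"
    using h by (intro chain_step) (auto simp: upper_half_plane_def)
  have "chain (k1 + 1 + k2) (Complex 0 1) (Complex u v)"
    by (rule chain_trans[OF chain_sym[OF k2(1)] chain_trans[OF c k1(1)]])
  moreover have "Complex 0 1 = \<i>" "Complex u v = w" by (simp_all add: u_def v_def complex_eq_iff)
  ultimately have "chain (k1 + 1 + k2) \<i> w" by simp
  moreover have "2 ^ (k1 + 1 + k2) \<le> 8 * (2 + hypQ \<i> w)"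
  proof -
    \<comment> \<open>Of the factor 8, a factor 2 comes from the horizontal step and a factor 2 from
      each vertical part.\<close>
    have "(2::real) ^ (k1 + 1 + k2) = 2 * (2 ^ k1 * 2 ^ k2)" by (simp add: power_add)
    also have "2 ^ k1 * 2 ^ k2 \<le> (2 * h) * (2 * h / v)"
      using k1(2) k2(2) h by (intro mult_mono) auto
    also have "(2 * h) * (2 * h / v) = 4 * (h\<^sup>2 / v)" by (simp add: power2_eq_square)
    also have "h\<^sup>2 \<le> 1 + u\<^sup>2 + v\<^sup>2" using h(4) by auto
    hence "4 * (h\<^sup>2 / v) \<le> 4 * ((1 + u\<^sup>2 + v\<^sup>2) / v)"
      using v by (intro mult_left_mono divide_right_mono) auto
    also have "(1 + u\<^sup>2 + v\<^sup>2) / v = 2 + hypQ \<i> w"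
    proof -
      have "hypQ \<i> w = (u\<^sup>2 + (1 - v)\<^sup>2) / v" by (simp add: hypQ_def cmod_power2 u_def v_def)
      also have "2 + \<dots> = (2 * v + (u\<^sup>2 + (1 - v)\<^sup>2)) / v" using v by (simp add: add_divide_distrib)
      also have "2 * v + (u\<^sup>2 + (1 - v)\<^sup>2) = 1 + u\<^sup>2 + v\<^sup>2" by (simp add: power2_eq_square algebra_simps)
      finally show ?thesis by simp
    qed
    finally show ?thesis by simp
  qed
  ultimately show ?thesis using that by blast
qed

lemma chain_exists:
  assumes "z \<in> \<H>" "w \<in> \<H>"
  obtains k where "chain k z w" "2 ^ k \<le> 8 * (2 + hypQ z w)"
proof -
  define y where "y = Im z"
  have y: "0 < y" using assms by (simp add: y_def upper_half_plane_def)
  \<comment> \<open>An upper triangular matrix that sends \<i> to \<open>z\<close>. By invariance it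
    reduces the claim to chains that start at \<i>.\<close>
  define A where "A = mat2 (sqrt y) (Re z / sqrt y) 0 (1 / sqrt y)"
  have A: "det A = 1" using y by (simp add: A_def det_2)
  have Ai: "mobius A \<i> = z"
  proof -
    have "mobius A \<i> = (of_real (sqrt y) * \<i> + of_real (Re z / sqrt y)) * of_real (sqrt y)"
      using y by (simp add: A_def mobius_def)
    also have "\<dots> = of_real (sqrt y * sqrt y) * \<i> + of_real (Re z)"
      using y by (simp add: algebra_simps flip: of_real_mult of_real_divide)
    also have "\<dots> = z" using y by (simp add: complex_eq_iff y_def)
    finally show ?thesis .
  qed
  obtain k where k: "chain k \<i> (mobius (adj2 A) w)" "2 ^ k \<le> 8 * (2 + hypQ \<i> (mobius (adj2 A) w))"
    using chain_from_ii[of "mobius (adj2 A) w"] A assms mobius_in_H[of "adj2 A" w] by auto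
  have "chain k z w"
    using chain_mobius[OF A k(1)] A assms by (simp add: Ai)
  moreover have "hypQ \<i> (mobius (adj2 A) w) = hypQ z w"
    using hypQ_mobius[of A \<i> "mobius (adj2 A) w"] A assms mobius_in_H[of "adj2 A" w] Ai ii_in_H by simp
  ultimately show ?thesis using that k(2) by simp
qed

section \<open>Words in a finite generating set\<close>

primrec mprod :: "(real^2^2) list \<Rightarrow> real^2^2" where
  "mprod [] = mat 1"
| "mprod (A # As) = A ** mprod As"

lemma mprod_append: "mprod (xs @ ys) = mprod xs ** mprod ys"
  by (induction xs) (auto simp: matrix_mul_assoc)

lemma mprod_in: "matgroup G \<Longrightarrow> set ws \<subseteq> G \<Longrightarrow> mprod ws \<in> G"
  by (induction ws) (auto simp: matgroupD)

text \<open>The preimage of a group acting freely and cocompactly on the half-plane.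
  \<open>Reg r\<close> is a compact set that meets every orbit, possibly many times; freeness says
  that stabilizers upstairs consist of 1 and -1.\<close>

locale cocompact_group =
  fixes G :: "(real^2^2) set" and r :: real
  assumes group: "matgroup G"
    and discrete: "discrete G"
    and r: "1 \<le> r"
    and cover: "\<And>z. z \<in> \<H> \<Longrightarrow> \<exists>A\<in>G. mobius A z \<in> Reg r"
    and free: "\<And>A z. A \<in> G \<Longrightarrow> z \<in> \<H> \<Longrightarrow> mobius A z = z \<Longrightarrow> A = mat 1 \<or> A = - mat 1"
begin

lemma G_closed [simp]:
  "A \<in> G \<Longrightarrow> det A = 1" "mat 1 \<in> G" "A \<in> G \<Longrightarrow> B \<in> G \<Longrightarrow> A ** B \<in> G"
  "A \<in> G \<Longrightarrow> adj2 A \<in> G" "A \<in> G \<Longrightarrow> - A \<in> G"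
  using matgroupD[OF group] by auto

lemma RegH: "z \<in> Reg r \<Longrightarrow> z \<in> \<H>"
  using Reg_subset_H[of r] r by auto

text \<open>The generators of the Milnor-Schwarz argument: the elements that bring the compact
  region within one step of itself.\<close>

definition S :: "(real^2^2) set" where
  "S = {A \<in> G. \<exists>x\<in>Reg r. \<exists>y\<in>Reg r. hypQ x (mobius A y) \<le> 1}"

lemma S_subset: "S \<subseteq> G"
  by (auto simp: S_def)

lemma finite_S: "finite S"
proof (rule finite_subset)
  show "S \<subseteq> {A \<in> G. \<forall>i j. \<bar>A$i$j\<bar> \<le> 2 * (3 * r) ^ 4}"
  proof
    fix A assume "A \<in> S"
    then obtain x y where A: "A \<in> G" "x \<in> Reg r" "y \<in> Reg r" "hypQ x (mobius A y) \<le> 1"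
      by (auto simp: S_def)
    have "mobius A y \<in> Reg (3 * r)"
      using A r RegH by (intro hypQ_le_1_Reg[of r x]) (auto intro: mobius_in_H)
    moreover have "y \<in> Reg (3 * r)" using Reg_mono[of r "3 * r"] r A by auto
    ultimately show "A \<in> {A \<in> G. \<forall>i j. \<bar>A$i$j\<bar> \<le> 2 * (3 * r) ^ 4}"
      using entries_bounded[of A "3 * r" y] A(1) r by simp
  qed
  show "finite {A \<in> G. \<forall>i j. \<bar>A$i$j\<bar> \<le> 2 * (3 * r) ^ 4}"
    by (rule discrete_matgroup_finite[OF group discrete])
qed

text \<open>Every point of the chain is carried into the compact region by some group element, and
  the quotient of the elements chosen at consecutive points is a generator. The starting point
  contributes a letter of its own, so the word is longer than the chain by one.\<close>

lemma chain_word: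
  assumes "chain k z w" "z \<in> Reg r" "B \<in> G" "mobius (adj2 B) w \<in> Reg r"
  shows "\<exists>ws. set ws \<subseteq> S \<and> length ws = Suc k \<and> mprod ws = B"
  using assms
proof (induction arbitrary: B rule: chain.induct)
  case (chain_0 z)
  have "hypQ z (mobius B (mobius (adj2 B) z)) \<le> 1"
    using chain_0 by simp
  hence "B \<in> S" unfolding S_def using chain_0 by blast
  thus ?case by (intro exI[of _ "[B]"]) simp
next
  case (chain_Suc k z w w' B')
  note H = chain_in_H[OF chain_Suc.hyps(1)]
  obtain C where C: "C \<in> G" "mobius C w \<in> Reg r" using cover[of w] H by auto
  define B where "B = adj2 C"
  have B: "B \<in> G" "mobius (adj2 B) w \<in> Reg r" using C by (auto simp: B_def)
  obtain ws where ws: "set ws \<subseteq> S" "length ws = Suc k" "mprod ws = B"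
    using chain_Suc.IH[OF chain_Suc.prems(1) B] by blast
  have w': "mobius (adj2 B') w' \<in> \<H>" using chain_Suc.prems(3) RegH by blast
  have "hypQ (mobius (adj2 B) w) (mobius (adj2 B ** B') (mobius (adj2 B') w')) =
        hypQ (mobius (adj2 B) w) (mobius (adj2 B) w')"
    using B chain_Suc w' by (simp add: mobius_mult)
  also have "\<dots> = hypQ w w'" using B H chain_Suc by (simp add: hypQ_mobius)
  also have "\<dots> \<le> 1" by fact
  finally have "adj2 B ** B' \<in> S"
    unfolding S_def using B chain_Suc.prems by auto
  moreover have "B ** (adj2 B ** B') = B'"
    using B by (simp add: matrix_mul_assoc adj2_mult)
  ultimately show ?case
    using ws by (intro exI[of _ "ws @ [adj2 B ** B']"]) (simp add: mprod_append)
qed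

text \<open>The constant 16 is the 8 from the chain, doubled for the additional letter of the
  word.\<close>

lemma word_of_displacement:
  assumes "A \<in> G" "z \<in> Reg r"
  obtains ws where "set ws \<subseteq> S" "mprod ws = A" "2 ^ length ws \<le> 16 * (2 + hypQ z (mobius A z))"
proof -
  have zH: "z \<in> \<H>" using assms RegH by auto
  obtain k where k: "chain k z (mobius A z)" "2 ^ k \<le> 8 * (2 + hypQ z (mobius A z))"
    using chain_exists[of z "mobius A z"] zH mobius_in_H[of A z] assms by auto
  obtain ws where "set ws \<subseteq> S" "length ws = Suc k" "mprod ws = A"
    using chain_word[OF k(1) assms(2,1)] assms zH by auto
  thus ?thesis using that[of ws] k(2) by simp
qed

lemma S_generates: "A \<in> G \<Longrightarrow> \<exists>ws. set ws \<subseteq> S \<and> mprod ws = A"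
  using word_of_displacement[OF _ ii_in_Reg[OF r]] by metis

lemma conjugate_into_Reg:
  assumes "A \<in> G" "z \<in> \<H>"
  obtains B where "B \<in> G" "mobius B z \<in> Reg r" "B ** A ** adj2 B \<in> G"
    "hypQ (mobius B z) (mobius (B ** A ** adj2 B) (mobius B z)) = hypQ z (mobius A z)"
proof -
  obtain B where B: "B \<in> G" "mobius B z \<in> Reg r" using cover[OF assms(2)] by blast
  have "mobius (B ** A ** adj2 B) (mobius B z) = mobius (B ** A) z"
    using assms B mobius_mult[of "adj2 B" "mobius B z" "B ** A"] by (simp add: mobius_in_H)
  also have "\<dots> = mobius B (mobius A z)" using assms by (simp add: mobius_mult)
  finally have "hypQ (mobius B z) (mobius (B ** A ** adj2 B) (mobius B z)) = hypQ z (mobius A z)"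
    using assms B by (simp add: hypQ_mobius mobius_in_H)
  thus ?thesis using that B assms(1) by simp
qed

text \<open>After conjugation the point lies in the compact region. If the displacement is at most
  1, the conjugate is one of the finitely many generators, and each nontrivial generator has a
  positive minimum displacement on the compact region because it fixes no point.\<close>

lemma displacement:
  obtains \<epsilon> where "0 < \<epsilon>"
    "\<And>A z. A \<in> G \<Longrightarrow> A \<noteq> mat 1 \<Longrightarrow> A \<noteq> - mat 1 \<Longrightarrow> z \<in> \<H> \<Longrightarrow> \<epsilon> \<le> hypQ z (mobius A z)"
proof -
  have "\<exists>m>0. \<forall>z\<in>Reg r. m \<le> hypQ z (mobius A z)"
    if A: "A \<in> G" "A \<noteq> mat 1" "A \<noteq> - mat 1" for A
  proof -
    have "continuous_on (Reg r) (\<lambda>z. hypQ z (mobius A z))"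
      unfolding hypQ_def
      using continuous_on_subset[OF continuous_on_mobius[of A], of "Reg r"] A RegH
        mobius_in_H[of A]
      by (intro continuous_intros) (force simp: upper_half_plane_def)+
    then obtain x where x: "x \<in> Reg r" "\<forall>z\<in>Reg r. hypQ x (mobius A x) \<le> hypQ z (mobius A z)"
      using continuous_attains_inf[OF compact_Reg, of r "\<lambda>z. hypQ z (mobius A z)"] ii_in_Reg[OF r] by blast
    have "hypQ x (mobius A x) \<noteq> 0"
      using mobius_fixed_iff[of A x] free[of A x] A x RegH by auto
    moreover have "0 \<le> hypQ x (mobius A x)"
      using A x RegH by (intro hypQ_nonneg) (auto intro: mobius_in_H)
    ultimately show ?thesis using x by (intro exI[of _ "hypQ x (mobius A x)"]) auto
  qed
  then obtain m where m: "\<And>A. A \<in> G \<Longrightarrow> A \<noteq> mat 1 \<Longrightarrow> A \<noteq> - mat 1 \<Longrightarrow>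
      0 < m A \<and> (\<forall>z\<in>Reg r. m A \<le> hypQ z (mobius A z))" by metis
  define T where "T = S - {mat 1, - mat 1}"
  define \<epsilon> where "\<epsilon> = Min (insert 1 (m ` T))"
  have fT: "finite (insert 1 (m ` T))" using finite_S by (simp add: T_def)
  have TD: "A \<in> T \<Longrightarrow> A \<in> G \<and> A \<noteq> mat 1 \<and> A \<noteq> - mat 1" for A using S_subset by (auto simp: T_def)
  have le: "\<epsilon> \<le> 1" "A \<in> T \<Longrightarrow> \<epsilon> \<le> m A" for A using fT by (auto simp: \<epsilon>_def intro: Min_le)
  show ?thesis
  proof (rule that[of \<epsilon>])
    have "\<forall>x\<in>insert 1 (m ` T). 0 < x" using TD m by auto
    thus "0 < \<epsilon>" unfolding \<epsilon>_def using fT by (simp add: Min_gr_iff)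
    fix A z assume A: "A \<in> G" "A \<noteq> mat 1" "A \<noteq> - mat 1" and z: "z \<in> \<H>"
    obtain B where B: "B \<in> G" "mobius B z \<in> Reg r" "B ** A ** adj2 B \<in> G"
      "hypQ (mobius B z) (mobius (B ** A ** adj2 B) (mobius B z)) = hypQ z (mobius A z)"
      using conjugate_into_Reg[OF A(1) z] .
    define A' where "A' = B ** A ** adj2 B"
    have A': "A' \<in> G" and Q: "hypQ (mobius B z) (mobius A' (mobius B z)) = hypQ z (mobius A z)"
      using B by (simp_all add: A'_def)
    have conj: "adj2 B ** A' ** B = A"
      using B(1) by (simp add: A'_def matrix_mul_assoc adj2_mult)
        (simp add: adj2_mult flip: matrix_mul_assoc)
    have ne: "A' \<noteq> mat 1" "A' \<noteq> - mat 1"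
      using conj A B(1) by (auto simp: adj2_mult)
    show "\<epsilon> \<le> hypQ z (mobius A z)"
    proof (cases "hypQ z (mobius A z) \<le> 1")
      case True
      hence "A' \<in> S" unfolding S_def using A' B(2) Q by (auto intro!: bexI[of _ "mobius B z"])
      hence "A' \<in> T" using ne by (simp add: T_def)
      thus ?thesis using le(2)[of A'] m[OF A' ne] B(2) Q by fastforce
    next
      case False
      thus ?thesis using le(1) by simp
    qed
  qed
qed

text \<open>An element with trace of absolute value at most 2 either fixes a point (elliptic) or
  moves suitable points arbitrarily little (parabolic); both contradict the uniform displacement
  bound. Here \<open>- D\<close> is the discriminant of the fixed point polynomial.\<close>

lemma trace_gt_2:
  assumes A: "A \<in> G" "A \<noteq> mat 1" "A \<noteq> - mat 1"
  shows "2 < \<bar>trace A\<bar>"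
proof (rule ccontr)
  assume "\<not> ?thesis"
  hence tr: "\<bar>trace A\<bar> \<le> 2" by simp
  obtain \<epsilon> where eps: "0 < \<epsilon>" "\<And>z. z \<in> \<H> \<Longrightarrow> \<epsilon> \<le> hypQ z (mobius A z)"
    using displacement A by metis
  define a b c d where "a = A$1$1" and "b = A$1$2" and "c = A$2$1" and "d = A$2$2"
  have det: "a * d - b * c = 1" using G_closed(1)[OF A(1)] by (simp add: det_2 a_def b_def c_def d_def)
  define D where "D = 4 - (a + d)\<^sup>2"
  have D0: "0 \<le> D"
    using tr power_mono[OF tr, of 2] by (simp add: D_def trace2 a_def d_def)
  have D: "(d - a)\<^sup>2 + 4 * b * c = - D" using det by (simp add: D_def power2_eq_square algebra_simps)
  note Q = hypQ_displacement[OF G_closed(1)[OF A(1)], folded a_def b_def c_def d_def]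
  show False
  proof (cases "c = 0")
    case True
    hence "d - a = 0" 
    proof -
      have "(d - a)\<^sup>2 = - D" using D True by simp
      hence "(d - a)\<^sup>2 \<le> 0" using D0 by simp
      thus ?thesis by simp
    qed
    \<comment> \<open>\<open>A\<close> is up to sign a horizontal translation, whose displacement
      \<open>b^2 / y^2\<close> tends to 0 at large height.\<close>
    define y where "y = sqrt (b\<^sup>2 / \<epsilon>) + 1"
    have y: "b\<^sup>2 / \<epsilon> < y\<^sup>2" "0 < y"
    proof -
      have s: "0 \<le> sqrt (b\<^sup>2 / \<epsilon>)" using eps by simp
      thus "0 < y" unfolding y_def by linarith
      have "(sqrt (b\<^sup>2 / \<epsilon>))\<^sup>2 < y\<^sup>2" using s by (intro power_strict_mono) (auto simp: y_def)
      thus "b\<^sup>2 / \<epsilon> < y\<^sup>2" using eps by simp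
    qed
    have zH: "Complex 0 y \<in> \<H>" using y by (simp add: upper_half_plane_def)
    have "hypQ (Complex 0 y) (mobius A (Complex 0 y)) = b\<^sup>2 / y\<^sup>2"
      unfolding Q[OF zH] using True \<open>d - a = 0\<close> by simp
    also have "\<dots> < \<epsilon>" using y eps by (simp add: field_simps)
    finally show False using eps(2)[OF zH] by simp
  next
    case False
    \<comment> \<open>Completing the square: above \<open>x0\<close> the fixed point polynomial
      takes the real values \<open>D / (4 c) - c y^2\<close>.\<close>
    define x0 where "x0 = (a - d) / (2 * c)"
    have val: "of_real c * (Complex x0 y)\<^sup>2 + of_real (d - a) * Complex x0 y - of_real b =
        of_real (D / (4 * c) - c * y\<^sup>2)" for y
    proof -
      have e: "d - a = - 2 * c * x0" using False by (simp add: x0_def)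
      have "D = - (4 * (c * c) * (x0 * x0)) - 4 * b * c"
        using D unfolding e by (simp add: power2_eq_square algebra_simps)
      hence "D / (4 * c) = - c * (x0 * x0) - b" using False by (simp add: field_simps)
      thus ?thesis
        unfolding e by (simp add: complex_eq_iff power2_eq_square algebra_simps)
    qed
    show False
    proof (cases "D = 0")
      case True
      \<comment> \<open>Parabolic case: \<open>x0\<close> is the fixed point on the boundary, and
        the displacement \<open>(c y)^2\<close> tends to 0 on the way down to it. This height makes
        it equal to \<open>\<epsilon> / 4\<close>.\<close>
      define y where "y = sqrt \<epsilon> / (2 * \<bar>c\<bar>)"
      have y: "0 < y" using eps False by (simp add: y_def)
      have zH: "Complex x0 y \<in> \<H>" using y by (simp add: upper_half_plane_def)
      have "hypQ (Complex x0 y) (mobius A (Complex x0 y)) = (c * y\<^sup>2)\<^sup>2 / y\<^sup>2"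
        unfolding Q[OF zH] val True by (simp add: norm_mult norm_power power_mult_distrib)
      also have "\<dots> = (c * y)\<^sup>2" using y by (simp add: power2_eq_square)
      also have "\<dots> = \<epsilon> / 4" using eps False by (simp add: y_def power_mult_distrib power_divide)
      finally show False using eps(2)[OF zH] eps(1) by simp
    next
      case ne: False
      \<comment> \<open>Elliptic case: at this height the point above \<open>x0\<close> is a zero of
        the polynomial, hence a fixed point.\<close>
      define y where "y = sqrt D / (2 * \<bar>c\<bar>)"
      have y: "0 < y" using D0 ne False by (simp add: y_def)
      have zH: "Complex x0 y \<in> \<H>" using y by (simp add: upper_half_plane_def)
      have "c * y\<^sup>2 = D / (4 * c)"
        using D0 False by (simp add: y_def power_divide power_mult_distrib power2_eq_square)
      hence "hypQ (Complex x0 y) (mobius A (Complex x0 y)) = 0"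
        unfolding Q[OF zH] val by simp
      thus False using eps(2)[OF zH] eps(1) by simp
    qed
  qed
qed

text \<open>Otherwise the half-plane would be a finite union of compact translates of
  \<open>Reg r\<close>.\<close>

lemma infinite_G: "infinite G"
proof
  assume fin: "finite G"
  have "\<H> = (\<Union>A\<in>G. mobius A ` Reg r)"
  proof (intro equalityI subsetI)
    fix z assume z: "z \<in> \<H>"
    then obtain A where A: "A \<in> G" "mobius A z \<in> Reg r" using cover by blast
    have "z = mobius (adj2 A) (mobius A z)" using A z by simp
    thus "z \<in> (\<Union>A\<in>G. mobius A ` Reg r)" using A by (intro UN_I[of "adj2 A"]) auto
  qed (auto intro!: mobius_in_H dest: RegH)
  moreover have "compact (mobius A ` Reg r)" if "A \<in> G" for A
    using that RegH continuous_on_subset[OF continuous_on_mobius[of A], of "Reg r"]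
    by (intro compact_continuous_image compact_Reg) auto
  ultimately have "compact \<H>" using fin compact_UN[of G "\<lambda>A. mobius A ` Reg r"] by simp
  then obtain b where b: "\<forall>z\<in>\<H>. cmod z \<le> b" using compact_imp_bounded bounded_iff by blast
  have "Complex 0 (\<bar>b\<bar> + 1) \<in> \<H>" by (simp add: upper_half_plane_def)
  thus False using b abs_Im_le_cmod[of "Complex 0 (\<bar>b\<bar> + 1)"] by (smt (verit) complex.sel(2))
qed

lemma countable_G: "countable G"
proof -
  have "G \<subseteq> (\<Union>n::nat. {A \<in> G. \<forall>i j. \<bar>A$i$j\<bar> \<le> real n})"
  proof
    fix A assume A: "A \<in> G"
    obtain n where "norm A \<le> real n" using real_arch_simple by blast
    from A order_trans[OF entry_le_norm[of A] this] show "A \<in> (\<Union>n::nat. {A \<in> G. \<forall>i j. \<bar>A$i$j\<bar> \<le> real n})"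
      by blast
  qed
  thus ?thesis
    by (rule countable_subset)
      (intro countable_UN countableI_type countable_finite[OF discrete_matgroup_finite[OF group discrete]])
qed

end

section \<open>Hyperbolic area\<close>

text \<open>Passage to \<open>real^2\<close>, where the substitution rule with Jacobian determinants
  applies.\<close>

definition cplx :: "real^2 \<Rightarrow> complex" where "cplx v = Complex (v$1) (v$2)"
definition vec2 :: "complex \<Rightarrow> real^2" where "vec2 z = vector [Re z, Im z]"

lemma vec2_nth [simp]: "vec2 z $ 1 = Re z" "vec2 z $ 2 = Im z"
  by (simp_all add: vec2_def)

lemma Re_Im_cplx [simp]: "Re (cplx v) = v$1" "Im (cplx v) = v$2"
  by (simp_all add: cplx_def)

lemma cplx_vec2 [simp]: "cplx (vec2 z) = z" "vec2 (cplx v) = v"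
  by (simp_all add: complex_eq_iff Finite_Cartesian_Product.vec_eq_iff forall_2)

lemma linear_cplx: "linear cplx"
  by (auto intro!: linearI simp: complex_eq_iff)

lemma linear_vec2: "linear vec2"
  by (auto intro!: linearI simp: Finite_Cartesian_Product.vec_eq_iff forall_2)

lemma borel_cplx [measurable]: "cplx \<in> borel_measurable borel"
  using linear_cplx by (simp add: borel_measurable_continuous_onI linear_continuous_on linear_conv_bounded_linear)

lemma Basis_real2: "(Basis :: (real^2) set) = {axis 1 1, axis 2 1}"
  by (auto simp: Basis_vec_def UNIV_2)

lemma lborel_cplx: "(lborel :: complex measure) = distr lborel borel cplx"
proof (rule lborel_eqI)
  fix l u :: complex
  assume le: "\<And>b. b \<in> Basis \<Longrightarrow> l \<bullet> b \<le> u \<bullet> b"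
  have lu: "Re l \<le> Re u" "Im l \<le> Im u" using le[of 1] le[of \<i>] by (auto simp: Basis_complex_def inner_complex_def)
  have "cplx -` box l u \<inter> space lborel = box (vec2 l) (vec2 u)"
    by (auto simp: mem_box_cart forall_2 mem_box Basis_complex_def inner_complex_def)
  hence "emeasure (distr lborel borel cplx) (box l u) = emeasure lborel (box (vec2 l) (vec2 u))"
    by (subst emeasure_distr) auto
  also have "\<dots> = (\<Prod>b\<in>Basis. (vec2 u - vec2 l) \<bullet> b)"
    using lu by (intro emeasure_lborel_box) (auto simp: Basis_real2 inner_axis)
  also have "\<dots> = (\<Prod>b\<in>Basis. (u - l) \<bullet> b)"
    by (simp add: Basis_real2 Basis_complex_def inner_axis inner_complex_def axis_eq_axis complex_eq_iff)
  finally show "emeasure (distr lborel borel cplx) (box l u) = (\<Prod>b\<in>Basis. (u - l) \<bullet> b)" .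
qed simp

lemma sets_hyp_measure [simp]: "sets hyp_measure = sets borel"
  by (simp add: hyp_measure_def)

lemma H_borel [measurable]: "\<H> \<in> sets borel"
  using open_H by auto

lemma borel_Reg [measurable]: "Reg r \<in> sets borel"
  by (intro borel_closed compact_imp_closed compact_Reg)

lemma vec2_image_eq: "vec2 ` E = cplx -` E"
  by (auto simp: image_iff) (metis cplx_vec2(2))

lemma borel_vec2_image: "E \<in> sets borel \<Longrightarrow> vec2 ` E \<in> sets borel"
  unfolding vec2_image_eq using measurable_sets[OF borel_cplx, of E] by simp

lemma hyp_measure_real2:
  assumes E: "E \<in> sets borel" "E \<subseteq> \<H>"
  shows "emeasure hyp_measure E = (\<integral>\<^sup>+v. ennreal (1 / (v$2)\<^sup>2) * indicator (vec2 ` E) v \<partial>lborel)"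
proof -
  note [measurable] = E(1)
  have "emeasure hyp_measure E = (\<integral>\<^sup>+z. ennreal (indicator \<H> z / (Im z)\<^sup>2) * indicator E z \<partial>lborel)"
    unfolding hyp_measure_def by (rule emeasure_density) auto
  also have "\<dots> = (\<integral>\<^sup>+v. ennreal (indicator \<H> (cplx v) / (Im (cplx v))\<^sup>2) * indicator E (cplx v) \<partial>lborel)"
    by (subst lborel_cplx, subst nn_integral_distr) auto
  also have "\<dots> = (\<integral>\<^sup>+v. ennreal (1 / (v$2)\<^sup>2) * indicator (vec2 ` E) v \<partial>lborel)"
    by (intro nn_integral_cong) (use E in \<open>auto simp: vec2_image_eq indicator_def\<close>)
  finally show ?thesis .
qed

lemma hyp_measure_has_integral:
  assumes "E \<in> sets borel" "E \<subseteq> \<H>" "((\<lambda>v. 1 / (v$2)\<^sup>2) has_integral I) (vec2 ` E)"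
  shows "emeasure hyp_measure E = ennreal I"
  unfolding hyp_measure_real2[OF assms(1,2)]
  using nn_integral_has_integral_lebesgue'[OF _ assms(3)] by simp

lemma emeasure_lborel_Reg: "emeasure lborel (Reg r) < \<infinity>"
  using compact_Reg emeasure_compact_finite by blast

lemma hyp_measure_Reg_finite:
  assumes "1 \<le> r"
  shows "emeasure hyp_measure (Reg r) < \<infinity>"
proof -
  have "emeasure hyp_measure (Reg r) = (\<integral>\<^sup>+z. ennreal (indicator \<H> z / (Im z)\<^sup>2) * indicator (Reg r) z \<partial>lborel)"
    unfolding hyp_measure_def by (rule emeasure_density) auto
  also have "\<dots> \<le> (\<integral>\<^sup>+z. ennreal (r\<^sup>2) * indicator (Reg r) z \<partial>lborel)"
  proof (intro nn_integral_mono)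
    fix z
    show "ennreal (indicator \<H> z / (Im z)\<^sup>2) * indicator (Reg r) z \<le> ennreal (r\<^sup>2) * indicator (Reg r) z"
    proof (cases "z \<in> Reg r")
      case True
      hence z: "1 / r \<le> Im z" "0 < 1 / r" using assms by (auto simp: Reg_def)
      have "(1 / r)\<^sup>2 \<le> (Im z)\<^sup>2" using z by (intro power_mono) auto
      hence "1 / (Im z)\<^sup>2 \<le> 1 / (1 / r)\<^sup>2"
        using z(2) by (intro divide_left_mono) (auto intro!: mult_pos_pos zero_less_power order_less_le_trans[OF z(2) z(1)])
      also have "\<dots> = r\<^sup>2" by (simp add: power_divide)
      finally have "indicator \<H> z / (Im z)\<^sup>2 \<le> r\<^sup>2" by (auto simp: indicator_def)
      thus ?thesis using True by (simp add: ennreal_leI)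
    qed simp
  qed
  also have "\<dots> = ennreal (r\<^sup>2) * emeasure lborel (Reg r)"
    by (rule nn_integral_cmult_indicator) simp
  also have "\<dots> < \<infinity>" using emeasure_lborel_Reg[of r] by (simp add: ennreal_mult_less_top)
  finally show ?thesis .
qed

lemma mobius_has_field_derivative:
  assumes "det A = 1" "z \<in> \<H>"
  shows "(mobius A has_field_derivative 1 / (cocycle A z)\<^sup>2) (at z within Y)"
proof -
  have 1: "complex_of_real (A$1$1) * of_real (A$2$2) - of_real (A$1$2) * of_real (A$2$1) = 1"
    using arg_cong[OF assms(1), of complex_of_real] by (simp add: det_2)
  define u where "u = of_real (A$1$1) * z + of_real (A$1$2)"
  have "(mobius A has_field_derivative
      (of_real (A$1$1) * cocycle A z - u * of_real (A$2$1)) / (cocycle A z * cocycle A z)) (at z within Y)"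
    unfolding mobius_def[abs_def] cocycle_def u_def using cocycle_nonzero[OF assms]
    by (auto intro!: derivative_eq_intros simp: cocycle_def)
  moreover have "of_real (A$1$1) * cocycle A z - u * of_real (A$2$1) = 1"
    using 1 by (simp add: u_def cocycle_def algebra_simps)
  ultimately show ?thesis by (simp add: power2_eq_square)
qed

lemma det_complex_mult: "det (matrix (\<lambda>h. vec2 (m * cplx h))) = (cmod m)\<^sup>2"
proof -
  have a: "cplx (axis 1 1) = 1" "cplx (axis 2 1) = \<i>"
    by (simp_all add: complex_eq_iff axis_def)
  show ?thesis
    by (simp add: det_2 matrix_def a cmod_power2 axis_def) (simp add: power2_eq_square)
qed

text \<open>The Jacobian \<open>|c z + d|^(-4)\<close> cancels exactly against the change of the
  density \<open>1 / y^2\<close>. Restriction to subsets of \<open>Reg r\<close> makes the integral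
  finite, so that the substitution rule for integrable functions can be used.\<close>

lemma hyp_measure_mobius_bounded:
  assumes A: "det A = 1" and E: "E \<in> sets borel" "E \<subseteq> Reg r" and r: "1 \<le> r"
  shows "emeasure hyp_measure (mobius A ` E) = emeasure hyp_measure E"
proof -
  have EH: "E \<subseteq> \<H>" using E(2) Reg_subset_H[of r] r by auto
  define S where "S = vec2 ` E"
  define F where "F = (\<lambda>v::real^2. 1 / (v$2)\<^sup>2)"
  define g where "g = (\<lambda>v. vec2 (mobius A (cplx v)))"
  define g' where "g' = (\<lambda>v h. vec2 (1 / (cocycle A (cplx v))\<^sup>2 * cplx h))"
  have [measurable]: "S \<in> sets borel" using borel_vec2_image E by (simp add: S_def)
  note Reg = borel_Reg[of r]
  have SH: "cplx v \<in> \<H>" if "v \<in> S" for v using that EH by (auto simp: S_def)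
  have img: "vec2 ` mobius A ` E = g ` S" by (simp add: S_def g_def image_image)
  have "emeasure hyp_measure E \<le> emeasure hyp_measure (Reg r)"
    using E Reg by (intro emeasure_mono) auto
  hence fin: "emeasure hyp_measure E < \<infinity>" using hyp_measure_Reg_finite[OF r] by (rule le_less_trans)
  then obtain I where I: "emeasure hyp_measure E = ennreal I" "0 \<le> I"
    by (cases "emeasure hyp_measure E") auto
  have "(\<integral>\<^sup>+v. ennreal (F v * indicator S v) \<partial>lborel) = ennreal I"
    unfolding I(1)[symmetric] hyp_measure_real2[OF E(1) EH] S_def F_def
    by (intro nn_integral_cong) (auto simp: indicator_def)
  hence "((\<lambda>v. F v * indicator S v) has_integral I) UNIV"
    using I(2) by (intro nn_integral_has_integral) (auto simp: F_def indicator_def)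
  moreover have "(\<lambda>v. F v * indicator S v) = (\<lambda>v. if v \<in> S then F v else 0)" by auto
  ultimately have hasS: "(F has_integral I) S" by (simp add: has_integral_restrict_UNIV)
  have S: "S \<in> sets lebesgue" by simp
  have der: "(g has_derivative g' v) (at v within S)" if "v \<in> S" for v
  proof -
    have "(mobius A has_derivative (\<lambda>h. 1 / (cocycle A (cplx v))\<^sup>2 * h)) (at (cplx v) within cplx ` S)"
      using mobius_has_field_derivative[OF A SH[OF that], of "cplx ` S"]
      by (simp only: has_field_derivative_def)
    from has_derivative_in_compose[OF linear_imp_has_derivative[OF linear_cplx] this]
    have "((\<lambda>v. mobius A (cplx v)) has_derivative (\<lambda>h. 1 / (cocycle A (cplx v))\<^sup>2 * cplx h)) (at v within S)" .
    from has_derivative_compose[OF this linear_imp_has_derivative[OF linear_vec2]]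
    show ?thesis by (simp add: g_def g'_def)
  qed
  have inj: "inj_on g S"
  proof (rule inj_onI)
    fix v w assume vw: "v \<in> S" "w \<in> S" "g v = g w"
    hence "cplx (g v) = cplx (g w)" by simp
    hence "mobius A (cplx v) = mobius A (cplx w)" by (simp add: g_def)
    hence "cplx v = cplx w" using mobius_adj2(1)[OF A] SH vw by metis
    thus "v = w" by (metis cplx_vec2(2))
  qed
  have jac: "\<bar>det (matrix (g' v))\<bar> * F (g v) = F v" if "v \<in> S" for v
  proof -
    have nz: "cmod (cocycle A (cplx v)) \<noteq> 0" using cocycle_nonzero[OF A SH[OF that]] by simp
    have "det (matrix (g' v)) = (1 / (cmod (cocycle A (cplx v)))\<^sup>2)\<^sup>2"
      unfolding g'_def det_complex_mult by (simp add: norm_divide norm_power)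
    moreover have "F (g v) = 1 / (v$2 / (cmod (cocycle A (cplx v)))\<^sup>2)\<^sup>2"
      using Im_mobius[OF A SH[OF that]] by (simp add: F_def g_def)
    ultimately show ?thesis using nz by (simp add: F_def power_divide)
  qed
  have aS: "F absolutely_integrable_on S"
    using hasS by (intro nonnegative_absolutely_integrable_1) (auto simp: F_def has_integral_iff)
  \<comment> \<open>The substitution rule is used for vector-valued integrands, hence the wrapping
    of the density in \<open>real^1\<close>.\<close>
  have cov: "(\<lambda>v. \<bar>det (matrix (g' v))\<bar> *\<^sub>R (vec (F (g v)) :: real^1)) absolutely_integrable_on S \<and>
       integral S (\<lambda>v. \<bar>det (matrix (g' v))\<bar> *\<^sub>R (vec (F (g v)) :: real^1)) = vec I \<longleftrightarrow>
     (\<lambda>v. vec (F v) :: real^1) absolutely_integrable_on (g ` S) \<and> integral (g ` S) (\<lambda>v. vec (F v) :: real^1) = vec I"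
    using has_absolute_integral_change_of_variables[OF S der inj, of "\<lambda>v. vec (F v)" "vec I"] by simp
  have "(\<lambda>v. \<bar>det (matrix (g' v))\<bar> * F (g v)) absolutely_integrable_on S"
    using aS by (rule absolutely_integrable_spike[where S = "{}"]) (simp_all add: jac)
  moreover have "integral S (\<lambda>v. \<bar>det (matrix (g' v))\<bar> * F (g v)) = I"
    using hasS by (subst integral_cong[of S _ F]) (auto simp: jac has_integral_iff)
  ultimately have "F absolutely_integrable_on (g ` S) \<and> integral (g ` S) F = I"
    using cov unfolding absolutely_integrable_on_1_iff integral_on_1_eq
    by (simp add: Finite_Cartesian_Product.vec_eq_iff)
  hence "(F has_integral I) (g ` S)"
    by (auto simp: absolutely_integrable_on_def has_integral_iff)
  hence "emeasure hyp_measure (mobius A ` E) = ennreal I"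
    unfolding F_def img[symmetric] using A E EH mobius_in_H[OF A]
    by (intro hyp_measure_has_integral borel_mobius_image) auto
  thus ?thesis using I by simp
qed

text \<open>Exhaustion by the regions \<open>Reg (n + 1)\<close> and continuity of the measure from
  below.\<close>

lemma hyp_measure_mobius:
  assumes A: "det A = 1" and E: "E \<in> sets borel" "E \<subseteq> \<H>"
  shows "emeasure hyp_measure (mobius A ` E) = emeasure hyp_measure E"
proof -
  define Y where "Y n = E \<inter> Reg (real n + 1)" for n
  note Reg = borel_Reg
  have Y: "Y n \<in> sets borel" "Y n \<subseteq> \<H>" for n using E Reg by (auto simp: Y_def)
  have UY: "(\<Union>n. Y n) = E"
  proof (intro equalityI subsetI)
    fix z assume z: "z \<in> E"
    hence Im: "0 < Im z" using E by (auto simp: upper_half_plane_def)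
    obtain n where n: "max (cmod z) (1 / Im z) \<le> real n" using real_arch_simple by blast
    have "1 / Im z \<le> real n + 1" "cmod z \<le> real n + 1" using n by linarith+
    hence "1 / (real n + 1) \<le> Im z" using Im by (simp add: field_simps)
    thus "z \<in> (\<Union>n. Y n)" using z \<open>cmod z \<le> real n + 1\<close> by (auto simp: Y_def Reg_def)
  qed (auto simp: Y_def)
  have inc: "incseq Y"
    unfolding Y_def incseq_def by (intro allI impI Int_mono Reg_mono) auto
  have "emeasure hyp_measure (mobius A ` E) = emeasure hyp_measure (\<Union>n. mobius A ` Y n)"
    by (simp add: UY[symmetric] image_UN)
  also have "\<dots> = (SUP n. emeasure hyp_measure (mobius A ` Y n))"
    using borel_mobius_image[OF A Y(2,1)] inc
    by (intro SUP_emeasure_incseq[symmetric]) (auto simp: incseq_def intro!: image_mono)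
  also have "\<dots> = (SUP n. emeasure hyp_measure (Y n))"
  proof -
    have "emeasure hyp_measure (mobius A ` Y n) = emeasure hyp_measure (Y n)" for n
      by (rule hyp_measure_mobius_bounded[OF A Y(1), of _ "real n + 1"]) (auto simp: Y_def)
    thus ?thesis by simp
  qed
  also have "\<dots> = emeasure hyp_measure (\<Union>n. Y n)"
    using Y inc by (intro SUP_emeasure_incseq) auto
  finally show ?thesis by (simp add: UY)
qed

text \<open>\<open>F\<close> is cut into disjoint pieces, each inside one translate of
  \<open>E\<close>, and the pieces are moved back into \<open>E\<close>. They remain disjoint
  because \<open>F\<close> contains no two distinct equivalent points. This serves both for the
  independence of the area from the fundamental set and for the bound of the area by the
  index.\<close>

lemma packing_le_covering:
  assumes H: "matgroup H" and cnt: "countable H"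
    and F: "F \<in> sets borel" "F \<subseteq> \<H>"
    and pack: "\<And>A z. A \<in> H \<Longrightarrow> z \<in> F \<Longrightarrow> mobius A z \<in> F \<Longrightarrow> mobius A z = z"
    and E: "E \<in> sets borel" "E \<subseteq> \<H>" and cov: "F \<subseteq> (\<Union>A\<in>H. mobius A ` E)"
  shows "emeasure hyp_measure F \<le> emeasure hyp_measure E"
proof -
  note g = matgroupD[OF H]
  have ne: "H \<noteq> {}" using g(2) by auto
  define e where "e = from_nat_into H"
  have e: "e n \<in> H" for n unfolding e_def using from_nat_into[OF ne] .
  have re: "range e = H" unfolding e_def using range_from_nat_into[OF ne cnt] .
  define D where "D = disjointed (\<lambda>n. F \<inter> mobius (e n) ` E)"
  have sD: "range D \<subseteq> sets borel"
    unfolding D_def using F E e g(1) by (intro sets.range_disjointed_sets) (auto intro!: borel_mobius_image)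
  have subD: "D n \<subseteq> F \<inter> mobius (e n) ` E" for n unfolding D_def by (rule disjointed_subset)
  have UD: "(\<Union>n. D n) = F"
  proof -
    have "(\<Union>n. D n) = (\<Union>n. F \<inter> mobius (e n) ` E)" unfolding D_def by (rule UN_disjointed_eq)
    also have "\<dots> = F \<inter> (\<Union>A\<in>range e. mobius A ` E)" by auto
    finally show ?thesis using cov re by auto
  qed
  have disjD: "disjoint_family D" unfolding D_def by (rule disjoint_family_disjointed)
  define C where "C n = mobius (adj2 (e n)) ` D n" for n
  have DH: "D n \<subseteq> \<H>" for n using subD F by blast
  have sC: "range C \<subseteq> sets borel"
    using sD DH e g by (auto simp: C_def intro!: borel_mobius_image)
  have CE: "C n \<subseteq> E" for n
  proof
    fix x assume "x \<in> C n"
    then obtain y where y: "y \<in> D n" "x = mobius (adj2 (e n)) y" by (auto simp: C_def)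
    then obtain w where "w \<in> E" "y = mobius (e n) w" using subD by blast
    thus "x \<in> E" using y(2) e g(1) E(2) by auto
  qed
  have disjC: "disjoint_family C"
    unfolding disjoint_family_on_def
  proof (intro ballI impI)
    fix m n :: nat assume mn: "m \<noteq> n"
    show "C m \<inter> C n = {}"
    proof (rule ccontr)
      assume "C m \<inter> C n \<noteq> {}"
      then obtain x where "x \<in> C m" "x \<in> C n" by blast
      then obtain y y' where y: "y \<in> D m" "x = mobius (adj2 (e m)) y" "y' \<in> D n" "x = mobius (adj2 (e n)) y'"
        unfolding C_def by blast
      have yH: "y \<in> \<H>" "y' \<in> \<H>" using y DH by auto
      have "mobius (e n ** adj2 (e m)) y = mobius (e n) x"
        using y e g yH by (simp add: mobius_mult)
      also have "\<dots> = y'" using y(4) e g yH by simp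
      finally have "mobius (e n ** adj2 (e m)) y = y'" .
      moreover have "y \<in> F" "y' \<in> F" using subD[of m] subD[of n] y by auto
      ultimately have "y' = y" using pack[OF g(3)[OF e[of n] g(4)[OF e[of m]]], of y] by simp
      thus False using disjD mn y by (auto simp: disjoint_family_on_def)
    qed
  qed
  have "emeasure hyp_measure F = suminf (\<lambda>n. emeasure hyp_measure (D n))"
    using suminf_emeasure[of D hyp_measure] sD disjD UD by simp
  also have "\<dots> = suminf (\<lambda>n. emeasure hyp_measure (C n))"
  proof -
    have "emeasure hyp_measure (C n) = emeasure hyp_measure (D n)" for n
      unfolding C_def using sD DH e g by (intro hyp_measure_mobius) auto
    thus ?thesis by simp
  qed
  also have "\<dots> = emeasure hyp_measure (\<Union>n. C n)"
    using sC disjC by (intro suminf_emeasure) auto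
  also have "\<dots> \<le> emeasure hyp_measure E"
    using CE E by (intro emeasure_mono) auto
  finally show ?thesis .
qed

lemma fundamental_packing:
  assumes H: "matgroup H" and F: "fundamental_set (proj ` H) F"
    and A: "A \<in> H" "z \<in> F" "mobius A z \<in> F"
  shows "mobius A z = z"
proof -
  have zH: "z \<in> \<H>" using F A by (auto simp: fundamental_set_def)
  let ?p = "(\<lambda>A. mobius A z) ` H"
  have "?p \<in> surface (proj ` H)" using zH by (auto simp: surface_proj)
  hence "\<exists>!w. w \<in> F \<inter> ?p" using F by (auto simp: fundamental_set_def)
  moreover have "z \<in> ?p" by (rule image_eqI[of _ _ "mat 1"]) (auto simp: matgroupD(2)[OF H])
  moreover have "mobius A z \<in> ?p" using A by auto
  ultimately show ?thesis using A by blast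
qed

lemma fundamental_covering:
  assumes H: "matgroup H" and F: "fundamental_set (proj ` H) F" and z: "z \<in> \<H>"
  shows "\<exists>A\<in>H. mobius A z \<in> F"
proof -
  let ?p = "(\<lambda>A. mobius A z) ` H"
  have "?p \<in> surface (proj ` H)" using z by (auto simp: surface_proj)
  hence "\<exists>!w. w \<in> F \<inter> ?p" using F by (auto simp: fundamental_set_def)
  thus ?thesis by blast
qed

text \<open>Any two fundamental sets both pack and cover, so their measures bound each other and the
  definite description in \<open>area\<close> has a unique value.\<close>

lemma area_eq:
  assumes H: "matgroup H" "countable H" and F: "fundamental_set (proj ` H) F"
  shows "area (proj ` H) = emeasure hyp_measure F"
proof -
  have le: "emeasure hyp_measure F1 \<le> emeasure hyp_measure F2"
    if F12: "fundamental_set (proj ` H) F1" "fundamental_set (proj ` H) F2" for F1 F2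
  proof (rule packing_le_covering[OF H])
    show "F1 \<in> sets borel" "F1 \<subseteq> \<H>" "F2 \<in> sets borel" "F2 \<subseteq> \<H>"
      using F12 by (auto simp: fundamental_set_def)
    show "F1 \<subseteq> (\<Union>A\<in>H. mobius A ` F2)"
    proof
      fix z assume "z \<in> F1"
      hence z: "z \<in> \<H>" using F12 by (auto simp: fundamental_set_def)
      then obtain A where A: "A \<in> H" "mobius A z \<in> F2" using fundamental_covering[OF H(1) F12(2)] by blast
      have "z = mobius (adj2 A) (mobius A z)" using A z matgroupD(1)[OF H(1)] by simp
      thus "z \<in> (\<Union>A\<in>H. mobius A ` F2)" using A matgroupD(4)[OF H(1)] by blast
    qed
  qed (use fundamental_packing[OF H(1) F12(1)] in blast)
  show ?thesis
    unfolding area_def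
  proof (rule the_equality)
    show "\<exists>F'. fundamental_set (proj ` H) F' \<and> emeasure hyp_measure F = emeasure hyp_measure F'"
      using F by blast
  qed (use le F in \<open>auto intro: antisym\<close>)
qed

context cocompact_group
begin

text \<open>The half-plane is covered by countably many balls so small that no ball contains two
  distinct equivalent points. From each ball those points are kept whose orbit misses all earlier
  balls; every orbit is then hit exactly once, in the first ball that it meets.\<close>

lemma fundamental_set_exists:
  assumes H: "matgroup H" and HG: "H \<subseteq> G"
  obtains F where "fundamental_set (proj ` H) F"
proof -
  note g = matgroupD[OF H]
  obtain \<epsilon> where eps: "0 < \<epsilon>"
    "\<And>A z. A \<in> G \<Longrightarrow> A \<noteq> mat 1 \<Longrightarrow> A \<noteq> - mat 1 \<Longrightarrow> z \<in> \<H> \<Longrightarrow> \<epsilon> \<le> hypQ z (mobius A z)"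
    using displacement by metis
  \<comment> \<open>The bound 1/2 keeps heights in the ball above half that of the centre. With the
    bound \<open>sqrt \<epsilon> / 5\<close>, two points of the ball have \<open>hypQ\<close> at
    most \<open>16 \<epsilon> / 25\<close>, which is less than \<open>\<epsilon>\<close>.\<close>
  define \<delta> where "\<delta> = min (1/2) (sqrt \<epsilon> / 5)"
  have d: "0 < \<delta>" "\<delta> \<le> 1/2" "\<delta> \<le> sqrt \<epsilon> / 5" using eps(1) by (auto simp: \<delta>_def)
  define B where "B z = ball z (\<delta> * Im z)" for z
  have Bim: "Im z / 2 \<le> Im x" if z: "z \<in> \<H>" "x \<in> B z" for x z
  proof -
    have "\<bar>Im z - Im x\<bar> \<le> cmod (z - x)" using abs_Im_le_cmod[of "z - x"] by simp
    also have "\<dots> \<le> \<delta> * Im z" using z by (simp add: B_def dist_norm)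
    also have "\<dots> \<le> (1/2) * Im z" using d z by (intro mult_right_mono) (auto simp: upper_half_plane_def)
    finally show ?thesis by linarith
  qed
  have BH: "B z \<subseteq> \<H>" if "z \<in> \<H>" for z
    using Bim[OF that] that by (force simp: upper_half_plane_def)
  have sep: "mobius A x = x" if z: "z \<in> \<H>" "x \<in> B z" "mobius A x \<in> B z" "A \<in> H" for A x z
  proof (rule ccontr)
    assume ne: "mobius A x \<noteq> x"
    have "A \<noteq> mat 1" "A \<noteq> - mat 1" using ne by auto
    hence Q: "\<epsilon> \<le> hypQ x (mobius A x)" using eps(2)[of A x] HG z BH by blast
    define y where "y = mobius A x"
    have Iz: "0 < Im z" using z(1) by (simp add: upper_half_plane_def)
    have "cmod (x - y) < 2 * (\<delta> * Im z)"
      using z dist_triangle_half_l[of x z "2 * (\<delta> * Im z)" y] by (simp add: B_def y_def dist_norm norm_minus_commute)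
    hence "(cmod (x - y))\<^sup>2 < (2 * (\<delta> * Im z))\<^sup>2" by (intro power_strict_mono) auto
    also have "\<dots> = 4 * \<delta>\<^sup>2 * (Im z)\<^sup>2" by (simp add: power_mult_distrib)
    also have "\<delta>\<^sup>2 \<le> (sqrt \<epsilon> / 5)\<^sup>2" using d by (intro power_mono) auto
    also have "(sqrt \<epsilon> / 5)\<^sup>2 = \<epsilon> / 25" using eps(1) by (simp add: power_divide)
    finally have 1: "(cmod (x - y))\<^sup>2 < 4 * (\<epsilon> / 25) * (Im z)\<^sup>2"
      using Iz by (auto simp: mult_right_mono mult_left_mono)
    have "(Im z / 2) * (Im z / 2) \<le> Im x * Im y"
      using Bim[OF z(1,2)] Bim[OF z(1,3)] Iz by (intro mult_mono) (auto simp: y_def)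
    hence 2: "(Im z)\<^sup>2 / 4 \<le> Im x * Im y" by (simp add: power2_eq_square)
    have pos: "0 < Im x * Im y" using 2 Iz by (smt (verit) divide_pos_pos zero_less_power)
    have "\<epsilon> * (Im x * Im y) \<le> (cmod (x - y))\<^sup>2"
      using Q pos by (simp add: hypQ_def y_def pos_le_divide_eq)
    moreover have "\<epsilon> * ((Im z)\<^sup>2 / 4) \<le> \<epsilon> * (Im x * Im y)" using 2 eps(1) by simp
    moreover have "0 < \<epsilon> * (Im z)\<^sup>2" using eps(1) Iz by simp
    ultimately show False using 1 by simp
  qed
  have "\<And>Y. Y \<in> B ` \<H> \<Longrightarrow> open Y" by (auto simp: B_def)
  then obtain \<B> where \<B>: "\<B> \<subseteq> B ` \<H>" "countable \<B>" "\<Union>\<B> = \<Union>(B ` \<H>)"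
    using Lindelof by metis
  have cov: "\<H> \<subseteq> \<Union>\<B>" unfolding \<B>(3) using d by (force simp: B_def upper_half_plane_def)
  hence ne: "\<B> \<noteq> {}" using ii_in_H by auto
  define b where "b = from_nat_into \<B>"
  have b: "\<exists>z\<in>\<H>. b n = B z" for n
    using \<B>(1) from_nat_into[OF ne, of n] by (auto simp: b_def)
  have rb: "range b = \<B>" unfolding b_def using range_from_nat_into[OF ne \<B>(2)] .
  have bH: "b n \<subseteq> \<H>" for n using b[of n] BH by auto
  have bo: "open (b n)" for n using b[of n] by (auto simp: B_def)
  \<comment> \<open>The saturation of the \<open>n\<close>-th ball: all points whose orbit meets
    it.\<close>
  define W where "W n = (\<Union>A\<in>H. mobius A ` b n)" for n
  have Wo: "open (W n)" for n
    unfolding W_def using bo bH g(1) by (intro open_UN ballI open_mobius_image) auto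
  define F where "F = (\<Union>n. b n - (\<Union>i<n. W i))"
  have "fundamental_set (proj ` H) F"
    unfolding fundamental_set_def
  proof (intro conjI ballI)
    show "F \<in> sets borel" unfolding F_def using Wo bo
      by (intro sets.countable_UN'[OF countableI_type] sets.Diff sets.finite_UN) auto
    show "F \<subseteq> \<H>" using bH by (auto simp: F_def)
    fix p assume "p \<in> surface (proj ` H)"
    then obtain w where w: "w \<in> \<H>" "p = (\<lambda>A. mobius A w) ` H" by (auto simp: surface_proj)
    have wp: "w \<in> p" unfolding w by (rule image_eqI[of _ _ "mat 1"]) (auto simp: g)
    have trans: "\<exists>A\<in>H. y = mobius A x" if "x \<in> p" "y \<in> p" for x y
      using mobius_orbit_eq[OF H _ w(1)] that w by (metis (no_types, lifting) imageE)
    obtain n0 where "w \<in> b n0" using cov w rb by blast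
    hence ex: "\<exists>n. p \<inter> b n \<noteq> {}" using wp by blast
    define n where "n = (LEAST n. p \<inter> b n \<noteq> {})"
    have n: "p \<inter> b n \<noteq> {}" unfolding n_def using LeastI_ex[OF ex] .
    then obtain x where x: "x \<in> p" "x \<in> b n" by blast
    have "x \<notin> W i" if "i < n" for i
    proof
      assume "x \<in> W i"
      then obtain A y where y: "A \<in> H" "y \<in> b i" "x = mobius A y" by (auto simp: W_def)
      have "y = mobius (adj2 A) x" using y bH[of i] g(1)[of A] mobius_adj2(1)[of A y] by auto
      hence "y \<in> p" using x(1) w mobius_mult g(1,3,4) y(1) by (auto intro!: image_eqI simp flip: mobius_mult)
      hence "p \<inter> b i \<noteq> {}" using y by blast
      thus False using not_less_Least that unfolding n_def by blast
    qed
    hence xF: "x \<in> F \<inter> p" using x by (auto simp: F_def)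
    have uniq: "j = k \<and> x' = y'"
      if xy: "x' \<in> p" "x' \<in> b j" "x' \<notin> (\<Union>i<j. W i)" "y' \<in> p" "y' \<in> b k" "y' \<notin> (\<Union>i<k. W i)" for j k x' y'
    proof -
      have 1: "\<not> j < k" 
      proof
        assume "j < k"
        obtain A where "A \<in> H" "y' = mobius A x'" using trans xy by blast
        hence "y' \<in> W j" unfolding W_def using xy by blast
        thus False using xy \<open>j < k\<close> by blast
      qed
      have 2: "\<not> k < j" 
      proof
        assume "k < j"
        obtain A where "A \<in> H" "x' = mobius A y'" using trans xy by blast
        hence "x' \<in> W k" unfolding W_def using xy by blast
        thus False using xy \<open>k < j\<close> by blast
      qed
      have jk: "j = k" using 1 2 by simp
      obtain z where z: "z \<in> \<H>" "b k = B z" using b by blast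
      obtain A where "A \<in> H" "y' = mobius A x'" using trans xy by blast
      hence "y' = x'" using sep[OF z(1), of x' A] that jk z by auto
      thus ?thesis using jk by simp
    qed
    show "\<exists>!z. z \<in> F \<inter> p"
    proof (rule ex1I[of _ x])
      show "x \<in> F \<inter> p" by (rule xF)
      fix y assume y: "y \<in> F \<inter> p"
      then obtain k where k: "y \<in> b k" "y \<notin> (\<Union>i<k. W i)" unfolding F_def by blast
      from xF obtain j where j: "x \<in> b j" "x \<notin> (\<Union>i<j. W i)" unfolding F_def by blast
      show "y = x" using uniq[OF _ k _ j] y x(1) by blast
    qed
  qed
  thus ?thesis using that by blast
qed

text \<open>The translates of \<open>Reg r\<close> by the representatives in \<open>T\<close> form a
  set whose images under \<open>H\<close> cover the half-plane, while a fundamental set of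
  \<open>H\<close> packs.\<close>

lemma area_le_index:
  assumes H: "matgroup H" and HG: "H \<subseteq> G"
    and T: "finite T" "T \<subseteq> G" "\<And>A. A \<in> G \<Longrightarrow> \<exists>B\<in>T. \<exists>C\<in>H. A = C ** B"
  shows "area (proj ` H) \<le> of_nat (card T) * emeasure hyp_measure (Reg r)"
proof -
  note g = matgroupD[OF H]
  obtain F where F: "fundamental_set (proj ` H) F" using fundamental_set_exists[OF H HG] .
  have cnt: "countable H" using countable_G HG countable_subset by blast
  note Reg = borel_Reg[of r]
  define E where "E = (\<Union>B\<in>T. mobius B ` Reg r)"
  have im: "mobius B ` Reg r \<in> sets borel" "mobius B ` Reg r \<subseteq> \<H>" if "B \<in> T" for B
    using that T Reg RegH by (auto intro!: borel_mobius_image mobius_in_H)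
  have "area (proj ` H) = emeasure hyp_measure F" by (rule area_eq[OF H cnt F])
  also have "\<dots> \<le> emeasure hyp_measure E"
  proof (rule packing_le_covering[OF H cnt])
    show "F \<in> sets borel" "F \<subseteq> \<H>" using F by (auto simp: fundamental_set_def)
    show "E \<in> sets borel" "E \<subseteq> \<H>" unfolding E_def using im T by auto
    show "F \<subseteq> (\<Union>A\<in>H. mobius A ` E)"
    proof
      fix z assume "z \<in> F"
      hence z: "z \<in> \<H>" using F by (auto simp: fundamental_set_def)
      then obtain C where C: "C \<in> G" "mobius C z \<in> Reg r" using cover by blast
      obtain B A where AB: "B \<in> T" "A \<in> H" "adj2 C = A ** B" using T(3)[of "adj2 C"] C by auto
      have CzH: "mobius C z \<in> \<H>" using C RegH by auto
      have dB: "det B = 1" using AB T by auto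
      have "z = mobius (adj2 C) (mobius C z)" using C z by simp
      also have "\<dots> = mobius A (mobius B (mobius C z))"
        unfolding AB(3) by (rule mobius_mult[OF dB CzH])
      finally show "z \<in> (\<Union>A\<in>H. mobius A ` E)" using AB C by (auto simp: E_def)
    qed
  qed (use fundamental_packing[OF H F] in blast)
  also have "\<dots> \<le> (\<Sum>B\<in>T. emeasure hyp_measure (mobius B ` Reg r))"
    unfolding E_def using im T by (intro emeasure_subadditive_finite) auto
  also have "\<dots> = (\<Sum>B\<in>T. emeasure hyp_measure (Reg r))"
    using T Reg RegH by (intro sum.cong hyp_measure_mobius) auto
  finally show ?thesis by simp
qed

end

section \<open>Closed geodesics and coverings\<close>

lemma hyp_dist_cosh:
  assumes "z \<in> \<H>" "w \<in> \<H>"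
  shows "cosh (hyp_dist z w) = 1 + hypQ z w / 2"
  unfolding hyp_dist_hypQ using hypQ_nonneg[OF assms] by (intro cosh_arcosh_real) simp

lemma hyp_dist_vertical: "hyp_dist (\<i> * of_real (exp s)) (\<i> * of_real (exp t)) = \<bar>s - t\<bar>"
proof -
  have "cmod (\<i> * of_real (exp s) - \<i> * of_real (exp t)) = \<bar>exp s - exp t\<bar>"
    by (metis mult.left_neutral norm_ii norm_mult norm_of_real of_real_diff right_diff_distrib)
  hence "hypQ (\<i> * of_real (exp s)) (\<i> * of_real (exp t)) = (exp s - exp t)\<^sup>2 / (exp s * exp t)"
    by (simp add: hypQ_def)
  also have "\<dots> = exp s / exp t + exp t / exp s - 2"
  proof -
    have "(exp s - exp t)\<^sup>2 = exp s * exp s + exp t * exp t - 2 * (exp s * exp t)"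
      by (simp add: power2_eq_square algebra_simps)
    thus ?thesis by (simp add: add_divide_distrib diff_divide_distrib)
  qed
  also have "\<dots> = 2 * cosh \<bar>s - t\<bar> - 2"
    by (cases "s \<le> t") (simp_all add: cosh_def exp_diff mult_ac add_ac)
  finally have "1 + hypQ (\<i> * of_real (exp s)) (\<i> * of_real (exp t)) / 2 = cosh \<bar>s - t\<bar>"
    by linarith
  thus ?thesis by (simp only: hyp_dist_hypQ arcosh_cosh_real abs_ge_zero)
qed

text \<open>The columns of \<open>P\<close> are eigenvectors read off from the rows of
  \<open>A\<close>: the second row if \<open>c\<close> is nonzero, otherwise the first if
  \<open>b\<close> is nonzero. A diagonal \<open>A\<close> needs at most an exchange of the
  axes.\<close>

lemma diagonalize:
  assumes A: "det A = 1" and \<nu>: "trace A = \<nu> + 1 / \<nu>" "1 < \<nu>"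
  obtains P where "det P = 1" "A ** P = P ** mat2 \<nu> 0 0 (1 / \<nu>)"
proof -
  define a b c d \<mu> where "a = A$1$1" and "b = A$1$2" and "c = A$2$1" and "d = A$2$2" and "\<mu> = 1 / \<nu>"
  have det: "a * d - b * c = 1" using A by (simp add: det_2 a_def b_def c_def d_def)
  have tr: "a + d = \<nu> + \<mu>" using \<nu> by (simp add: trace2 a_def d_def \<mu>_def)
  have lm: "\<nu> * \<mu> = 1" using \<nu>(2) by (simp add: \<mu>_def)
  have ne: "\<nu> \<noteq> \<mu>" using lm \<nu>(2) by (metis less_1_mult less_irrefl)
  have root: "x * x = (a + d) * x - a * d + b * c" if "x = \<nu> \<or> x = \<mu>" for x
  proof -
    have "x * x - (a + d) * x + 1 = 0"
      using that lm unfolding tr by (auto simp: algebra_simps)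
    thus ?thesis using det by linarith
  qed
  note result = that
  \<comment> \<open>Only the first eigenvector is rescaled to reach determinant 1. The scaling
    matrix is diagonal and so commutes with the diagonal form.\<close>
  have scale: thesis
    if P: "A ** P = P ** mat2 \<nu> 0 0 \<mu>" "det P \<noteq> 0" for P
  proof (rule result[of "P ** mat2 (1 / det P) 0 0 1"])
    show "det (P ** mat2 (1 / det P) 0 0 1) = 1" using P(2) by (simp add: det_mul det_2[of "mat2 _ _ _ _"])
    have "A ** (P ** mat2 (1 / det P) 0 0 1) = P ** (mat2 \<nu> 0 0 \<mu> ** mat2 (1 / det P) 0 0 1)"
      by (simp add: matrix_mul_assoc P(1))
    also have "mat2 \<nu> 0 0 \<mu> ** mat2 (1 / det P) 0 0 1 = mat2 (1 / det P) 0 0 1 ** mat2 \<nu> 0 0 \<mu>"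
      by (simp add: mat2_eq_iff mult2_nth)
    finally show "A ** (P ** mat2 (1 / det P) 0 0 1) = P ** mat2 (1 / det P) 0 0 1 ** mat2 \<nu> 0 0 (1 / \<nu>)"
      by (simp add: matrix_mul_assoc \<mu>_def)
  qed
  consider "c \<noteq> 0" | "c = 0" "b \<noteq> 0" | "c = 0" "b = 0" by blast
  thus thesis
  proof cases
    case 1
    show thesis
    proof (rule scale[of "mat2 (\<nu> - d) (\<mu> - d) c c"])
      have "a * (x - d) + b * c = (x - d) * x" "c * (x - d) + d * c = c * x" if "x = \<nu> \<or> x = \<mu>" for x
        using root[OF that] by (simp_all add: algebra_simps)
      thus "A ** mat2 (\<nu> - d) (\<mu> - d) c c = mat2 (\<nu> - d) (\<mu> - d) c c ** mat2 \<nu> 0 0 \<mu>"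
        by (simp add: mat2_eq_iff mult2_nth flip: a_def b_def c_def d_def)
      have "det (mat2 (\<nu> - d) (\<mu> - d) c c) = c * (\<nu> - \<mu>)" by (simp add: det_2 algebra_simps)
      thus "det (mat2 (\<nu> - d) (\<mu> - d) c c) \<noteq> 0" using 1 ne by simp
    qed
  next
    case 2
    show thesis
    proof (rule scale[of "mat2 b b (\<nu> - a) (\<mu> - a)"])
      have "a * b + b * (x - a) = b * x" "c * b + d * (x - a) = (x - a) * x" if "x = \<nu> \<or> x = \<mu>" for x
        using root[OF that] by (simp_all add: algebra_simps)
      thus "A ** mat2 b b (\<nu> - a) (\<mu> - a) = mat2 b b (\<nu> - a) (\<mu> - a) ** mat2 \<nu> 0 0 \<mu>"
        by (simp add: mat2_eq_iff mult2_nth flip: a_def b_def c_def d_def)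
      have "det (mat2 b b (\<nu> - a) (\<mu> - a)) = b * (\<mu> - \<nu>)" by (simp add: det_2 algebra_simps)
      thus "det (mat2 b b (\<nu> - a) (\<mu> - a)) \<noteq> 0" using 2 ne by simp
    qed
  next
    case 3
    have "(a - \<nu>) * (a - \<mu>) = a * a - (a + d) * a + \<nu> * \<mu>" unfolding tr by (simp add: algebra_simps)
    also have "\<dots> = 0" using det 3 lm by (simp add: algebra_simps)
    finally consider "a = \<nu>" "d = \<mu>" | "a = \<mu>" "d = \<nu>" using tr by auto
    thus thesis
    proof cases
      case 1
      thus thesis using 3
        by (intro scale[of "mat 1"]) (simp_all add: mat2_eq_iff mult2_nth flip: a_def b_def c_def d_def)
    next
      case 2
      thus thesis using 3
        by (intro scale[of "mat2 0 (-1) 1 0"])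
          (simp_all add: mat2_eq_iff mult2_nth det_2 flip: a_def b_def c_def d_def)
    qed
  qed
qed

text \<open>After a change of sign the trace is positive and \<open>A\<close> is conjugate to a
  dilation. The geodesic is the image of the imaginary axis, along which the dilation
  translates.\<close>

lemma axis_exists:
  assumes A: "det A = 1" and tr: "2 < \<bar>trace A\<bar>"
  obtains c l where "hyp_geodesic c" "0 < l" "\<And>t. mobius A (c t) = c (t + l)"
proof -
  note result = that
  have main: thesis if B: "det B = 1" "2 < trace B" "\<And>z. mobius B z = mobius A z" for B
  proof -
    define \<tau> where "\<tau> = trace B"
    define \<nu> where "\<nu> = (\<tau> + sqrt (\<tau>\<^sup>2 - 4)) / 2"
    have t: "2 < \<tau>" using B by (simp add: \<tau>_def)
    have t2: "4 \<le> \<tau>\<^sup>2" using power_mono[of 2 \<tau> 2] t by simp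
    have l1: "1 < \<nu>"
    proof -
      have "0 \<le> sqrt (\<tau>\<^sup>2 - 4)" using t2 by simp
      hence "2 < \<tau> + sqrt (\<tau>\<^sup>2 - 4)" using t by linarith
      thus ?thesis unfolding \<nu>_def by simp
    qed
    have "\<nu> * (\<tau> - \<nu>) = (\<tau>\<^sup>2 - (sqrt (\<tau>\<^sup>2 - 4))\<^sup>2) / 4"
      unfolding \<nu>_def by (simp add: field_simps power2_eq_square)
    also have "\<dots> = 1" using t2 by simp
    finally have "\<tau> - \<nu> = 1 / \<nu>" using l1 by (simp add: eq_divide_eq mult.commute)
    hence "trace B = \<nu> + 1 / \<nu>" by (simp add: \<tau>_def)
    then obtain P where P: "det P = 1" "B ** P = P ** mat2 \<nu> 0 0 (1 / \<nu>)"
      using diagonalize[OF B(1) _ l1] by blast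
    define y where "y t = \<i> * of_real (exp t)" for t :: real
    have yH: "y t \<in> \<H>" for t by (simp add: y_def upper_half_plane_def)
    define c where "c t = mobius P (y t)" for t
    \<comment> \<open>The diagonal matrix multiplies by \<open>\<nu>^2\<close>, which shifts the
      logarithm of the height by this amount.\<close>
    define l where "l = 2 * ln \<nu>"
    have dD: "det (mat2 \<nu> 0 0 (1 / \<nu>)) = 1" using l1 by (simp add: det_2)
    have l2: "exp l = \<nu> * \<nu>" using l1 by (simp add: l_def exp_double[of "ln \<nu>"] power2_eq_square)
    have "mobius (mat2 \<nu> 0 0 (1 / \<nu>)) (y t) = y (t + l)" for t
      using l1 by (simp add: mobius_def y_def exp_add l2 mult_ac)
    hence "mobius A (c t) = c (t + l)" for t
      using mobius_mult[OF P(1) yH[of t], of B] mobius_mult[OF dD yH[of t], of P]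
      by (simp add: P(2) B(3) c_def)
    moreover have "hyp_geodesic c"
      unfolding hyp_geodesic_def
    proof (intro conjI allI)
      show "range c \<subseteq> \<H>" using mobius_in_H[OF P(1) yH] by (auto simp: c_def)
      show "hyp_dist (c s) (c t) = \<bar>s - t\<bar>" for s t
        unfolding c_def hyp_dist_hypQ hypQ_mobius[OF P(1) yH yH]
        unfolding hyp_dist_hypQ[symmetric] y_def by (rule hyp_dist_vertical)
    qed
    moreover have "0 < l" using l1 by (simp add: l_def)
    ultimately show thesis using result by blast
  qed
  show thesis
  proof (cases "0 < trace A")
    case True
    thus thesis using main[of A] A tr by simp
  next
    case False
    thus thesis using main[of "- A"] A tr by (simp add: trace2)
  qed
qed

text \<open>A closed geodesic of length \<open>l\<close> lifts to a path whose endpoints at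
  parameters 0 and \<open>l\<close> differ by an element of the group, so \<open>l\<close> is a
  displacement. The hyperbolic element \<open>A\<close> provides a closed geodesic, without which
  the infimum would be taken over the empty set.\<close>

lemma systole_ge:
  assumes H: "matgroup H" and A: "A \<in> H" "2 < \<bar>trace A\<bar>"
    and L: "\<And>B z. B \<in> H \<Longrightarrow> B \<noteq> mat 1 \<Longrightarrow> B \<noteq> - mat 1 \<Longrightarrow> z \<in> \<H> \<Longrightarrow> L \<le> hyp_dist z (mobius B z)"
  shows "L \<le> systole (proj ` H)"
  unfolding systole_def
proof (rule cInf_greatest)
  obtain c l where c: "hyp_geodesic c" "0 < l" "\<And>t. mobius A (c t) = c (t + l)"
    using axis_exists[OF matgroupD(1)[OF H A(1)] A(2)] by blast
  have cH: "c t \<in> \<H>" for t using c(1) by (auto simp: hyp_geodesic_def)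
  have "closed_geodesic_of_length (proj ` H) (\<lambda>t. orb (proj ` H) (c t)) l"
    unfolding closed_geodesic_of_length_def surface_geodesic_def
    using c mobius_orbit_eq[OF H A(1) cH] by (auto simp: orb_proj c(3)[symmetric])
  thus "{l. \<exists>p. closed_geodesic_of_length (proj ` H) p l} \<noteq> {}" by blast
next
  fix l assume "l \<in> {l. \<exists>p. closed_geodesic_of_length (proj ` H) p l}"
  then obtain c where c: "hyp_geodesic c" "0 < l" "\<And>t. orb (proj ` H) (c (t + l)) = orb (proj ` H) (c t)"
    by (auto simp: closed_geodesic_of_length_def surface_geodesic_def)
  have cH: "c t \<in> \<H>" for t using c(1) by (auto simp: hyp_geodesic_def)
  have "c l \<in> orb (proj ` H) (c l)"
    unfolding orb_proj by (rule image_eqI[of _ _ "mat 1"]) (auto simp: matgroupD(2)[OF H])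
  hence "c l \<in> orb (proj ` H) (c 0)" using c(3)[of 0] by simp
  then obtain B where B: "B \<in> H" "c l = mobius B (c 0)" by (auto simp: orb_proj)
  have dist: "hyp_dist (c 0) (c l) = l" using c by (simp add: hyp_geodesic_def)
  have "c l \<noteq> c 0" using dist c(2) by (auto simp: hyp_dist_hypQ)
  hence "B \<noteq> mat 1" "B \<noteq> - mat 1" using B by auto
  thus "L \<le> l" using L[OF B(1) _ _ cH[of 0]] B dist by simp
qed

context cocompact_group
begin

definition coset :: "(real^2^2) set \<Rightarrow> real^2^2 \<Rightarrow> (real^2^2) set" where
  "coset H B = (\<lambda>C. C ** B) ` H"

lemma coset_eq:
  assumes H: "matgroup H" and C: "C \<in> H"
  shows "coset H (C ** B) = coset H B"
proof -
  note g = matgroupD[OF H]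
  have "D ** (C ** B) \<in> coset H B" if "D \<in> H" for D
    unfolding coset_def using that C g by (intro image_eqI[of _ _ "D ** C"]) (auto simp: matrix_mul_assoc)
  moreover have "D ** B \<in> coset H (C ** B)" if "D \<in> H" for D
    unfolding coset_def
  proof (rule image_eqI[of _ _ "D ** adj2 C"])
    have "D ** adj2 C ** (C ** B) = D ** (adj2 C ** C) ** B" by (simp add: matrix_mul_assoc)
    thus "D ** B = D ** adj2 C ** (C ** B)" using adj2_mult(1)[OF g(1)[OF C]] by simp
  qed (use that C g in auto)
  ultimately show ?thesis by (auto simp: coset_def)
qed

lemma coset_eqD:
  assumes H: "matgroup H" and B: "B \<in> G" "B' \<in> G" and eq: "coset H B = coset H B'"
  shows "B ** adj2 B' \<in> H"
proof -
  note g = matgroupD[OF H]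
  have "mat 1 ** B \<in> coset H B" unfolding coset_def using g(2) by blast
  then obtain C where C: "C \<in> H" "B = C ** B'" using eq by (auto simp: coset_def)
  have "B ** adj2 B' = C ** (B' ** adj2 B')" by (simp add: C(2) matrix_mul_assoc)
  thus ?thesis using C(1) adj2_mult(2)[of B'] B by simp
qed

text \<open>By freeness the fibre over any orbit corresponds to the set of right cosets of
  \<open>H\<close> in \<open>G\<close>, so all fibres have the same cardinality. \<open>T\<close>
  makes this set finite, which matters since \<open>card\<close> of an infinite set is 0;
  \<open>Y\<close> contributes distinct cosets.\<close>

lemma covering_degree_ge:
  assumes H: "matgroup H" and HG: "H \<subseteq> G"
    and T: "finite T" "T \<subseteq> G" "\<And>A. A \<in> G \<Longrightarrow> \<exists>B\<in>T. \<exists>C\<in>H. A = C ** B"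
    and Y: "Y \<subseteq> G" "\<And>A B. A \<in> Y \<Longrightarrow> B \<in> Y \<Longrightarrow> A ** adj2 B \<in> H \<Longrightarrow> A = B"
  shows "card Y \<le> covering_degree (proj ` H) (proj ` G)"
proof -
  note g = matgroupD[OF H]
  define K where "K = coset H ` G"
  have "K \<subseteq> coset H ` T"
    unfolding K_def using T(3) coset_eq[OF H] by fastforce
  hence finK: "finite K" using T(1) finite_surj by blast
  \<comment> \<open>Sends the coset of \<open>B\<close> to the \<open>H\<close>-orbit of
    \<open>B z\<close>.\<close>
  define \<psi> where "\<psi> z C = (\<lambda>D. mobius D z) ` C" for z and C :: "(real^2^2) set"
  have psi: "\<psi> z (coset H B) = (\<lambda>D. mobius D (mobius B z)) ` H" if "B \<in> G" "z \<in> \<H>" for z B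
    unfolding \<psi>_def coset_def image_image using that by (intro image_cong) (auto simp: mobius_mult)
  have fib: "card {q \<in> surface (proj ` H). q \<subseteq> p} = card K" if p: "p \<in> surface (proj ` G)" for p
  proof -
    obtain z where z: "z \<in> \<H>" "p = (\<lambda>A. mobius A z) ` G" using p by (auto simp: surface_proj)
    have "{q \<in> surface (proj ` H). q \<subseteq> p} = \<psi> z ` K"
    proof (intro equalityI subsetI)
      fix q assume q: "q \<in> {q \<in> surface (proj ` H). q \<subseteq> p}"
      then obtain w where w: "w \<in> \<H>" "q = (\<lambda>A. mobius A w) ` H" by (auto simp: surface_proj)
      have "w \<in> q" unfolding w by (rule image_eqI[of _ _ "mat 1"]) (auto simp: g)
      then obtain B where B: "B \<in> G" "w = mobius B z" using q z by auto
      thus "q \<in> \<psi> z ` K" unfolding w K_def using psi[OF B(1) z(1)] by auto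
    next
      fix q assume "q \<in> \<psi> z ` K"
      then obtain B where B: "B \<in> G" "q = (\<lambda>D. mobius D (mobius B z)) ` H" using psi z by (auto simp: K_def)
      have "mobius D (mobius B z) \<in> p" if "D \<in> H" for D
        unfolding z using that B HG z(1) by (intro image_eqI[of _ _ "D ** B"]) (auto simp: mobius_mult)
      moreover have "mobius B z \<in> \<H>" using B z by (auto intro: mobius_in_H)
      ultimately show "q \<in> {q \<in> surface (proj ` H). q \<subseteq> p}" using B by (auto simp: surface_proj)
    qed
    moreover have "inj_on (\<psi> z) K"
    proof (rule inj_onI)
      fix k k' assume k: "k \<in> K" "k' \<in> K" "\<psi> z k = \<psi> z k'"
      then obtain B B' where B: "B \<in> G" "k = coset H B" "B' \<in> G" "k' = coset H B'" by (auto simp: K_def)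
      have "mobius B z \<in> (\<lambda>D. mobius D (mobius B z)) ` H"
        by (rule image_eqI[of _ _ "mat 1"]) (auto simp: g)
      hence "mobius B z \<in> (\<lambda>D. mobius D (mobius B' z)) ` H"
        using k(3) psi[OF B(1) z(1)] psi[OF B(3) z(1)] B by simp
      then obtain C where C: "C \<in> H" "mobius B z = mobius C (mobius B' z)" by auto
      have CG: "C ** B' \<in> G" using C B HG by auto
      have "mobius B z = mobius (C ** B') z" using C B z by (simp add: mobius_mult)
      hence "mobius (adj2 (C ** B') ** B) z = z"
        using mobius_mult[of B z "adj2 (C ** B')"] mobius_adj2(1)[of "C ** B'" z] CG B z by simp
      moreover have "adj2 (C ** B') ** B \<in> G" using CG B by simp
      ultimately have "adj2 (C ** B') ** B = mat 1 \<or> adj2 (C ** B') ** B = - mat 1"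
        using free z(1) by blast
      moreover have "(C ** B') ** (adj2 (C ** B') ** B) = B"
        using adj2_mult(2)[of "C ** B'"] CG by (simp add: matrix_mul_assoc)
      ultimately have "B = C ** B' \<or> B = - C ** B'" by auto
      moreover have "- C \<in> H" using C g by simp
      ultimately have "coset H B = coset H B'"
        using coset_eq[OF H C(1)] coset_eq[OF H \<open>- C \<in> H\<close>] by metis
      thus "k = k'" using B by simp
    qed
    ultimately show ?thesis by (simp add: card_image)
  qed
  have "(\<lambda>A. mobius A \<i>) ` G \<in> surface (proj ` G)" using ii_in_H by (auto simp: surface_proj)
  hence "covering_degree (proj ` H) (proj ` G) = card K"
    unfolding covering_degree_def using fib by (intro the_equality) auto
  moreover have "inj_on (coset H) Y"
    using coset_eqD[OF H] Y by (intro inj_onI) blast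
  hence "card Y \<le> card K"
    using finK Y(1) unfolding K_def by (metis card_image card_mono image_mono)
  ultimately show ?thesis by simp
qed

end

section \<open>Sizes and denominators in number fields\<close>

interpretation ratvs: vector_space "\<lambda>(q::rat) (x::real). of_rat q * x"
  by unfold_locales (simp_all add: algebra_simps of_rat_add of_rat_mult)

lemma ring_of_type_simps [simp]:
  "carrier ring_of_type_algebra = UNIV" "x \<otimes>\<^bsub>ring_of_type_algebra\<^esub> y = x * y"
  "x \<oplus>\<^bsub>ring_of_type_algebra\<^esub> y = x + y" "\<one>\<^bsub>ring_of_type_algebra\<^esub> = 1"
  "\<zero>\<^bsub>ring_of_type_algebra\<^esub> = 0"
  by (simp_all add: ring_of_type_algebra_def)

text \<open>Each step in the inductive definition of dimension adjoins one vector, which on the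
  other side is the insertion of a vector into a spanning set.\<close>

lemma dimension_imp_span:
  assumes "ring.dimension (ring_of_type_algebra :: real ring) n \<rat> E"
  shows "\<exists>B. finite B \<and> ratvs.span B = E"
proof -
  interpret R: ring "ring_of_type_algebra :: real ring" ..
  have "finite B \<and> ratvs.span B = E \<Longrightarrow>
      ratvs.span (insert v B) = R.line_extension \<rat> v E" for B v E
  proof -
    assume B: "finite B \<and> ratvs.span B = E"
    have "R.line_extension \<rat> v E = {x. \<exists>h\<in>\<rat>. \<exists>u\<in>E. x = h * v + u}"
      unfolding R.line_extension_def set_add_def' r_coset_def by auto
    also have "\<dots> = {x. \<exists>k. x - of_rat k * v \<in> E}"
    proof (intro equalityI subsetI)
      fix x assume "x \<in> {x. \<exists>h\<in>\<rat>. \<exists>u\<in>E. x = h * v + u}"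
      then obtain h u where h: "h \<in> \<rat>" "u \<in> E" "x = h * v + u" by blast
      obtain q where "h = of_rat q" using h(1) by (rule Rats_cases)
      thus "x \<in> {x. \<exists>k. x - of_rat k * v \<in> E}" using h by (auto intro!: exI[of _ q])
    next
      fix x assume "x \<in> {x. \<exists>k. x - of_rat k * v \<in> E}"
      then obtain k where "x - of_rat k * v \<in> E" by blast
      moreover have "x = of_rat k * v + (x - of_rat k * v)" by simp
      moreover have "of_rat k \<in> \<rat>" by simp
      ultimately show "x \<in> {x. \<exists>h\<in>\<rat>. \<exists>u\<in>E. x = h * v + u}" by blast
    qed
    finally have "R.line_extension \<rat> v E = {x. \<exists>k. x - of_rat k * v \<in> E}" .
    thus ?thesis using B by (simp add: ratvs.span_insert)
  qed
  note ext = this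
  show ?thesis
    using assms
  proof (induction n "\<rat> :: real set" E rule: R.dimension.induct)
    case zero_dim
    show ?case by (intro exI[of _ "{}"]) simp
  next
    case (Suc_dim v E n)
    then obtain B where B: "finite B" "ratvs.span B = E" by blast
    thus ?case using ext[of B E v] by (intro exI[of _ "insert v B"]) simp
  qed
qed

text \<open>A number field viewed as a finite-dimensional algebra over the rationals with a chosen
  basis. Rational coordinates take the place of the conjugates of an element.\<close>

locale number_basis =
  fixes K B :: "real set"
  assumes one_K: "1 \<in> K"
    and add_K: "x \<in> K \<Longrightarrow> y \<in> K \<Longrightarrow> x + y \<in> K"
    and uminus_K: "x \<in> K \<Longrightarrow> - x \<in> K"
    and mult_K: "x \<in> K \<Longrightarrow> y \<in> K \<Longrightarrow> x * y \<in> K"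
    and finite_B: "finite B"
    and indep_B: "ratvs.independent B"
    and span_B: "ratvs.span B = K"

lemma number_field_basis:
  assumes "number_field K"
  obtains B where "number_basis K B"
proof -
  have sf: "subfield K (ring_of_type_algebra :: real ring)" using assms by (simp add: number_field_def)
  then interpret K: subring K "ring_of_type_algebra :: real ring"
    by (simp add: subfield_def subdomain_def subcring_def)
  obtain n where "ring.dimension (ring_of_type_algebra :: real ring) n \<rat> K"
    using assms by (auto simp: number_field_def)
  then obtain B0 where B0: "finite B0" "ratvs.span B0 = K" using dimension_imp_span by blast
  obtain B where B: "B \<subseteq> B0" "ratvs.independent B" "ratvs.span B = ratvs.span B0"
    using ratvs.maximal_independent_subset[of B0] ratvs.span_superset
    by (metis ratvs.span_mono ratvs.span_span subset_antisym)
  show ?thesis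
  proof (rule that[of B], unfold_locales)
    show "1 \<in> K" using K.one_closed by simp
    show "x + y \<in> K" "x * y \<in> K" if "x \<in> K" "y \<in> K" for x y
      using ratvs.span_add[of x B0 y] K.m_closed[OF that] that B0(2) by simp_all
    show "- x \<in> K" if "x \<in> K" for x
      using ratvs.span_neg[of x B0] that B0(2) by simp
    show "finite B" using B B0 finite_subset by blast
    show "ratvs.independent B" "ratvs.span B = K" using B B0 by auto
  qed
qed

context number_basis
begin

abbreviation coord :: "real \<Rightarrow> real \<Rightarrow> rat" where
  "coord \<equiv> ratvs.representation B"

lemma K_zero: "0 \<in> K" using ratvs.span_zero[of B] by (simp add: span_B)

lemma of_rat_K: "of_rat q * x \<in> K" if "x \<in> K"
  using ratvs.span_scale[of x B q] that by (simp add: span_B)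

lemma of_int_K: "of_int m * x \<in> K" if "x \<in> K"
  using of_rat_K[OF that, of "of_int m"] by simp

lemma of_nat_K: "of_nat m * x \<in> K" if "x \<in> K"
  using of_rat_K[OF that, of "of_nat m"] by simp

lemma minus_K: "x \<in> K \<Longrightarrow> y \<in> K \<Longrightarrow> x - y \<in> K"
  using add_K[of x "- y"] uminus_K[of y] by simp

lemma sum_K: "(\<And>i. i \<in> I \<Longrightarrow> f i \<in> K) \<Longrightarrow> sum f I \<in> K"
  by (induction I rule: infinite_finite_induct) (auto simp: K_zero add_K)

lemma power_K: "x \<in> K \<Longrightarrow> x ^ k \<in> K"
  by (induction k) (auto simp: one_K mult_K)

lemma B_K: "B \<subseteq> K"
  using ratvs.span_superset[of B] span_B by simp

lemma coord_sum: "x \<in> K \<Longrightarrow> (\<Sum>b\<in>B. of_rat (coord x b) * b) = x"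
  using ratvs.sum_representation_eq[OF indep_B _ finite_B subset_refl, of x] by (simp add: span_B)

lemma coord_add: "x \<in> K \<Longrightarrow> y \<in> K \<Longrightarrow> coord (x + y) b = coord x b + coord y b"
  using ratvs.representation_add[OF indep_B] by (simp add: span_B)

lemma coord_of_rat: "x \<in> K \<Longrightarrow> coord (of_rat q * x) b = q * coord x b"
  using ratvs.representation_scale[OF indep_B] by (simp add: span_B)

lemma coord_of_int: "x \<in> K \<Longrightarrow> coord (of_int m * x) b = of_int m * coord x b"
  using coord_of_rat[of x "of_int m" b] by simp

lemma coord_of_nat: "x \<in> K \<Longrightarrow> coord (of_nat m * x) b = of_nat m * coord x b"
  using coord_of_rat[of x "of_nat m" b] by simp

lemma coord_diff: "x \<in> K \<Longrightarrow> y \<in> K \<Longrightarrow> coord (x - y) b = coord x b - coord y b"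
  using ratvs.representation_diff[OF indep_B] by (simp add: span_B)

lemma coord_zero [simp]: "coord 0 b = 0"
  using ratvs.representation_zero by simp

lemma coord_sum_fun: "(\<And>i. i \<in> I \<Longrightarrow> f i \<in> K) \<Longrightarrow> coord (sum f I) b = (\<Sum>i\<in>I. coord (f i) b)"
  by (induction I rule: infinite_finite_induct) (auto simp: coord_add sum_K)

lemma coord_basis: "b \<in> B \<Longrightarrow> coord b b' = (if b' = b then 1 else 0)"
  using ratvs.representation_basis[OF indep_B] by auto

text \<open>The l1 norm of the coordinates. Nonzero elements with a common denominator have size
  bounded away from 0, whereas their real absolute values can be arbitrarily small.\<close>

definition size1 :: "real \<Rightarrow> real" where
  "size1 x = (\<Sum>b\<in>B. \<bar>of_rat (coord x b)\<bar>)"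

text \<open>A bound for the structure constants of multiplication in the basis; the summand 1 makes
  \<open>size\<close> dominate \<open>size1\<close>.\<close>

definition Cst :: real where
  "Cst = 1 + (\<Sum>b\<in>B. \<Sum>b'\<in>B. size1 (b * b'))"

text \<open>The factor \<^term>\<open>Cst\<close> makes the size submultiplicative.\<close>

definition size :: "real \<Rightarrow> real" where
  "size x = Cst * size1 x"

lemma size1_nonneg: "0 \<le> size1 x"
  by (simp add: size1_def sum_nonneg)

lemma Cst_ge_1: "1 \<le> Cst"
  by (simp add: Cst_def sum_nonneg size1_nonneg)

lemma size_nonneg: "0 \<le> size x"
  using Cst_ge_1 size1_nonneg[of x] by (simp add: size_def)

lemma size1_add: "x \<in> K \<Longrightarrow> y \<in> K \<Longrightarrow> size1 (x + y) \<le> size1 x + size1 y"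
  unfolding size1_def sum.distrib[symmetric]
  by (intro sum_mono) (simp only: coord_add of_rat_add abs_triangle_ineq)

lemma size_add: "x \<in> K \<Longrightarrow> y \<in> K \<Longrightarrow> size (x + y) \<le> size x + size y"
  using mult_left_mono[OF size1_add[of x y], of Cst] Cst_ge_1 by (simp add: size_def distrib_left)

lemma size1_zero [simp]: "size1 0 = 0"
  by (simp add: size1_def)

lemma size1_sum: "(\<And>i. i \<in> I \<Longrightarrow> f i \<in> K) \<Longrightarrow> size1 (sum f I) \<le> (\<Sum>i\<in>I. size1 (f i))"
proof (induction I rule: infinite_finite_induct)
  case (insert i I)
  have "size1 (sum f (insert i I)) \<le> size1 (f i) + size1 (sum f I)"
    using insert size1_add[of "f i" "sum f I"] sum_K[of I f] by simp
  also have "size1 (sum f I) \<le> (\<Sum>i\<in>I. size1 (f i))" using insert by simp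
  finally show ?case using insert by simp
qed auto

lemma size1_of_rat: "x \<in> K \<Longrightarrow> size1 (of_rat q * x) = \<bar>of_rat q\<bar> * size1 x"
  by (simp add: size1_def coord_of_rat of_rat_mult abs_mult sum_distrib_left)

lemma size_of_nat: "x \<in> K \<Longrightarrow> size (of_nat m * x) = of_nat m * size x"
  using size1_of_rat[of x "of_nat m"] by (simp add: size_def)

lemma size_uminus: "x \<in> K \<Longrightarrow> size (- x) = size x"
  using size1_of_rat[of x "-1"] by (simp add: size_def)

lemma size1_mult:
  assumes "x \<in> K" "y \<in> K"
  shows "size1 (x * y) \<le> Cst * size1 x * size1 y"
proof -
  have K: "of_rat q * b \<in> K" if "b \<in> K" for q b using of_rat_K that by blast
  have BB: "b * b' \<in> K" if "b \<in> B" "b' \<in> B" for b b' using that B_K mult_K by blast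
  have le: "size1 (b * b') \<le> Cst" if "b \<in> B" "b' \<in> B" for b b'
  proof -
    have "size1 (b * b') \<le> (\<Sum>b'\<in>B. size1 (b * b'))"
      using that finite_B size1_nonneg by (intro member_le_sum) auto
    also have "\<dots> \<le> (\<Sum>b\<in>B. \<Sum>b'\<in>B. size1 (b * b'))"
      using that finite_B size1_nonneg
      by (intro member_le_sum[of b B "\<lambda>b. \<Sum>b'\<in>B. size1 (b * b')"]) (auto intro: sum_nonneg)
    finally show ?thesis by (simp add: Cst_def)
  qed
  have "x * y = (\<Sum>b\<in>B. of_rat (coord x b) * b) * (\<Sum>b'\<in>B. of_rat (coord y b') * b')"
    using assms by (simp add: coord_sum)
  also have "\<dots> = (\<Sum>b\<in>B. \<Sum>b'\<in>B. of_rat (coord x b * coord y b') * (b * b'))"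
    by (simp add: sum_product of_rat_mult mult_ac)
  finally have "size1 (x * y) = size1 (\<Sum>b\<in>B. \<Sum>b'\<in>B. of_rat (coord x b * coord y b') * (b * b'))"
    by (rule arg_cong)
  also have "\<dots> \<le> (\<Sum>b\<in>B. size1 (\<Sum>b'\<in>B. of_rat (coord x b * coord y b') * (b * b')))"
    using BB K by (intro size1_sum sum_K) blast
  also have "\<dots> \<le> (\<Sum>b\<in>B. \<Sum>b'\<in>B. size1 (of_rat (coord x b * coord y b') * (b * b')))"
    using BB K by (intro sum_mono size1_sum) blast
  also have "\<dots> = (\<Sum>b\<in>B. \<Sum>b'\<in>B. \<bar>of_rat (coord x b)\<bar> * \<bar>of_rat (coord y b')\<bar> * size1 (b * b'))"
    
  proof (intro sum.cong refl)
    fix b b' assume "b \<in> B" "b' \<in> B"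
    thus "size1 (of_rat (coord x b * coord y b') * (b * b')) =
        \<bar>of_rat (coord x b)\<bar> * \<bar>of_rat (coord y b')\<bar> * size1 (b * b')"
      using size1_of_rat[OF BB, of b b' "coord x b * coord y b'"] by (simp only: of_rat_mult abs_mult)
  qed
  also have "\<dots> \<le> (\<Sum>b\<in>B. \<Sum>b'\<in>B. \<bar>of_rat (coord x b)\<bar> * \<bar>of_rat (coord y b')\<bar> * Cst)"
    using le by (intro sum_mono mult_left_mono) auto
  also have "\<dots> = Cst * size1 x * size1 y"
    by (simp add: size1_def sum_product sum_distrib_left sum_distrib_right mult_ac)
  finally show ?thesis .
qed

lemma size_mult:
  assumes "x \<in> K" "y \<in> K" shows "size (x * y) \<le> size x * size y"
  using mult_left_mono[OF size1_mult[OF assms], of Cst] Cst_ge_1 by (simp add: size_def mult_ac)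

text \<open>Restricted to positive exponents because \<open>size 1\<close> may exceed 1.\<close>

lemma size_power:
  assumes "x \<in> K" shows "size (x ^ Suc k) \<le> size x ^ Suc k"
proof (induction k)
  case (Suc k)
  have "size (x ^ Suc (Suc k)) \<le> size x * size (x ^ Suc k)"
    using size_mult[OF assms power_K[OF assms, of "Suc k"]] by simp
  also have "\<dots> \<le> size x * size x ^ Suc k"
    using Suc size_nonneg by (intro mult_left_mono) auto
  finally show ?case by simp
qed simp

text \<open>The lattice spanned over the integers by the basis divided by \<open>D\<close>.\<close>

definition lat :: "nat \<Rightarrow> real \<Rightarrow> bool" where
  "lat D x \<longleftrightarrow> x \<in> K \<and> (\<forall>b\<in>B. of_nat D * coord x b \<in> \<int>)"

lemma lat_K: "lat D x \<Longrightarrow> x \<in> K" by (simp add: lat_def)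

lemma lat_add: "lat D x \<Longrightarrow> lat D y \<Longrightarrow> lat D (x + y)"
  by (auto simp: lat_def add_K coord_add distrib_left)

lemma lat_zero: "lat D 0" by (simp add: lat_def K_zero)

lemma lat_sum: "(\<And>i. i \<in> I \<Longrightarrow> lat D (f i)) \<Longrightarrow> lat D (sum f I)"
  by (induction I rule: infinite_finite_induct) (auto simp: lat_zero lat_add)

lemma lat_of_int: "lat D x \<Longrightarrow> lat D (of_int m * x)"
proof -
  assume x: "lat D x"
  have "of_nat D * coord (of_int m * x) b \<in> \<int>" if "b \<in> B" for b
  proof -
    have "of_nat D * coord (of_int m * x) b = of_int m * (of_nat D * coord x b)"
      using x by (simp add: lat_def coord_of_int)
    moreover have "of_int m * (of_nat D * coord x b) \<in> \<int>"
      using x that by (intro Ints_mult[OF Ints_of_int]) (simp add: lat_def)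
    ultimately show ?thesis by (simp only:)
  qed
  thus ?thesis using x by (simp add: lat_def of_int_K)
qed

lemma lat_of_nat: "lat D x \<Longrightarrow> lat D (of_nat m * x)"
  using lat_of_int[of D x "int m"] by simp

lemma Ints_of_nat_dvd:
  fixes q :: rat
  assumes "of_nat D * q \<in> \<int>" "D dvd D'" shows "of_nat D' * q \<in> \<int>"
proof -
  obtain k where "D' = D * k" using assms(2) by blast
  hence "of_nat D' * q = of_nat k * (of_nat D * q)" by simp
  moreover have "of_nat k * (of_nat D * q) \<in> \<int>" by (intro Ints_mult Ints_of_nat assms(1))
  ultimately show ?thesis by (simp only:)
qed

lemma lat_dvd: "lat D x \<Longrightarrow> D dvd D' \<Longrightarrow> lat D' x"
  by (auto simp: lat_def intro: Ints_of_nat_dvd)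

lemma rat_denominator: "\<exists>D>0. of_nat D * (q::rat) \<in> \<int>"
proof -
  obtain a d where q: "q = of_int a / of_int d" "d > 0" using quotient_of_div[of q] quotient_of_denom_pos[of q]
    by (metis prod.exhaust)
  hence "of_nat (nat d) * q = of_int a" by simp
  thus ?thesis using q(2) by (intro exI[of _ "nat d"]) auto
qed

text \<open>The product of the individual witnesses works for all elements at once. This is the
  device for clearing finitely many denominators, with \<open>Q\<close> stable under passage to
  multiples.\<close>

lemma common_multiple:
  fixes Q :: "nat \<Rightarrow> 'x \<Rightarrow> bool"
  assumes "finite Y" "\<And>x. x \<in> Y \<Longrightarrow> \<exists>D>0. Q D x" "\<And>D D' x. x \<in> Y \<Longrightarrow> Q D x \<Longrightarrow> D dvd D' \<Longrightarrow> D' > 0 \<Longrightarrow> Q D' x"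
  shows "\<exists>D>0. \<forall>x\<in>Y. Q D x"
proof -
  obtain f where f: "\<And>x. x \<in> Y \<Longrightarrow> f x > 0 \<and> Q (f x) x" using assms(2) by metis
  have "0 < (\<Prod>x\<in>Y. f x)" using f by (simp add: prod_pos)
  moreover have "Q (\<Prod>x\<in>Y. f x) x" if "x \<in> Y" for x
    using assms(3)[OF that] f[OF that] that assms(1) dvd_prodI[of Y x f] \<open>0 < (\<Prod>x\<in>Y. f x)\<close> by blast
  ultimately show ?thesis by blast
qed

lemma lat_exists:
  assumes "x \<in> K" shows "\<exists>D>0. lat D x"
proof -
  have "\<exists>D>0. \<forall>b\<in>B. of_nat D * coord x b \<in> \<int>"
    using finite_B rat_denominator
    by (intro common_multiple) (auto intro: Ints_of_nat_dvd)
  thus ?thesis using assms by (auto simp: lat_def)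
qed

lemma lat_finite:
  assumes "finite Y" "Y \<subseteq> K" shows "\<exists>D>0. \<forall>x\<in>Y. lat D x"
  using assms lat_exists by (intro common_multiple) (auto intro: lat_dvd)

lemma lat_expansion:
  assumes "lat D x"
  obtains n where "of_nat D * x = (\<Sum>b\<in>B. of_int (n b) * b)"
proof -
  have "\<forall>b\<in>B. \<exists>n. of_nat D * coord x b = of_int n" using assms by (auto simp: lat_def Ints_def)
  then obtain n where n: "\<And>b. b \<in> B \<Longrightarrow> of_nat D * coord x b = of_int (n b)" by metis
  have n': "real D * of_rat (coord x b) = of_int (n b)" if "b \<in> B" for b
    using arg_cong[OF n[OF that], of "of_rat :: rat \<Rightarrow> real"] by (simp add: of_rat_mult)
  have "of_nat D * x = of_nat D * (\<Sum>b\<in>B. of_rat (coord x b) * b)"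
    using coord_sum[OF lat_K[OF assms]] by simp
  also have "\<dots> = (\<Sum>b\<in>B. of_int (n b) * b)"
    using n' by (simp add: sum_distrib_left flip: mult.assoc)
  finally show ?thesis by (rule that)
qed

lemma lat_size_ge:
  assumes x: "lat D x" "x \<noteq> 0" and D: "D > 0"
  shows "1 / of_nat D \<le> size x"
proof -
  have xK: "x \<in> K" using x by (simp add: lat_def)
  have "\<exists>b\<in>B. coord x b \<noteq> 0"
  proof (rule ccontr)
    assume "\<not> ?thesis"
    thus False using coord_sum[OF xK] x(2) by simp
  qed
  then obtain b where b: "b \<in> B" "coord x b \<noteq> 0" by blast
  obtain m where m: "of_nat D * coord x b = of_int m" using x b by (auto simp: lat_def Ints_def)
  have "m \<noteq> 0" using m b D by auto
  hence "1 \<le> \<bar>real_of_int m\<bar>" by linarith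
  also have "real_of_int m = of_nat D * of_rat (coord x b)"
    using arg_cong[OF m, of "of_rat :: rat \<Rightarrow> real"] by (simp add: of_rat_mult)
  finally have "1 / of_nat D \<le> \<bar>real_of_rat (coord x b)\<bar>" using D by (simp add: abs_mult field_simps)
  also have "\<dots> \<le> size1 x"
    unfolding size1_def using b finite_B by (intro member_le_sum[of b B "\<lambda>b. \<bar>of_rat (coord x b)\<bar>"]) auto
  also have "\<dots> \<le> size x" unfolding size_def using Cst_ge_1 size1_nonneg[of x] by (simp add: mult_le_cancel_right1)
  finally show ?thesis .
qed

text \<open>The powers of an algebraic integer have bounded denominators, so their sizes cannot tend to 0.\<close>

lemma size_algebraic_int_ge_1:
  assumes "algebraic_int x" "x \<in> K" "x \<noteq> 0"
  shows "1 \<le> size x"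
proof (rule ccontr)
  assume "\<not> ?thesis"
  hence lt: "size x < 1" by simp
  obtain d c where d: "0 < d" "x ^ d = (\<Sum>i<d. of_int (c i) * x ^ i)"
    using algebraic_int_power_reduce[OF assms(1)] .
  obtain D where D: "D > 0" "\<forall>y\<in>(\<lambda>i. x ^ i) ` {..<d}. lat D y"
    using lat_finite[of "(\<lambda>i. x ^ i) ` {..<d}"] power_K[OF assms(2)] by auto
  have low: "lat D (x ^ k)" for k
  proof (induction k rule: less_induct)
    case (less k)
    show ?case
    proof (cases "k < d")
      case True
      thus ?thesis using D by auto
    next
      case False
      have "x ^ k = x ^ (k - d) * x ^ d" using False by (simp flip: power_add)
      also have "\<dots> = (\<Sum>i<d. of_int (c i) * x ^ (k - d + i))"
        by (simp add: d(2) sum_distrib_left power_add mult_ac)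
      finally show ?thesis
        using less False by (auto intro!: lat_sum lat_of_int)
    qed
  qed
  have "1 / of_nat D \<le> size x ^ Suc k" for k
    using lat_size_ge[OF low[of "Suc k"] _ D(1)] size_power[OF assms(2), of k] assms(3) by force
  moreover have "(\<lambda>k. size x ^ Suc k) \<longlonglongrightarrow> 0"
    using LIMSEQ_Suc[OF LIMSEQ_realpow_zero[OF size_nonneg lt]] .
  ultimately have "1 / of_nat D \<le> (0::real)"
    by (intro LIMSEQ_le_const[of "\<lambda>k. size x ^ Suc k"]) auto
  thus False using D(1) by simp
qed

lemma B_nonzero: "b \<in> B \<Longrightarrow> b \<noteq> 0"
  using ratvs.dependent_zero indep_B by blast

lemma B_nonempty: "B \<noteq> {}"
  using one_K span_B by auto

text \<open>Multiplication by \<open>x\<close> has a rational matrix in the basis. Clearing its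
  denominators gives a multiple of \<open>x\<close> that maps the integral span of the basis into
  itself.\<close>

lemma algebraic_int_multiple:
  assumes "x \<in> K" shows "\<exists>D>0. algebraic_int (of_nat D * x)"
proof -
  obtain D where D: "D > 0" "\<forall>y\<in>(\<lambda>b. x * b) ` B. lat D y"
    using lat_finite[of "(\<lambda>b. x * b) ` B"] finite_B B_K mult_K assms by auto
  obtain b0 where b0: "b0 \<in> B" using B_nonempty by blast
  have "of_nat D * x * s \<in> zmod.span B" if s: "s \<in> B" for s
  proof -
    have "lat D (x * s)" using D s by blast
    then obtain m where "of_nat D * (x * s) = (\<Sum>b\<in>B. of_int (m b) * b)" by (rule lat_expansion)
    hence "of_nat D * x * s = (\<Sum>b\<in>B. of_int (m b) * b)" by (simp add: mult.assoc)
    thus ?thesis by (simp only:) (intro zmod.span_sum zmod.span_scale zmod.span_base)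
  qed
  hence "algebraic_int (of_nat D * x)"
    by (rule algebraic_int_if_stable_zspan[OF finite_B b0 B_nonzero[OF b0]])
  thus ?thesis using D(1) by blast
qed

lemma int_ring_add: "x \<in> int_ring K \<Longrightarrow> y \<in> int_ring K \<Longrightarrow> x + y \<in> int_ring K"
  and int_ring_mult: "x \<in> int_ring K \<Longrightarrow> y \<in> int_ring K \<Longrightarrow> x * y \<in> int_ring K"
  and int_ring_uminus: "x \<in> int_ring K \<Longrightarrow> - x \<in> int_ring K"
  by (auto simp: int_ring_def add_K mult_K uminus_K algebraic_int_add algebraic_int_mult)

lemma int_ring_diff: "x \<in> int_ring K \<Longrightarrow> y \<in> int_ring K \<Longrightarrow> x - y \<in> int_ring K"
  using int_ring_add[of x "- y"] int_ring_uminus[of y] by simp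

lemma int_ring_of_int: "of_int m \<in> int_ring K"
  using of_int_K[OF one_K, of m] by (simp add: int_ring_def)

lemma int_ring_of_nat: "of_nat m \<in> int_ring K"
  using int_ring_of_int[of "int m"] by simp

lemma int_ring_0: "0 \<in> int_ring K" and int_ring_1: "1 \<in> int_ring K"
  using int_ring_of_int[of 0] int_ring_of_int[of 1] by simp_all

lemma int_ring_sum: "(\<And>i. i \<in> I \<Longrightarrow> f i \<in> int_ring K) \<Longrightarrow> sum f I \<in> int_ring K"
  by (induction I rule: infinite_finite_induct) (auto simp: int_ring_0 int_ring_add)

text \<open>Distinct algebraic integers are at distance at least 1 in size, so only finitely many of them
  have bounded coordinates; the others are translates of these by integral combinations of multiples of
  the basis.\<close>

lemma int_ring_lat: "\<exists>D>0. \<forall>x\<in>int_ring K. lat D x"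
proof -
  have "\<exists>M>0. \<forall>b\<in>B. algebraic_int (of_nat M * b)"
  proof (rule common_multiple[OF finite_B])
    show "\<exists>D>0. algebraic_int (of_nat D * b)" if "b \<in> B" for b
      using that B_K algebraic_int_multiple by blast
    show "algebraic_int (of_nat D' * b)" if "algebraic_int (of_nat D * b)" "D dvd D'" for D D' and b :: real
    proof -
      obtain k where "D' = D * k" using \<open>D dvd D'\<close> by blast
      hence "of_nat D' * b = of_nat k * (of_nat D * b)" by simp
      thus ?thesis using that(1) by (metis algebraic_int_mult algebraic_int_of_nat)
    qed
  qed
  then obtain M where M: "M > 0" "\<And>b. b \<in> B \<Longrightarrow> algebraic_int (of_nat M * b)" by blast
  have MB: "of_nat M * b \<in> int_ring K" if "b \<in> B" for b
    using M(2)[OF that] of_nat_K B_K that by (auto simp: int_ring_def)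
  \<comment> \<open>The integers of the field in a half-open box, a fundamental domain for the
    translations by \<open>M\<close> times the basis.\<close>
  define P where "P = {x \<in> int_ring K. \<forall>b\<in>B. 0 \<le> coord x b \<and> coord x b < of_nat M}"
  have PK: "x \<in> K" if "x \<in> P" for x using that by (simp add: P_def int_ring_def)
  have "finite P"
  proof -
    \<comment> \<open>The box is divided into cells of side \<open>1 / t\<close>. Two integers in
      one cell would differ by an element of size at most \<open>Cst * card B / t\<close>, which is
      below 1.\<close>
    obtain t :: nat where t: "Cst * card B < real t" using reals_Archimedean2 by blast
    have t0: "0 < real t" using t Cst_ge_1 by (smt (verit) mult_nonneg_nonneg of_nat_0_le_iff)
    define cell where "cell x = restrict (\<lambda>b. \<lfloor>of_nat t * coord x b\<rfloor>) B" for x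
    have "cell ` P \<subseteq> B \<rightarrow>\<^sub>E {0..int t * int M}"
    proof
      fix f assume "f \<in> cell ` P"
      then obtain x where x: "x \<in> P" "f = cell x" by blast
      have "0 \<le> \<lfloor>of_nat t * coord x b\<rfloor> \<and> \<lfloor>of_nat t * coord x b\<rfloor> \<le> int t * int M" if "b \<in> B" for b
      proof
        have c: "0 \<le> coord x b" "coord x b < of_nat M" using x that by (auto simp: P_def)
        thus "0 \<le> \<lfloor>of_nat t * coord x b\<rfloor>" by simp
        have "of_nat t * coord x b \<le> of_int (int t * int M)" using c by (simp add: mult_left_mono)
        thus "\<lfloor>of_nat t * coord x b\<rfloor> \<le> int t * int M" by linarith
      qed
      thus "f \<in> B \<rightarrow>\<^sub>E {0..int t * int M}" by (auto simp: x(2) cell_def)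
    qed
    hence "finite (cell ` P)" using finite_PiE[OF finite_B] by (metis finite_atLeastAtMost_int finite_subset)
    moreover have "inj_on cell P"
    proof (rule inj_onI, rule ccontr)
      fix x y assume xy: "x \<in> P" "y \<in> P" "cell x = cell y" "x \<noteq> y"
      have K: "x \<in> K" "y \<in> K" using xy PK by auto
      have close: "\<bar>real_of_rat (coord (x - y) b)\<bar> \<le> 1 / t" if "b \<in> B" for b
      proof -
        have "\<lfloor>of_nat t * coord x b\<rfloor> = \<lfloor>of_nat t * coord y b\<rfloor>"
          using fun_cong[OF xy(3), of b] that by (simp add: cell_def)
        hence "\<bar>of_nat t * coord x b - of_nat t * coord y b\<bar> < 1" by linarith
        hence "\<bar>of_nat t * coord (x - y) b\<bar> < 1" by (simp add: coord_diff K right_diff_distrib)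
        hence "of_rat \<bar>of_nat t * coord (x - y) b\<bar> < (1::real)" by (simp add: of_rat_less_1_iff)
        hence "real t * \<bar>of_rat (coord (x - y) b)\<bar> < 1" by (simp add: of_rat_mult abs_mult)
        thus ?thesis using t0 by (simp add: field_simps)
      qed
      have "size1 (x - y) \<le> (\<Sum>b\<in>B. 1 / t)" unfolding size1_def using close by (intro sum_mono)
      hence "size (x - y) \<le> Cst * (card B / t)" unfolding size_def using Cst_ge_1 by (intro mult_left_mono) auto
      also have "\<dots> < 1" using t t0 by (simp add: field_simps)
      finally have "size (x - y) < 1" .
      moreover have "x - y \<in> int_ring K" using xy int_ring_diff by (auto simp: P_def)
      hence "1 \<le> size (x - y)" using xy(4) by (intro size_algebraic_int_ge_1) (auto simp: int_ring_def)
      ultimately show False by simp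
    qed
    ultimately show ?thesis using finite_imageD by blast
  qed
  then obtain D where D: "D > 0" "\<forall>x\<in>P. lat D x" using lat_finite[of P] PK by blast
  have latb: "lat D b" if "b \<in> B" for b
    using that B_K coord_basis[OF that] by (auto simp: lat_def)
  have "lat D x" if x: "x \<in> int_ring K" for x
  proof -
    have xK: "x \<in> K" using x by (simp add: int_ring_def)
    \<comment> \<open>The integral translation that moves \<open>x\<close> into the box.\<close>
    define k where "k b = \<lfloor>coord x b / of_nat M\<rfloor>" for b
    define s where "s = (\<Sum>b\<in>B. of_int (k b) * (of_nat M * b))"
    have sI: "s \<in> int_ring K"
      unfolding s_def by (intro int_ring_sum int_ring_mult int_ring_of_int MB)
    have sK: "s \<in> K" using sI by (simp add: int_ring_def)
    have cs: "coord s b = of_int (k b) * of_nat M" if b: "b \<in> B" for b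
    proof -
      have "coord s b = (\<Sum>b'\<in>B. coord (of_int (k b') * (of_nat M * b')) b)"
        unfolding s_def using B_K by (intro coord_sum_fun of_int_K of_nat_K) auto
      also have "\<dots> = (\<Sum>b'\<in>B. if b = b' then of_int (k b') * of_nat M else 0)"
      proof (intro sum.cong refl)
        fix b' assume b': "b' \<in> B"
        thus "coord (of_int (k b') * (of_nat M * b')) b = (if b = b' then of_int (k b') * of_nat M else 0)"
          using B_K of_nat_K[of b' M] by (auto simp: coord_of_int coord_of_nat coord_basis)
      qed
      finally show ?thesis using b finite_B by simp
    qed
    have "x - s \<in> P"
      unfolding P_def
    proof (intro CollectI conjI ballI)
      show "x - s \<in> int_ring K" using x sI by (rule int_ring_diff)
      fix b assume b: "b \<in> B"
      have c: "coord (x - s) b = coord x b - of_int (k b) * of_nat M"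
        using xK sK b by (simp add: coord_diff cs)
      have M0: "(0::rat) < of_nat M" using M by simp
      have "of_int (k b) \<le> coord x b / of_nat M" "coord x b / of_nat M < of_int (k b) + 1"
        unfolding k_def by linarith+
      thus "0 \<le> coord (x - s) b" "coord (x - s) b < of_nat M"
        unfolding c using M0 by (simp_all add: pos_le_divide_eq pos_divide_less_eq distrib_right)
    qed
    hence "lat D (x - s)" using D by blast
    moreover have "lat D s"
      unfolding s_def using latb by (intro lat_sum lat_of_int lat_of_nat)
    ultimately show ?thesis using lat_add[of D "x - s" s] by simp
  qed
  thus ?thesis using D(1) by blast
qed

end

section \<open>Quaternion orders\<close>

lemma vector_4 [simp]:
  "(vector [x, y, z, w] :: ('a::zero)^4)$1 = x" "(vector [x, y, z, w] :: ('a::zero)^4)$2 = y"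
  "(vector [x, y, z, w] :: ('a::zero)^4)$3 = z" "(vector [x, y, z, w] :: ('a::zero)^4)$4 = w"
  unfolding vector_def by auto

lemma vec4_eq_iff: "(x :: real^4) = y \<longleftrightarrow> x$1 = y$1 \<and> x$2 = y$2 \<and> x$3 = y$3 \<and> x$4 = y$4"
  by (simp add: Finite_Cartesian_Product.vec_eq_iff forall_4)

lemma axis4_nth [simp]:
  "(axis i c :: real^4)$j = (if i = j then c else 0)"
  by (simp add: axis_def)

lemma quat_mult_nth [simp]:
  "quat_mult \<alpha> \<beta> x y $ 1 = x$1 * y$1 + \<alpha> * (x$2 * y$2) + \<beta> * (x$3 * y$3) - \<alpha> * \<beta> * (x$4 * y$4)"
  "quat_mult \<alpha> \<beta> x y $ 2 = x$1 * y$2 + x$2 * y$1 - \<beta> * (x$3 * y$4) + \<beta> * (x$4 * y$3)"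
  "quat_mult \<alpha> \<beta> x y $ 3 = x$1 * y$3 + x$3 * y$1 + \<alpha> * (x$2 * y$4) - \<alpha> * (x$4 * y$2)"
  "quat_mult \<alpha> \<beta> x y $ 4 = x$1 * y$4 + x$4 * y$1 + x$2 * y$3 - x$3 * y$2"
  by (simp_all add: quat_mult_def)

lemma quat_mult_one [simp]:
  "quat_mult \<alpha> \<beta> (axis 1 1) x = x" "quat_mult \<alpha> \<beta> x (axis 1 1) = x"
  by (simp_all add: vec4_eq_iff)

lemma quat_mult_diff:
  "quat_mult \<alpha> \<beta> (x - y) z = quat_mult \<alpha> \<beta> x z - quat_mult \<alpha> \<beta> y z"
  "quat_mult \<alpha> \<beta> z (x - y) = quat_mult \<alpha> \<beta> z x - quat_mult \<alpha> \<beta> z y"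
  by (simp_all add: vec4_eq_iff algebra_simps)

lemma quat_mult_scaleR:
  "quat_mult \<alpha> \<beta> (c *\<^sub>R x) y = c *\<^sub>R quat_mult \<alpha> \<beta> x y"
  "quat_mult \<alpha> \<beta> x (c *\<^sub>R y) = c *\<^sub>R quat_mult \<alpha> \<beta> x y"
  by (simp_all add: vec4_eq_iff algebra_simps)

lemma reduced_norm_mult:
  "reduced_norm \<alpha> \<beta> (quat_mult \<alpha> \<beta> x y) = reduced_norm \<alpha> \<beta> x * reduced_norm \<alpha> \<beta> y"
  unfolding reduced_norm_def quat_mult_nth by (simp add: power2_eq_square algebra_simps)

locale quat_data = number_basis K B for K B :: "real set" +
  fixes \<alpha> \<beta> :: real and \<OO> :: "(real^4) set" and \<xi> :: "real^4 \<Rightarrow> real^2^2"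
  assumes \<alpha>: "\<alpha> \<in> K" "\<alpha> \<noteq> 0" and \<beta>: "\<beta> \<in> K" "\<beta> \<noteq> 0"
    and order: "quaternion_order K \<alpha> \<beta> \<OO>"
    and embedding: "alg_embedding K \<alpha> \<beta> \<xi>"
begin

abbreviation V :: "(real^4) set" where "V \<equiv> {x. \<forall>i. x$i \<in> K}"
abbreviation qm :: "real^4 \<Rightarrow> real^4 \<Rightarrow> real^4" where "qm \<equiv> quat_mult \<alpha> \<beta>"
abbreviation e1 :: "real^4" where "e1 \<equiv> axis 1 1"

lemma carrier_V: "carrier (quaternion_algebra K \<alpha> \<beta>) = V"
  by (simp add: quaternion_algebra_def)

lemma V_mult: "x \<in> V \<Longrightarrow> y \<in> V \<Longrightarrow> qm x y \<in> V"
  using \<alpha> \<beta> by (simp add: forall_4 add_K minus_K mult_K)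

lemma V_axis: "axis i 1 \<in> V"
  by (simp add: one_K K_zero)

lemma \<xi>_mult: "x \<in> V \<Longrightarrow> y \<in> V \<Longrightarrow> \<xi> (qm x y) = \<xi> x ** \<xi> y"
  using embedding unfolding alg_embedding_def carrier_V
  by (auto simp: Ring.ring_hom_def quaternion_algebra_def mat_ring_def)

lemma \<xi>_add: "x \<in> V \<Longrightarrow> y \<in> V \<Longrightarrow> \<xi> (x + y) = \<xi> x + \<xi> y"
  using embedding unfolding alg_embedding_def carrier_V
  by (auto simp: Ring.ring_hom_def quaternion_algebra_def mat_ring_def)

lemma \<xi>_one: "\<xi> e1 = mat 1"
  using embedding unfolding alg_embedding_def carrier_V
  by (auto simp: Ring.ring_hom_def quaternion_algebra_def mat_ring_def)

lemma \<xi>_scale: "k \<in> K \<Longrightarrow> x \<in> V \<Longrightarrow> \<xi> (k *\<^sub>R x) = k *\<^sub>R \<xi> x"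
  using embedding unfolding alg_embedding_def carrier_V by auto

lemma \<xi>_inj: "x \<in> V \<Longrightarrow> y \<in> V \<Longrightarrow> \<xi> x = \<xi> y \<Longrightarrow> x = y"
  using embedding unfolding alg_embedding_def carrier_V by (auto dest: inj_onD)

text \<open>The images of \<open>i\<close>, \<open>j\<close>, \<open>ij\<close> are traceless since they anticommute with an invertible
  matrix.\<close>

lemma trace_\<xi>:
  assumes x: "x \<in> V"
  shows "trace (\<xi> x) = 2 * x$1"
proof -
  define I J where "I = \<xi> (axis 2 1)" and "J = \<xi> (axis 3 1)"
  have ij: "\<xi> (axis 4 1) = I ** J"
    unfolding I_def J_def using V_axis
    by (subst \<xi>_mult[symmetric]) (auto intro!: arg_cong[of _ _ \<xi>] simp: vec4_eq_iff)
  have ji: "J ** I = (-1) *\<^sub>R \<xi> (axis 4 1)"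
    unfolding I_def J_def using V_axis uminus_K[OF one_K]
    by (subst \<xi>_mult[symmetric], simp, simp, subst \<xi>_scale[symmetric])
      (auto intro!: arg_cong[of _ _ \<xi>] simp: vec4_eq_iff)
  have II: "I ** I = \<alpha> *\<^sub>R mat 1"
    unfolding I_def using V_axis \<alpha>
    by (subst \<xi>_mult[symmetric], simp, simp, subst \<xi>_one[symmetric], subst \<xi>_scale[symmetric])
      (auto intro!: arg_cong[of _ _ \<xi>] simp: vec4_eq_iff)
  have JJ: "J ** J = \<beta> *\<^sub>R mat 1"
    unfolding J_def using V_axis \<beta>
    by (subst \<xi>_mult[symmetric], simp, simp, subst \<xi>_one[symmetric], subst \<xi>_scale[symmetric])
      (auto intro!: arg_cong[of _ _ \<xi>] simp: vec4_eq_iff)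
  have sc: "M ** (c *\<^sub>R mat 1) = c *\<^sub>R M" "(c *\<^sub>R M) ** N = c *\<^sub>R (M ** N)" "trace (c *\<^sub>R M) = c * trace M"
    for c and M N :: "real^2^2"
    by (simp_all add: mat2_eq_iff mult2_nth trace2 algebra_simps)
  have tI: "trace I = 0"
  proof -
    have "\<beta> * trace I = trace (I ** (J ** J))" by (simp add: JJ sc)
    also have "\<dots> = trace ((I ** J) ** J)" by (simp add: matrix_mul_assoc)
    also have "\<dots> = trace (J ** (I ** J))" by (rule trace_mul_sym)
    also have "J ** (I ** J) = (J ** I) ** J" by (simp add: matrix_mul_assoc)
    also have "\<dots> = (-1) *\<^sub>R ((I ** J) ** J)" unfolding ji ij sc ..
    also have "(I ** J) ** J = I ** (J ** J)" by (simp add: matrix_mul_assoc)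
    finally have "\<beta> * trace I = - (\<beta> * trace I)" by (simp only: JJ sc)
    thus ?thesis using \<beta> by simp
  qed
  have tJ: "trace J = 0"
  proof -
    have "\<alpha> * trace J = trace (J ** (I ** I))" by (simp add: II sc)
    also have "\<dots> = trace ((J ** I) ** I)" by (simp add: matrix_mul_assoc)
    also have "(J ** I) ** I = (-1) *\<^sub>R ((I ** J) ** I)" unfolding ji ij sc ..
    also have "trace \<dots> = - trace ((I ** J) ** I)" by (simp only: sc)
    also have "trace ((I ** J) ** I) = trace (I ** (I ** J))" by (rule trace_mul_sym)
    also have "I ** (I ** J) = (I ** I) ** J" by (simp add: matrix_mul_assoc)
    also have "\<dots> = \<alpha> *\<^sub>R J" unfolding II sc by simp
    finally have "\<alpha> * trace J = - (\<alpha> * trace J)" by (simp only: sc)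
    thus ?thesis using \<alpha> by simp
  qed
  have tIJ: "trace (I ** J) = 0"
  proof -
    have "trace (I ** J) = trace (J ** I)" by (rule trace_mul_sym)
    also have "\<dots> = - trace (I ** J)" unfolding ji ij sc by simp
    finally show ?thesis by simp
  qed
  have dec: "x = ((x$1 *\<^sub>R axis 1 1 + x$2 *\<^sub>R axis 2 1) + x$3 *\<^sub>R axis 3 1) + x$4 *\<^sub>R axis 4 1"
    by (simp add: vec4_eq_iff)
  have xK: "x$i \<in> K" for i using x by simp
  have sV: "c *\<^sub>R axis i 1 \<in> V" if "c \<in> K" for c i using that by (simp add: K_zero)
  have aV: "y + z \<in> V" if "y \<in> V" "z \<in> V" for y z using that by (simp add: add_K)
  have "\<xi> x = ((x$1 *\<^sub>R mat 1 + x$2 *\<^sub>R I) + x$3 *\<^sub>R J) + x$4 *\<^sub>R (I ** J)"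
    by (subst dec) (simp only: \<xi>_add aV sV xK \<xi>_scale[OF xK V_axis] \<xi>_one ij flip: I_def J_def)
  moreover have "trace (mat 1 :: real^2^2) = 2" by (simp add: trace2)
  ultimately show ?thesis using tI tJ tIJ by (simp add: trace_add sc)
qed

lemma order_V: "\<OO> \<subseteq> V"
  and order_one: "e1 \<in> \<OO>"
  and order_mult: "x \<in> \<OO> \<Longrightarrow> y \<in> \<OO> \<Longrightarrow> qm x y \<in> \<OO>"
  and order_add: "x \<in> \<OO> \<Longrightarrow> y \<in> \<OO> \<Longrightarrow> x + y \<in> \<OO>"
  and order_zero: "0 \<in> \<OO>"
  using order subringE[of \<OO> "quaternion_algebra K \<alpha> \<beta>"] carrier_V
  unfolding quaternion_order_def by (auto simp: quaternion_algebra_def)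

lemma order_scale:
  assumes "a \<in> int_ring K" "x \<in> \<OO>" shows "a *\<^sub>R x \<in> \<OO>"
proof -
  obtain W where W: "\<OO> = combinations (int_ring K) W" using order by (auto simp: quaternion_order_def)
  obtain T c where T: "finite T" "T \<subseteq> W" "c ` T \<subseteq> int_ring K" "x = (\<Sum>\<omega>\<in>T. c \<omega> *\<^sub>R \<omega>)"
    using assms(2) unfolding W combinations_def by blast
  have "a *\<^sub>R x = (\<Sum>\<omega>\<in>T. (a * c \<omega>) *\<^sub>R \<omega>)" by (simp add: T(4) scaleR_sum_right)
  moreover have "(\<lambda>\<omega>. a * c \<omega>) ` T \<subseteq> int_ring K" using T(3) assms(1) int_ring_mult by auto
  ultimately show ?thesis unfolding W combinations_def using T(1,2)
    by (intro CollectI exI[of _ T] exI[of _ "\<lambda>\<omega>. a * c \<omega>"]) simp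
qed

lemma order_sum: "(\<And>i. i \<in> I \<Longrightarrow> f i \<in> \<OO>) \<Longrightarrow> sum f I \<in> \<OO>"
  by (induction I rule: infinite_finite_induct) (auto simp: order_zero order_add)

lemma order_diff: "x \<in> \<OO> \<Longrightarrow> y \<in> \<OO> \<Longrightarrow> x - y \<in> \<OO>"
  using order_add[of x "(-1) *\<^sub>R y"] order_scale[OF int_ring_of_int[of "-1"], of y] by simp

definition lat4 :: "nat \<Rightarrow> real^4 \<Rightarrow> bool" where
  "lat4 D x \<longleftrightarrow> (\<forall>i. lat D (x$i))"

text \<open>The order is finitely generated over the ring of integers, which already lies in a
  lattice, and the products of basis elements with coordinates of the generators have a common
  denominator.\<close>

lemma order_lat4: "\<exists>D>0. \<forall>x\<in>\<OO>. lat4 D x"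
proof -
  obtain W where W: "finite W" "\<OO> = combinations (int_ring K) W" using order by (auto simp: quaternion_order_def)
  have WV: "W \<subseteq> V"
  proof
    fix \<omega> assume "\<omega> \<in> W"
    hence "\<omega> \<in> combinations (int_ring K) W" unfolding combinations_def
      using int_ring_1 by (intro CollectI exI[of _ "{\<omega>}"] exI[of _ "\<lambda>_. 1"]) auto
    thus "\<omega> \<in> V" using W order_V by auto
  qed
  obtain D1 where D1: "D1 > 0" "\<forall>x\<in>int_ring K. lat D1 x" using int_ring_lat by blast
  define Y where "Y = {b * \<omega>$i | b \<omega> i. b \<in> B \<and> \<omega> \<in> W}"
  have "Y = (\<lambda>(b, \<omega>, i). b * \<omega>$i) ` (B \<times> W \<times> UNIV)" by (force simp: Y_def)
  hence "finite Y" using finite_B W(1) by simp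
  moreover have "Y \<subseteq> K" using WV B_K by (auto simp: Y_def intro!: mult_K)
  ultimately obtain D2 where D2: "D2 > 0" "\<forall>y\<in>Y. lat D2 y" using lat_finite by blast
  have prod: "lat (D1 * D2) (a * \<omega>$i)" if a: "a \<in> int_ring K" and \<omega>: "\<omega> \<in> W" for a \<omega> i
  proof -
    have aK: "a \<in> K" "lat D1 a" using a D1 by (auto simp: int_ring_def)
    obtain n where "of_nat D1 * a = (\<Sum>b\<in>B. of_int (n b) * b)" using aK(2) by (rule lat_expansion)
    hence "of_nat D1 * a * \<omega>$i = (\<Sum>b\<in>B. of_int (n b) * b) * \<omega>$i" by (simp only:)
    hence "of_nat D1 * (a * \<omega>$i) = (\<Sum>b\<in>B. of_int (n b) * (b * \<omega>$i))"
      by (simp only: sum_distrib_right mult.assoc)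
    moreover have "lat D2 (\<Sum>b\<in>B. of_int (n b) * (b * \<omega>$i))"
    proof (rule lat_sum, rule lat_of_int)
      fix b assume "b \<in> B"
      thus "lat D2 (b * \<omega>$i)" using D2 \<omega> by (auto simp: Y_def)
    qed
    ultimately have l: "lat D2 (of_nat D1 * (a * \<omega>$i))" by simp
    have K: "a * \<omega>$i \<in> K" using aK WV \<omega> by (auto intro!: mult_K)
    have "of_nat (D1 * D2) * coord (a * \<omega>$i) b = of_nat D2 * coord (of_nat D1 * (a * \<omega>$i)) b" for b
      unfolding coord_of_nat[OF K] by simp
    moreover have "\<forall>b\<in>B. of_nat D2 * coord (of_nat D1 * (a * \<omega>$i)) b \<in> \<int>"
      using l unfolding lat_def by blast
    ultimately show ?thesis using K unfolding lat_def by (simp only:)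
  qed
  have "lat4 (D1 * D2) x" if xO: "x \<in> \<OO>" for x
  proof -
    obtain T c where T: "finite T" "T \<subseteq> W" "c ` T \<subseteq> int_ring K" "x = (\<Sum>\<omega>\<in>T. c \<omega> *\<^sub>R \<omega>)"
      using xO unfolding W(2) combinations_def by blast
    have "lat (D1 * D2) (x$i)" for i
    proof -
      have "lat (D1 * D2) (\<Sum>\<omega>\<in>T. c \<omega> * \<omega>$i)"
      proof (rule lat_sum)
        fix \<omega> assume "\<omega> \<in> T"
        hence "c \<omega> \<in> int_ring K" "\<omega> \<in> W" using T by auto
        thus "lat (D1 * D2) (c \<omega> * \<omega>$i)" by (rule prod)
      qed
      thus ?thesis by (simp add: T(4))
    qed
    thus ?thesis unfolding lat4_def by blast
  qed
  thus ?thesis using D1(1) D2(1) by (intro exI[of _ "D1 * D2"]) auto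
qed

lemma order_multiple:
  assumes "y \<in> V" shows "\<exists>M>0. of_nat M *\<^sub>R y \<in> \<OO>"
proof -
  have "y \<in> combinations K \<OO>" using assms order carrier_V by (auto simp: quaternion_order_def)
  then obtain T c where T: "finite T" "T \<subseteq> \<OO>" "c ` T \<subseteq> K" "y = (\<Sum>\<omega>\<in>T. c \<omega> *\<^sub>R \<omega>)"
    unfolding combinations_def by blast
  have "\<exists>M>0. \<forall>\<omega>\<in>T. of_nat M * c \<omega> \<in> int_ring K"
  proof (rule common_multiple[OF T(1)])
    fix \<omega> assume w: "\<omega> \<in> T"
    hence cK: "c \<omega> \<in> K" using T(3) by auto
    thus "\<exists>M>0. of_nat M * c \<omega> \<in> int_ring K"
      using algebraic_int_multiple[OF cK] of_nat_K by (auto simp: int_ring_def)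
    fix D D' assume D: "of_nat D * c \<omega> \<in> int_ring K" "D dvd D'"
    then obtain k where "D' = D * k" by blast
    hence "of_nat D' * c \<omega> = of_nat k * (of_nat D * c \<omega>)" by simp
    thus "of_nat D' * c \<omega> \<in> int_ring K" using int_ring_mult[OF int_ring_of_nat D(1), of k] by (simp only:)
  qed
  then obtain M where M: "M > 0" "\<And>\<omega>. \<omega> \<in> T \<Longrightarrow> of_nat M * c \<omega> \<in> int_ring K" by blast
  have "of_nat M *\<^sub>R y = (\<Sum>\<omega>\<in>T. (of_nat M * c \<omega>) *\<^sub>R \<omega>)" by (simp add: T(4) scaleR_sum_right)
  also have "\<dots> \<in> \<OO>" using T(2) M(2) by (intro order_sum order_scale) auto
  finally show ?thesis using M(1) by blast
qed

text \<open>The inclusion opposite to \<open>order_lat4\<close>. It turns a congruence between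
  coordinates into a congruence modulo a multiple of the order, which is what the index count
  requires.\<close>

lemma lat4_order:
  assumes D: "D > 0"
  shows "\<exists>M>0. \<forall>x. lat4 D x \<longrightarrow> of_nat M *\<^sub>R x \<in> \<OO>"
proof -
  have "\<exists>M>0. \<forall>p\<in>UNIV \<times> B. of_nat M *\<^sub>R (snd p *\<^sub>R axis (fst p) 1 :: real^4) \<in> \<OO>"
  proof (rule common_multiple)
    show "finite (UNIV \<times> B :: (4 \<times> real) set)" using finite_B by simp
    fix p :: "4 \<times> real" assume "p \<in> UNIV \<times> B"
    hence "snd p *\<^sub>R axis (fst p) 1 \<in> V" using B_K K_zero by auto
    thus "\<exists>M>0. of_nat M *\<^sub>R (snd p *\<^sub>R axis (fst p) 1 :: real^4) \<in> \<OO>" by (rule order_multiple)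
    fix D D' assume D: "of_nat D *\<^sub>R (snd p *\<^sub>R axis (fst p) 1 :: real^4) \<in> \<OO>" "D dvd D'"
    then obtain k where "D' = D * k" by blast
    hence "of_nat D' *\<^sub>R (snd p *\<^sub>R axis (fst p) 1 :: real^4) =
      of_nat k *\<^sub>R (of_nat D *\<^sub>R (snd p *\<^sub>R axis (fst p) 1))" by simp
    thus "of_nat D' *\<^sub>R (snd p *\<^sub>R axis (fst p) 1 :: real^4) \<in> \<OO>"
      using order_scale[OF int_ring_of_nat D(1), of k] by (simp only:)
  qed
  then obtain M where M: "M > 0" "\<And>i b. b \<in> B \<Longrightarrow> of_nat M *\<^sub>R (b *\<^sub>R axis i 1 :: real^4) \<in> \<OO>"
    by force
  have "of_nat (M * D) *\<^sub>R x \<in> \<OO>" if x: "lat4 D x" for x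
  proof -
    have "\<forall>i. \<exists>n. of_nat D * x$i = (\<Sum>b\<in>B. of_int (n b) * b)"
      using x unfolding lat4_def by (metis lat_expansion)
    then obtain n where Dx: "\<And>i. of_nat D * x$i = (\<Sum>b\<in>B. of_int (n i b) * b)" by metis
    have "of_nat (M * D) *\<^sub>R x =
      (\<Sum>i\<in>UNIV. \<Sum>b\<in>B. of_int (n i b) *\<^sub>R (of_nat M *\<^sub>R (b *\<^sub>R axis i 1)))"
    proof (subst Finite_Cartesian_Product.vec_eq_iff, rule allI)
      fix j
      have "(\<Sum>b\<in>B. of_int (n i b) *\<^sub>R (of_nat M *\<^sub>R (b *\<^sub>R axis i 1))) $ j =
        (if i = j then of_nat M * (\<Sum>b\<in>B. of_int (n i b) * b) else 0)" for i
        by (cases "i = j") (simp_all add: sum_distrib_left mult_ac)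
      hence "(\<Sum>i\<in>UNIV. \<Sum>b\<in>B. of_int (n i b) *\<^sub>R (of_nat M *\<^sub>R (b *\<^sub>R axis i 1))) $ j =
        (\<Sum>i\<in>UNIV. if i = j then of_nat M * (\<Sum>b\<in>B. of_int (n i b) * b) else 0)"
        unfolding sum_component by (intro sum.cong refl) 
      also have "\<dots> = of_nat M * (of_nat D * x$j)" by (simp add: Dx)
      finally show "(of_nat (M * D) *\<^sub>R x) $ j =
        (\<Sum>i\<in>UNIV. \<Sum>b\<in>B. of_int (n i b) *\<^sub>R (of_nat M *\<^sub>R (b *\<^sub>R axis i 1))) $ j" by simp
    qed
    also have "\<dots> \<in> \<OO>" by (rule order_sum, rule order_sum, rule order_scale[OF int_ring_of_int M(2)])
    finally show ?thesis .
  qed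
  thus ?thesis using M(1) D by (intro exI[of _ "M * D"]) auto
qed

section \<open>Levels generated by rational integers\<close>

definition level :: "nat \<Rightarrow> real set" where
  "level m = (\<lambda>x. of_nat m * x) ` int_ring K"

lemma nonzero_ideal_level:
  assumes "0 < m"
  shows "nonzero_ideal K (level m)"
  unfolding nonzero_ideal_def
proof
  let ?R = "ring_of_type_algebra\<lparr>carrier := int_ring K\<rparr>"
  have R: "ring ?R"
  proof (rule ringI)
    show "abelian_group ?R"
    proof (rule abelian_groupI)
      fix x assume "x \<in> carrier ?R"
      thus "\<exists>y\<in>carrier ?R. y \<oplus>\<^bsub>?R\<^esub> x = \<zero>\<^bsub>?R\<^esub>"
        using int_ring_uminus by (intro bexI[of _ "- x"]) (auto simp: ring_of_type_algebra_def)
    qed (auto simp: ring_of_type_algebra_def int_ring_add int_ring_0)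
    show "monoid ?R"
      by (rule monoidI) (auto simp: ring_of_type_algebra_def int_ring_mult int_ring_1)
  qed (auto simp: ring_of_type_algebra_def algebra_simps)
  show "ideal (level m) ?R"
  proof (rule idealI[OF R])
    interpret ring ?R by (rule R)
    have inv: "inv\<^bsub>add_monoid ?R\<^esub> x = - x" if "x \<in> int_ring K" for x
      using that int_ring_uminus[OF that]
      by (intro group.inv_equality[OF a_group]) (auto simp: ring_of_type_algebra_def)
    show "subgroup (level m) (add_monoid ?R)"
    proof -
      have invl: "inv\<^bsub>add_monoid ?R\<^esub> x \<in> level m" if x: "x \<in> level m" for x
      proof -
        obtain y where y: "y \<in> int_ring K" "x = of_nat m * y" using x by (auto simp: level_def)
        have "- x = of_nat m * - y" using y by simp
        hence "- x \<in> level m" unfolding level_def using int_ring_uminus[OF y(1)] by (rule image_eqI)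
        moreover have "x \<in> int_ring K" using y by (auto simp: int_ring_mult int_ring_of_nat)
        ultimately show ?thesis by (simp only: inv)
      qed
      show ?thesis
        unfolding subgroup_def
        using invl by (auto simp: level_def ring_of_type_algebra_def int_ring_add int_ring_mult int_ring_of_nat
          int_ring_0 simp flip: distrib_left)
    qed
    have mults: "x \<otimes>\<^bsub>?R\<^esub> a = x * a" "carrier ?R = int_ring K" for x a
      by (simp_all add: ring_of_type_algebra_def)
    have absorb: "x * a \<in> level m" if xa: "x \<in> int_ring K" "a \<in> level m" for a x
    proof -
      obtain y where y: "y \<in> int_ring K" "a = of_nat m * y" using xa(2) unfolding level_def by blast
      have "x * a = of_nat m * (x * y)" using y by simp
      thus ?thesis unfolding level_def using int_ring_mult[OF xa(1) y(1)] by (rule image_eqI)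
    qed
    fix a x assume "a \<in> level m" "x \<in> carrier ?R"
    thus "x \<otimes>\<^bsub>?R\<^esub> a \<in> level m" "a \<otimes>\<^bsub>?R\<^esub> x \<in> level m"
      using absorb[of x a] unfolding mults by (simp_all add: mult.commute[of a x])
  qed
  have "of_nat m * 1 \<in> level m" unfolding level_def using int_ring_1 by (rule imageI)
  moreover have "of_nat m * 1 \<notin> {0 :: real}" using assms by simp
  ultimately show "level m \<noteq> {0}" by metis
qed

text \<open>For a principal level the product of ideal and order is just the multiple of the order
  by the generator, so being congruent to 1 means a single equation
  \<open>D - e1 = m w\<close>.\<close>

lemma combinations_level: "combinations (level m) \<OO> = (\<lambda>x. of_nat m *\<^sub>R x) ` \<OO>"
proof (intro equalityI subsetI)
  fix y assume "y \<in> combinations (level m) \<OO>"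
  then obtain T a where T: "finite T" "T \<subseteq> \<OO>" "a ` T \<subseteq> level m" "y = (\<Sum>\<omega>\<in>T. a \<omega> *\<^sub>R \<omega>)"
    unfolding combinations_def by blast
  have "\<forall>\<omega>\<in>T. \<exists>c. c \<in> int_ring K \<and> a \<omega> = of_nat m * c" using T(3) by (auto simp: level_def)
  then obtain c where c: "\<And>\<omega>. \<omega> \<in> T \<Longrightarrow> c \<omega> \<in> int_ring K \<and> a \<omega> = of_nat m * c \<omega>" by metis
  have "y = of_nat m *\<^sub>R (\<Sum>\<omega>\<in>T. c \<omega> *\<^sub>R \<omega>)"
    unfolding T(4) scaleR_sum_right using c by (intro sum.cong) auto
  moreover have "(\<Sum>\<omega>\<in>T. c \<omega> *\<^sub>R \<omega>) \<in> \<OO>" using c T(2) by (intro order_sum order_scale) auto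
  ultimately show "y \<in> (\<lambda>x. of_nat m *\<^sub>R x) ` \<OO>" by blast
next
  fix y assume "y \<in> (\<lambda>x. of_nat m *\<^sub>R x) ` \<OO>"
  then obtain x where x: "x \<in> \<OO>" "y = of_nat m *\<^sub>R x" by blast
  have "of_nat m \<in> level m"
    unfolding level_def using int_ring_1 by (intro image_eqI[of _ _ 1]) auto
  thus "y \<in> combinations (level m) \<OO>"
    unfolding combinations_def using x by (intro CollectI exI[of _ "{x}"] exI[of _ "\<lambda>_. of_nat m"]) auto
qed

abbreviation PC :: "nat \<Rightarrow> (real^4) set" where
  "PC m \<equiv> principal_congruence \<alpha> \<beta> \<OO> (level m)"

lemma PC_iff: "D \<in> PC m \<longleftrightarrow> D \<in> norm_one_group \<alpha> \<beta> \<OO> \<and> (\<exists>w\<in>\<OO>. D - e1 = of_nat m *\<^sub>R w)"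
  unfolding principal_congruence_def combinations_level by auto

lemma norm_one_V: "D \<in> norm_one_group \<alpha> \<beta> \<OO> \<Longrightarrow> D \<in> V"
  using order_V by (auto simp: norm_one_group_def)

lemma norm_one_order: "D \<in> norm_one_group \<alpha> \<beta> \<OO> \<Longrightarrow> D \<in> \<OO>"
  by (simp add: norm_one_group_def)

lemma norm_one_mult:
  "D \<in> norm_one_group \<alpha> \<beta> \<OO> \<Longrightarrow> E \<in> norm_one_group \<alpha> \<beta> \<OO> \<Longrightarrow> qm D E \<in> norm_one_group \<alpha> \<beta> \<OO>"
  by (simp add: norm_one_group_def order_mult reduced_norm_mult)

lemma norm_one_one: "e1 \<in> norm_one_group \<alpha> \<beta> \<OO>"
  by (simp add: norm_one_group_def order_one reduced_norm_def)

lemma PC_one: "e1 \<in> PC m"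
  unfolding PC_iff using norm_one_one order_zero by (auto intro!: bexI[of _ 0])

lemma PC_mult:
  assumes "D \<in> PC m" "E \<in> PC m" shows "qm D E \<in> PC m"
proof -
  obtain v w where v: "v \<in> \<OO>" "D - e1 = of_nat m *\<^sub>R v" and w: "w \<in> \<OO>" "E - e1 = of_nat m *\<^sub>R w"
    using assms by (auto simp: PC_iff)
  have n: "D \<in> norm_one_group \<alpha> \<beta> \<OO>" "E \<in> norm_one_group \<alpha> \<beta> \<OO>" using assms by (auto simp: PC_iff)
  have "qm D E - e1 = qm (D - e1) E + (E - e1)" by (simp add: quat_mult_diff)
  also have "\<dots> = of_nat m *\<^sub>R (qm v E + w)" by (simp add: v(2) w(2) quat_mult_scaleR scaleR_add_right)
  finally show ?thesis
    unfolding PC_iff using n v w norm_one_mult norm_one_order by (blast intro: order_add order_mult)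
qed

section \<open>Sizes of quaternions and of traces of words\<close>

definition size4 :: "real^4 \<Rightarrow> real" where
  "size4 x = size (x$1) + size (x$2) + size (x$3) + size (x$4)"

lemma size4_nonneg: "0 \<le> size4 x"
  by (simp add: size4_def size_nonneg)

lemma size_nth_le: "size (x$i) \<le> size4 x"
proof -
  have "\<forall>i. size (x$i) \<le> size4 x"
    unfolding forall_4 size4_def using size_nonneg by (auto intro: add_increasing add_increasing2)
  thus ?thesis by blast
qed

lemma size4_mult:
  obtains c where "1 \<le> c" "\<And>x y. x \<in> V \<Longrightarrow> y \<in> V \<Longrightarrow> size4 (qm x y) \<le> c * size4 x * size4 y"
proof
  \<comment> \<open>Dominates the sizes of the coefficients \<alpha>, \<beta> and \<alpha>\<beta> in
    the product formula. Each of the four coordinates is a sum of four terms, whence the constant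
    \<open>16 * d\<close>.\<close>
  define d where "d = 1 + size \<alpha> + size \<beta> + size \<alpha> * size \<beta>"
  have d: "1 \<le> d" "size \<alpha> \<le> d" "size \<beta> \<le> d" "size \<alpha> * size \<beta> \<le> d"
    using size_nonneg[of \<alpha>] size_nonneg[of \<beta>] mult_nonneg_nonneg[OF size_nonneg[of \<alpha>] size_nonneg[of \<beta>]]
    unfolding d_def by linarith+
  show "1 \<le> 16 * d" using d(1) by simp
  fix x y assume xy: "x \<in> V" "y \<in> V"
  define s where "s = size4 x * size4 y"
  have K: "x$i \<in> K" "y$i \<in> K" for i using xy by auto
  have p: "size (x$i * y$j) \<le> s" for i j
    using size_mult[OF K(1)[of i] K(2)[of j]] mult_mono[OF size_nth_le[of x i] size_nth_le[of y j]]
      size4_nonneg size_nonneg by (force simp: s_def)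
  have s0: "0 \<le> s" using size4_nonneg by (simp add: s_def)
  have t: "size (c * (x$i * y$j)) \<le> d * s" if "c \<in> K" "size c \<le> d" for c i j
  proof -
    have "size (c * (x$i * y$j)) \<le> size c * size (x$i * y$j)" using that K by (intro size_mult mult_K)
    also have "\<dots> \<le> d * s" using that p size_nonneg d by (intro mult_mono) auto
    finally show ?thesis .
  qed
  have t1: "size (x$i * y$j) \<le> d * s" for i j
    using p[of i j] mult_right_mono[OF d(1) s0] by simp
  have \<alpha>\<beta>: "\<alpha> * \<beta> \<in> K" "size (\<alpha> * \<beta>) \<le> d"
    using \<alpha> \<beta> mult_K size_mult[OF \<alpha>(1) \<beta>(1)] d(4) by auto
  have four: "size (((u1 + u2) + u3) + u4) \<le> 4 * (d * s)"
    if "u1 \<in> K" "u2 \<in> K" "u3 \<in> K" "u4 \<in> K"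
      "size u1 \<le> d * s" "size u2 \<le> d * s" "size u3 \<le> d * s" "size u4 \<le> d * s" for u1 u2 u3 u4
    using size_add[OF add_K[OF add_K[OF that(1,2)] that(3)] that(4)] size_add[OF add_K[OF that(1,2)] that(3)]
      size_add[OF that(1,2)] that(5-8) by linarith
  have neg: "size (- u) \<le> d * s" "- u \<in> K" if "u \<in> K" "size u \<le> d * s" for u
    using that size_uminus uminus_K by auto
  note Ks = mult_K[OF K] mult_K[OF \<alpha>(1) mult_K[OF K]] mult_K[OF \<beta>(1) mult_K[OF K]] mult_K[OF \<alpha>\<beta>(1) mult_K[OF K]]
  note ts = t1 t[OF \<alpha>(1) d(2)] t[OF \<beta>(1) d(3)] t[OF \<alpha>\<beta>]
  have "size (qm x y $ 1) \<le> 4 * (d * s)"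
    unfolding quat_mult_nth diff_conv_add_uminus by (intro four neg Ks ts)
  moreover have "size (qm x y $ 2) \<le> 4 * (d * s)"
    unfolding quat_mult_nth diff_conv_add_uminus by (intro four neg Ks ts)
  moreover have "size (qm x y $ 3) \<le> 4 * (d * s)"
    unfolding quat_mult_nth diff_conv_add_uminus by (intro four neg Ks ts)
  moreover have "size (qm x y $ 4) \<le> 4 * (d * s)"
    unfolding quat_mult_nth diff_conv_add_uminus by (intro four neg Ks ts)
  ultimately have "size4 (qm x y) \<le> 16 * (d * s)" unfolding size4_def by linarith
  thus "size4 (qm x y) \<le> 16 * d * size4 x * size4 y" by (simp add: s_def mult_ac)
qed

text \<open>Each letter multiplies the size of the quaternion by at most a fixed factor, and the
  trace is twice the first coordinate.\<close>

lemma trace_word_bound: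
  assumes fin: "finite Y" and Y: "Y \<subseteq> \<xi> ` V"
  obtains E where "1 \<le> E" "\<And>ws. set ws \<subseteq> Y \<Longrightarrow> trace (mprod ws) \<in> K"
    "\<And>ws. set ws \<subseteq> Y \<Longrightarrow> size (trace (mprod ws)) \<le> E ^ Suc (length ws)"
proof -
  obtain c where c: "1 \<le> c" "\<And>x y. x \<in> V \<Longrightarrow> y \<in> V \<Longrightarrow> size4 (qm x y) \<le> c * size4 x * size4 y"
    using size4_mult by blast
  have "\<forall>A\<in>Y. \<exists>D. D \<in> V \<and> A = \<xi> D" using Y by blast
  then obtain f where f: "\<And>A. A \<in> Y \<Longrightarrow> f A \<in> V \<and> A = \<xi> (f A)" by metis
  \<comment> \<open>The term \<open>2 * size4 e1\<close> accounts for the empty word and explains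
    the additional factor \<open>E\<close>; the sum bounds the growth caused by any single
    letter.\<close>
  define E where "E = 1 + 2 * size4 e1 + c * (\<Sum>A\<in>Y. size4 (f A))"
  have s0: "0 \<le> (\<Sum>A\<in>Y. size4 (f A))" by (simp add: sum_nonneg size4_nonneg)
  hence cs0: "0 \<le> c * (\<Sum>A\<in>Y. size4 (f A))" using c(1) by simp
  have E1: "1 \<le> E" using size4_nonneg[of e1] cs0 by (simp add: E_def)
  have Ee: "2 * size4 e1 \<le> E" using cs0 by (simp add: E_def)
  have EA: "c * size4 (f A) \<le> E" if "A \<in> Y" for A
  proof -
    have "size4 (f A) \<le> (\<Sum>A\<in>Y. size4 (f A))"
      using that fin size4_nonneg by (intro member_le_sum) auto
    hence "c * size4 (f A) \<le> c * (\<Sum>A\<in>Y. size4 (f A))" using c(1) by (intro mult_left_mono) auto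
    thus ?thesis using size4_nonneg[of e1] unfolding E_def by linarith
  qed
  have word: "\<exists>D\<in>V. mprod ws = \<xi> D \<and> 2 * size4 D \<le> E ^ Suc (length ws)" if "set ws \<subseteq> Y" for ws
    using that
  proof (induction ws)
    case Nil
    show ?case using V_axis[of 1] \<xi>_one Ee by (intro bexI[of _ e1]) simp_all
  next
    case (Cons A ws)
    then obtain D where D: "D \<in> V" "mprod ws = \<xi> D" "2 * size4 D \<le> E ^ Suc (length ws)" by auto
    have A: "A \<in> Y" "f A \<in> V" "A = \<xi> (f A)" using Cons.prems f by auto
    have "2 * size4 (qm (f A) D) \<le> (c * size4 (f A)) * (2 * size4 D)"
      using c(2)[OF A(2) D(1)] by (simp add: mult_ac)
    also have "\<dots> \<le> E * E ^ Suc (length ws)"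
      using EA[OF A(1)] D(3) size4_nonneg E1 by (intro mult_mono) auto
    finally show ?case
      using V_mult[OF A(2) D(1)] \<xi>_mult[OF A(2) D(1)] A(3) D(2)
      by (intro bexI[of _ "qm (f A) D"]) simp_all
  qed
  show ?thesis
  proof (rule that[OF E1])
    fix ws assume "set ws \<subseteq> Y"
    then obtain D where D: "D \<in> V" "mprod ws = \<xi> D" "2 * size4 D \<le> E ^ Suc (length ws)" using word by blast
    have tr: "trace (mprod ws) = of_nat 2 * D$1" using trace_\<xi>[OF D(1)] D(2) by simp
    have D1: "D$1 \<in> K" using D(1) by simp
    show "trace (mprod ws) \<in> K" unfolding tr by (rule of_nat_K[OF D1])
    have "size (trace (mprod ws)) = 2 * size (D$1)" unfolding tr using size_of_nat[OF D1, of 2] by simp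
    also have "\<dots> \<le> 2 * size4 D" using size_nth_le[of D 1] by simp
    finally show "size (trace (mprod ws)) \<le> E ^ Suc (length ws)" using D(3) by simp
  qed
qed

lemma trace_PC:
  obtains \<delta> where "0 < \<delta>"
    "\<And>m D. D \<in> PC m \<Longrightarrow> trace (\<xi> D) \<noteq> 2 \<Longrightarrow> of_nat m * \<delta> \<le> size (trace (\<xi> D) - 2)"
proof -
  obtain M where M: "M > 0" "\<forall>x\<in>\<OO>. lat4 M x" using order_lat4 by blast
  show ?thesis
  \<comment> \<open>A nonzero element with denominator \<open>M\<close> has size at least
    \<open>1 / M\<close>.\<close>
  proof (rule that[of "1 / of_nat M"])
    show "0 < 1 / real M" using M(1) by simp
    fix m D assume D: "D \<in> PC m" and ne: "trace (\<xi> D) \<noteq> 2"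
    obtain w where w: "w \<in> \<OO>" "D - e1 = of_nat m *\<^sub>R w" using D by (auto simp: PC_iff)
    have DV: "D \<in> V" using D norm_one_V by (auto simp: PC_iff)
    have "D$1 - 1 = of_nat m * w$1" using arg_cong[OF w(2), of "\<lambda>v. v$1"] by simp
    hence tr: "trace (\<xi> D) - 2 = of_nat m * (of_nat 2 * w$1)" using trace_\<xi>[OF DV] by simp
    have l: "lat M (of_nat 2 * w$1)" using M(2) w(1) unfolding lat4_def by (intro lat_of_nat) blast
    have "of_nat 2 * w$1 \<noteq> 0" using tr ne by auto
    hence "1 / of_nat M \<le> size (of_nat 2 * w$1)" using lat_size_ge[OF l _ M(1)] by blast
    thus "real m * (1 / real M) \<le> size (trace (\<xi> D) - 2)"
      unfolding tr size_of_nat[OF lat_K[OF l], of m] by (intro mult_left_mono) auto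
  qed
qed

end

section \<open>Congruence subgroups\<close>

lemma representatives:
  assumes "finite Y" "f ` U \<subseteq> Y"
  obtains R where "R \<subseteq> U" "finite R" "card R \<le> card Y" "\<And>x. x \<in> U \<Longrightarrow> \<exists>y\<in>R. f y = f x"
proof -
  define g where "g = inv_into U f"
  define R where "R = g ` f ` U"
  have fin: "finite (f ` U)" using assms finite_subset by blast
  show ?thesis
  proof (rule that[of R])
    show "R \<subseteq> U" unfolding R_def g_def by (auto intro: inv_into_into)
    show "finite R" using fin by (simp add: R_def)
    show "card R \<le> card Y"
      unfolding R_def using card_image_le[OF fin, of g] card_mono[OF assms] by linarith
    show "\<exists>y\<in>R. f y = f x" if "x \<in> U" for x
      unfolding R_def g_def using that by (intro bexI[of _ "inv_into U f (f x)"]) (auto simp: f_inv_into_f)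
  qed
qed

text \<open>\<open>G\<close> and \<Delta> stand for the lifts of the given group and of the subgroup
  generated by its squares. Both alternatives allowed for the quaternion data place \<Delta> in the
  image of the norm one group.\<close>

locale congruence_groups = quat_data K B \<alpha> \<beta> \<OO> \<xi>
  for K B :: "real set" and \<alpha> \<beta> :: real and \<OO> :: "(real^4) set" and \<xi> :: "real^4 \<Rightarrow> real^2^2" +
  fixes G \<Delta> :: "(real^2^2) set"
  assumes G: "matgroup G" and \<Delta>: "matgroup \<Delta>" and \<Delta>_G: "\<Delta> \<subseteq> G"
    and square_\<Delta>: "A \<in> G \<Longrightarrow> A ** A \<in> \<Delta>"
    and \<Delta>_\<xi>: "\<Delta> \<subseteq> \<xi> ` norm_one_group \<alpha> \<beta> \<OO>"
begin

definition H0 :: "nat \<Rightarrow> (real^2^2) set" where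
  "H0 m = G \<inter> \<xi> ` PC m"

text \<open>The full preimage of \<open>\<Gamma>(m)\<close>: the negative of an element of \<^term>\<open>H0 m\<close> need not be congruent to 1.\<close>

definition H :: "nat \<Rightarrow> (real^2^2) set" where
  "H m = {A. A \<in> H0 m \<or> - A \<in> H0 m}"

lemma proj_H: "proj ` H m = proj ` H0 m"
proof -
  have neg: "proj (- A) = proj A" for A by (simp add: proj_eq_iff)
  show ?thesis
  proof (intro equalityI subsetI)
    fix p assume "p \<in> proj ` H m"
    then obtain A where A: "p = proj A" "A \<in> H0 m \<or> - A \<in> H0 m" by (auto simp: H_def)
    thus "p \<in> proj ` H0 m" using neg[of A] by (metis imageI)
  qed (auto simp: H_def)
qed

lemma PC_V: "D \<in> PC m \<Longrightarrow> D \<in> V"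
  using norm_one_V PC_iff by blast

lemma H0_mult:
  assumes "A \<in> H0 m" "A' \<in> H0 m" shows "A ** A' \<in> H0 m"
proof -
  obtain D D' where D: "D \<in> PC m" "A = \<xi> D" "A \<in> G" "D' \<in> PC m" "A' = \<xi> D'" "A' \<in> G"
    using assms unfolding H0_def by blast
  have "A ** A' = \<xi> (qm D D')" using \<xi>_mult[OF PC_V[OF D(1)] PC_V[OF D(4)]] D by simp
  thus ?thesis unfolding H0_def using PC_mult[OF D(1,4)] matgroupD(3)[OF G D(3,6)] by blast
qed

lemma e1_V: "e1 \<in> V" by (rule V_axis)

text \<open>An element of \<open>G\<close> need not have its inverse in the image of the order, but its square does.\<close>

lemma H0_adj2:
  assumes "A \<in> H0 m" shows "adj2 A \<in> H0 m"
proof -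
  obtain D where D: "D \<in> PC m" "A = \<xi> D" "A \<in> G" using assms by (auto simp: H0_def)
  have dA: "det A = 1" using matgroupD(1)[OF G D(3)] .
  have "adj2 (A ** A) \<in> \<Delta>" using square_\<Delta>[OF D(3)] matgroupD(4)[OF \<Delta>] by blast
  then obtain E where E: "E \<in> norm_one_group \<alpha> \<beta> \<OO>" "adj2 (A ** A) = \<xi> E" using \<Delta>_\<xi> by blast
  have V: "D \<in> V" "E \<in> V" using PC_V[OF D(1)] norm_one_V[OF E(1)] by blast+
  \<comment> \<open>\<open>E\<close> represents the inverse of the square of \<open>A\<close>, so
    this product represents the inverse of \<open>A\<close> by an element of the order.\<close>
  define F where "F = qm E D"
  have FV: "F \<in> V" unfolding F_def using V by (intro V_mult)
  have "\<xi> F = adj2 A ** (adj2 A ** A)"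
    unfolding F_def \<xi>_mult[OF V(2,1)] D(2)[symmetric] E(2)[symmetric] adj2_matrix_mult
    by (simp add: matrix_mul_assoc)
  hence F: "\<xi> F = adj2 A" using adj2_mult(1)[OF dA] by simp
  have "\<xi> (qm F D) = \<xi> e1" using \<xi>_mult[OF FV V(1)] F adj2_mult(1)[OF dA] D(2) \<xi>_one by simp
  hence FD: "qm F D = e1" using \<xi>_inj[OF V_mult[OF FV V(1)] e1_V] by blast
  have Fn: "F \<in> norm_one_group \<alpha> \<beta> \<OO>"
    unfolding F_def using E(1) D(1) by (intro norm_one_mult) (auto simp: PC_iff)
  obtain w where w: "w \<in> \<OO>" "D - e1 = of_nat m *\<^sub>R w" using D(1) by (auto simp: PC_iff)
  \<comment> \<open>Since \<open>F D = 1\<close>, the congruence of \<open>D\<close> to 1 passes to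
    its inverse.\<close>
  have "F - e1 = - qm F (D - e1)" by (simp add: quat_mult_diff FD)
  also have "\<dots> = of_nat m *\<^sub>R (0 - qm F w)" by (simp add: w(2) quat_mult_scaleR)
  finally have "F \<in> PC m"
    unfolding PC_iff using Fn w(1) by (blast intro: order_diff order_zero order_mult norm_one_order)
  thus ?thesis unfolding H0_def using F matgroupD(4)[OF G D(3)] by (metis IntI imageI)
qed

lemma matgroup_H: "matgroup (H m)"
  unfolding matgroup_def
proof (intro conjI ballI)
  fix A assume A: "A \<in> H m"
  hence "A \<in> G \<or> - A \<in> G" by (auto simp: H_def H0_def)
  thus "det A = 1" using matgroupD(1)[OF G, of A] matgroupD(1)[OF G, of "- A"] by auto
  show "- A \<in> H m" using A by (auto simp: H_def)
  show "adj2 A \<in> H m" using A H0_adj2[of A m] H0_adj2[of "- A" m] by (auto simp: H_def)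
  fix A' assume "A' \<in> H m"
  thus "A ** A' \<in> H m"
    using A H0_mult[of A m A'] H0_mult[of "- A" m A'] H0_mult[of A m "- A'"] H0_mult[of "- A" m "- A'"]
    by (auto simp: H_def)
next
  have "mat 1 \<in> H0 m"
    unfolding H0_def using matgroupD(2)[OF G] PC_one \<xi>_one by (metis IntI imageI)
  thus "mat 1 \<in> H m" by (simp add: H_def)
qed

lemma H_G: "H m \<subseteq> G"
proof
  fix A assume "A \<in> H m"
  hence "A \<in> G \<or> - A \<in> G" by (auto simp: H_def H0_def)
  thus "A \<in> G" using matgroupD(5)[OF G, of "- A"] by auto
qed

text \<open>Elements whose quaternions have the same integral coordinates modulo \<open>m M\<close>
  lie in the same coset: if \<open>D - D'\<close> is in \<open>m\<close> times the order, so is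
  \<open>D E - 1\<close> for the inverse \<open>E\<close> of \<open>D'\<close>. Only \<Delta> is
  treated, where every element and its inverse come from the order.\<close>

lemma index_bound:
  obtains M where "0 < M" "\<And>m. 0 < m \<Longrightarrow> \<exists>R. R \<subseteq> \<Delta> \<and> finite R \<and> card R \<le> (m * M) ^ (4 * card B) \<and>
      (\<forall>A\<in>\<Delta>. \<exists>A'\<in>R. A ** adj2 A' \<in> H m)"
proof -
  obtain D0 where D0: "D0 > 0" "\<forall>x\<in>\<OO>. lat4 D0 x" using order_lat4 by blast
  obtain M where M: "M > 0" "\<And>x. lat4 D0 x \<Longrightarrow> of_nat M *\<^sub>R x \<in> \<OO>" using lat4_order[OF D0(1)] by blast
  have "\<forall>A\<in>\<Delta>. \<exists>D. D \<in> norm_one_group \<alpha> \<beta> \<OO> \<and> A = \<xi> D" using \<Delta>_\<xi> by blast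
  then obtain g where g: "\<And>A. A \<in> \<Delta> \<Longrightarrow> g A \<in> norm_one_group \<alpha> \<beta> \<OO> \<and> A = \<xi> (g A)" by metis
  show ?thesis
  proof (rule that[OF M(1)])
    fix m :: nat assume m: "0 < m"
    \<comment> \<open>There are \<open>4 * card B\<close> integral coordinates with this many
      residues each. The factor \<open>M\<close> pays for the return from the coordinate lattice to
      the order.\<close>
    define Z where "Z = int (m * M)"
    have Z0: "0 < Z" using m M by (simp add: Z_def)
    define f where "f A = restrict (\<lambda>(i, b). \<lfloor>of_nat D0 * coord (g A $ i) b\<rfloor> mod Z) (UNIV \<times> B)" for A
    define Y where "Y = (UNIV \<times> B :: (4 \<times> real) set) \<rightarrow>\<^sub>E {0..<Z}"
    have finY: "finite Y" unfolding Y_def using finite_B by (intro finite_PiE) auto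
    have "card Y = (\<Prod>p\<in>(UNIV \<times> B :: (4 \<times> real) set). nat Z)"
      unfolding Y_def using finite_B by (subst card_PiE) auto
    also have "\<dots> = (m * M) ^ (4 * card B)" by (simp add: Z_def card_cartesian_product nat_int flip: of_nat_mult)
    finally have cardY: "card Y = (m * M) ^ (4 * card B)" .
    have "(\<lambda>(i, b). \<lfloor>of_nat D0 * coord (g A $ i) b\<rfloor> mod Z) p \<in> {0..<Z}" for A p
      using Z0 by (cases p) simp
    hence "f A \<in> Y" for A unfolding f_def Y_def by (intro restrict_PiE_iff[THEN iffD2] ballI)
    hence "f ` \<Delta> \<subseteq> Y" by blast
    then obtain R where R: "R \<subseteq> \<Delta>" "finite R" "card R \<le> card Y" "\<And>A. A \<in> \<Delta> \<Longrightarrow> \<exists>A'\<in>R. f A' = f A"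
      by (rule representatives[OF finY]) blast
    have "\<exists>A'\<in>R. A ** adj2 A' \<in> H m" if A: "A \<in> \<Delta>" for A
    proof -
      obtain A' where A': "A' \<in> R" "f A' = f A" using R(4)[OF A] by blast
      have A'\<Delta>: "A' \<in> \<Delta>" using A' R by blast
      define D D' where "D = g A" and "D' = g A'"
      have D: "D \<in> norm_one_group \<alpha> \<beta> \<OO>" "\<xi> D = A" "D' \<in> norm_one_group \<alpha> \<beta> \<OO>" "\<xi> D' = A'"
        using g[OF A] g[OF A'\<Delta>] by (auto simp: D_def D'_def)
      have V: "D \<in> V" "D' \<in> V" using D norm_one_V by blast+
      have l: "lat4 D0 D" "lat4 D0 D'" using D D0 norm_one_order by blast+
      \<comment> \<open>Equal residues put \<open>y\<close> in the coordinate lattice. Then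
        \<open>M y\<close> is in the order, and \<open>D - D'\<close> is \<open>m\<close> times
        it.\<close>
      define y where "y = (1 / real (m * M)) *\<^sub>R (D - D')"
      have "lat4 D0 y"
        unfolding lat4_def
      proof
        fix i
        have K: "D$i \<in> K" "D'$i \<in> K" using V by auto
        have yi: "y$i = of_rat (1 / of_nat (m * M)) * (D$i - D'$i)" by (simp add: y_def of_rat_divide of_rat_mult)
        have "of_nat D0 * coord (y$i) b \<in> \<int>" if b: "b \<in> B" for b
        proof -
          obtain n n' where n: "of_nat D0 * coord (D$i) b = of_int n" "of_nat D0 * coord (D'$i) b = of_int n'"
            using l b unfolding lat4_def lat_def Ints_def by blast
          have "n' mod Z = n mod Z"
            using fun_cong[OF A'(2), of "(i, b)"] b n by (simp add: f_def D_def D'_def)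
          then obtain k where k: "n - n' = Z * k" by (metis mod_eq_dvd_iff dvdE)
          have "of_nat D0 * coord (y$i) b = (of_nat D0 * coord (D$i) b - of_nat D0 * coord (D'$i) b) / of_nat (m * M)"
            unfolding yi coord_of_rat[OF minus_K[OF K]] coord_diff[OF K] by (simp add: diff_divide_distrib right_diff_distrib)
          also have "\<dots> = of_int (n - n') / of_nat (m * M)" by (simp only: n of_int_diff)
          also have "\<dots> = of_int k" using Z0 m M unfolding k Z_def by simp
          finally show ?thesis by simp
        qed
        moreover have "y$i \<in> K" unfolding yi by (rule of_rat_K[OF minus_K[OF K]])
        ultimately show "lat D0 (y$i)" by (simp add: lat_def)
      qed
      hence My: "of_nat M *\<^sub>R y \<in> \<OO>" by (rule M(2))
      have DD: "D - D' = of_nat m *\<^sub>R (of_nat M *\<^sub>R y)" using m M(1) by (simp add: y_def)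
      have adjA': "adj2 A' \<in> \<Delta>" using matgroupD(4)[OF \<Delta> A'\<Delta>] .
      obtain E where E': "adj2 A' = \<xi> E" and E1: "E \<in> norm_one_group \<alpha> \<beta> \<OO>"
        using subsetD[OF \<Delta>_\<xi> adjA'] by (rule imageE)
      note E = E1 E'[symmetric]
      have EV: "E \<in> V" using norm_one_V[OF E(1)] .
      have "\<xi> (qm D' E) = \<xi> e1"
        using \<xi>_mult[OF V(2) EV] D(4) E(2) \<xi>_one adj2_mult(2)[OF matgroupD(1)[OF \<Delta> A'\<Delta>]] by simp
      hence "qm D' E = e1" using \<xi>_inj[OF V_mult[OF V(2) EV] e1_V] by blast
      hence "qm D E - e1 = qm (D - D') E" by (simp add: quat_mult_diff)
      also have "\<dots> = of_nat m *\<^sub>R qm (of_nat M *\<^sub>R y) E" unfolding DD quat_mult_scaleR ..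
      finally have "qm D E \<in> PC m"
        unfolding PC_iff using norm_one_mult[OF D(1) E(1)] order_mult[OF My norm_one_order[OF E(1)]] by blast
      moreover have "\<xi> (qm D E) = A ** adj2 A'" using \<xi>_mult[OF V(1) EV] D(2) E(2) by simp
      moreover have "A ** adj2 A' \<in> G" using A adjA' \<Delta>_G matgroupD(3)[OF \<Delta>] by blast
      ultimately have "A ** adj2 A' \<in> H0 m" unfolding H0_def by (metis IntI imageI)
      thus ?thesis using A' by (auto simp: H_def)
    qed
    thus "\<exists>R. R \<subseteq> \<Delta> \<and> finite R \<and> card R \<le> (m * M) ^ (4 * card B) \<and> (\<forall>A\<in>\<Delta>. \<exists>A'\<in>R. A ** adj2 A' \<in> H m)"
      using R(1-3) unfolding cardY by blast
  qed
qed

text \<open>Squaring removes the sign: whichever of \<open>A\<close> and \<open>- A\<close> is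
  congruent to 1, the square is congruent to 1 as well.\<close>

lemma trace_H:
  obtains \<delta> where "0 < \<delta>"
    "\<And>m A. A \<in> H m \<Longrightarrow> trace (A ** A) \<noteq> 2 \<Longrightarrow> of_nat m * \<delta> \<le> size (trace (A ** A) - 2)"
proof -
  obtain \<delta> where \<delta>: "0 < \<delta>"
    "\<And>m D. D \<in> PC m \<Longrightarrow> trace (\<xi> D) \<noteq> 2 \<Longrightarrow> of_nat m * \<delta> \<le> size (trace (\<xi> D) - 2)"
    using trace_PC by blast
  show ?thesis
  proof (rule that[OF \<delta>(1)])
    fix m A assume A: "A \<in> H m" "trace (A ** A) \<noteq> 2"
    have "A ** A \<in> H0 m" using A(1) H0_mult[of A m A] H0_mult[of "- A" m "- A"] by (auto simp: H_def)
    then obtain D where "D \<in> PC m" "A ** A = \<xi> D" by (auto simp: H0_def)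
    thus "of_nat m * \<delta> \<le> size (trace (A ** A) - 2)" using \<delta>(2)[of D m] A(2) by simp
  qed
qed

end

section \<open>Squares and words\<close>

locale square_closed_subgroup = cocompact_group +
  fixes \<Delta> :: "(real^2^2) set"
  assumes \<Delta>: "matgroup \<Delta>" and \<Delta>_G: "\<Delta> \<subseteq> G" and square: "A \<in> G \<Longrightarrow> A ** A \<in> \<Delta>"
begin

definition equiv :: "real^2^2 \<Rightarrow> real^2^2 \<Rightarrow> bool" where
  "equiv A B \<longleftrightarrow> (\<exists>C\<in>\<Delta>. A = C ** B)"

lemma \<Delta>_closed:
  "A \<in> \<Delta> \<Longrightarrow> det A = 1" "mat 1 \<in> \<Delta>" "A \<in> \<Delta> \<Longrightarrow> A' \<in> \<Delta> \<Longrightarrow> A ** A' \<in> \<Delta>" "A \<in> \<Delta> \<Longrightarrow> adj2 A \<in> \<Delta>"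
  using matgroupD[OF \<Delta>] by auto

lemma equiv_trans: "equiv A B \<Longrightarrow> equiv B C \<Longrightarrow> equiv A C"
  unfolding equiv_def using \<Delta>_closed(3) by (metis matrix_mul_assoc)

lemma equiv_right: "equiv A B \<Longrightarrow> equiv (A ** C) (B ** C)"
  unfolding equiv_def by (metis matrix_mul_assoc)

lemma adj2_cancel:
  fixes A Z :: "real^2^2"
  assumes "det A = 1"
  shows "adj2 A ** (A ** Z) = Z" "A ** (adj2 A ** Z) = Z"
  using adj2_mult[OF assms] by (simp_all add: matrix_mul_assoc)

text \<open>The commutator of \<open>x\<close> and \<open>y\<close> is \<open>x\<^sup>2 (x\<^sup>-\<^sup>1 y)\<^sup>2 (y\<^sup>-\<^sup>1)\<^sup>2\<close>.\<close>

lemma equiv_commute: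
  assumes "A \<in> G" "B \<in> G"
  shows "equiv (A ** B) (B ** A)"
proof -
  note d = G_closed(1)[OF assms(1)] G_closed(1)[OF assms(2)]
  define C where "C = (A ** A) ** ((adj2 A ** B) ** (adj2 A ** B)) ** (adj2 B ** adj2 B)"
  have "C \<in> \<Delta>" unfolding C_def
    by (rule \<Delta>_closed(3)[OF \<Delta>_closed(3)[OF square square] square]) (use assms in auto)
  moreover have "C ** (B ** A) = A ** B"
    unfolding C_def using adj2_cancel[OF d(1)] adj2_cancel[OF d(2)] adj2_mult[OF d(1)] adj2_mult[OF d(2)]
    by (simp flip: matrix_mul_assoc)
  ultimately show ?thesis unfolding equiv_def by metis
qed

lemma equiv_left:
  assumes "equiv A B" "A \<in> G" "B \<in> G" "C \<in> G"
  shows "equiv (C ** A) (C ** B)"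
  using equiv_trans[OF equiv_commute[OF assms(4,2)]
    equiv_trans[OF equiv_right[OF assms(1), of C] equiv_commute[OF assms(3,4)]]] .

lemma mprod_S_G: "set ws \<subseteq> S \<Longrightarrow> mprod ws \<in> G"
  using mprod_in[OF group] S_subset by blast

text \<open>Modulo \<open>\<Delta>\<close> letters commute and have order 2, so a repeated letter can be dropped.\<close>

lemma short_word:
  assumes "set ws \<subseteq> S"
  shows "\<exists>us. set us \<subseteq> S \<and> length us \<le> card S \<and> equiv (mprod ws) (mprod us)"
  using assms
proof (induction "length ws" arbitrary: ws rule: less_induct)
  case less
  show ?case
  proof (cases "length ws \<le> card S")
    case True
    have "equiv (mprod ws) (mprod ws)" unfolding equiv_def using \<Delta>_closed(2) by (metis matrix_mul_lid)
    thus ?thesis using True less.prems by blast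
  next
    case False
    have "\<not> distinct ws"
      using False less.prems finite_S card_mono[OF finite_S less.prems] distinct_card[of ws] by auto
    then obtain xs s ys zs where ws: "ws = xs @ [s] @ ys @ [s] @ zs" using not_distinct_decomp by blast
    define x y z where "x = mprod xs" and "y = mprod ys" and "z = mprod zs"
    have sub: "set xs \<subseteq> S" "set ys \<subseteq> S" "set zs \<subseteq> S" "s \<in> S" using less.prems ws by auto
    have xG: "x \<in> G" "y \<in> G" "z \<in> G" "s \<in> G"
      using sub mprod_S_G S_subset unfolding x_def y_def z_def by blast+
    have w: "mprod ws = x ** (s ** (y ** (s ** z)))"
      by (simp add: ws mprod_append x_def y_def z_def matrix_mul_assoc)
    have e1: "equiv (s ** (y ** (s ** z))) (y ** z)"
    proof -
      have "equiv (s ** (y ** (s ** z))) (y ** (s ** z) ** s)"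
        using xG by (intro equiv_commute) auto
      moreover have "equiv (y ** (s ** z) ** s) (y ** (s ** z ** s))"
        unfolding equiv_def using \<Delta>_closed(2) by (metis matrix_mul_assoc matrix_mul_lid)
      moreover have "equiv (y ** (s ** z ** s)) (y ** z)"
      proof (rule equiv_left)
        have "equiv (s ** z ** s) (s ** (s ** z))" using xG by (intro equiv_commute) auto
        moreover have "equiv (s ** (s ** z)) z"
          unfolding equiv_def using square[OF xG(4)] by (metis matrix_mul_assoc)
        ultimately show "equiv (s ** z ** s) z" by (rule equiv_trans)
      qed (use xG in auto)
      ultimately show ?thesis using equiv_trans by blast
    qed
    have "equiv (mprod ws) (x ** (y ** z))"
      unfolding w using e1 xG by (intro equiv_left) auto
    moreover have "x ** (y ** z) = mprod (xs @ ys @ zs)" by (simp add: mprod_append x_def y_def z_def)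
    moreover have "\<exists>us. set us \<subseteq> S \<and> length us \<le> card S \<and> equiv (mprod (xs @ ys @ zs)) (mprod us)"
      by (rule less.hyps) (use sub in \<open>auto simp: ws\<close>)
    ultimately show ?thesis using equiv_trans by metis
  qed
qed

text \<open>Representatives of the right cosets of \<Delta>: the quotient of \<open>G\<close> is
  generated by the finitely many letters, which commute there and have order at most 2, so short
  words suffice.\<close>

definition T :: "(real^2^2) set" where
  "T = insert (mat 1) (mprod ` {us. set us \<subseteq> S \<and> length us \<le> card S})"

lemma finite_T: "finite T"
  unfolding T_def using finite_lists_length_le[OF finite_S] by simp

lemma T_G: "T \<subseteq> G"
  unfolding T_def using mprod_S_G by auto

lemma T_cover: "A \<in> G \<Longrightarrow> \<exists>B\<in>T. equiv A B"
  using S_generates short_word unfolding T_def by blast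

text \<open>The Schreier rewriting process. A coset representative is pushed through the word from
  left to right and leaves one element of \<Delta> per letter. The representative that remains at
  the end lies in \<Delta> itself and becomes the one additional letter.\<close>

lemma schreier:
  obtains Y where "finite Y" "Y \<subseteq> \<Delta>"
    "\<And>ws. set ws \<subseteq> S \<Longrightarrow> mprod ws \<in> \<Delta> \<Longrightarrow>
      \<exists>us. set us \<subseteq> Y \<and> length us = Suc (length ws) \<and> mprod us = mprod ws"
proof -
  have "\<forall>p\<in>T \<times> S. \<exists>q. fst q \<in> T \<and> snd q \<in> \<Delta> \<and> fst p ** snd p = snd q ** fst q"
  proof
    fix p assume "p \<in> T \<times> S"
    hence "fst p \<in> G" "snd p \<in> G" using T_G S_subset by auto
    hence "fst p ** snd p \<in> G" by simp
    then obtain B C where "B \<in> T" "C \<in> \<Delta>" "fst p ** snd p = C ** B" using T_cover unfolding equiv_def by blast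
    thus "\<exists>q. fst q \<in> T \<and> snd q \<in> \<Delta> \<and> fst p ** snd p = snd q ** fst q" by (intro exI[of _ "(B, C)"]) simp
  qed
  then obtain q where q: "\<And>p. p \<in> T \<times> S \<Longrightarrow> fst (q p) \<in> T \<and> snd (q p) \<in> \<Delta> \<and> fst p ** snd p = snd (q p) ** fst (q p)"
    by metis
  define Y where "Y = (snd \<circ> q) ` (T \<times> S) \<union> (T \<inter> \<Delta>)"
  have step: "\<exists>us t. set us \<subseteq> Y \<and> length us = length ws \<and> t \<in> T \<and> mprod ws = mprod us ** t"
    if "set ws \<subseteq> S" for ws
    using that
  proof (induction ws rule: rev_induct)
    case Nil
    show ?case by (intro exI[of _ "[]"] exI[of _ "mat 1"]) (simp add: T_def)
  next
    case (snoc s ws)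
    then obtain us t where us: "set us \<subseteq> Y" "length us = length ws" "t \<in> T" "mprod ws = mprod us ** t" by auto
    have p: "(t, s) \<in> T \<times> S" using us snoc.prems by auto
    have "mprod (ws @ [s]) = mprod us ** (t ** s)" by (simp add: mprod_append us(4) matrix_mul_assoc)
    also have "t ** s = snd (q (t, s)) ** fst (q (t, s))" using q[OF p] by simp
    finally have "mprod (ws @ [s]) = mprod (us @ [snd (q (t, s))]) ** fst (q (t, s))"
      by (simp add: mprod_append matrix_mul_assoc)
    moreover have "snd (q (t, s)) \<in> Y" unfolding Y_def using p by (auto intro!: image_eqI[of _ _ "(t, s)"])
    ultimately show ?case using us q[OF p]
      by (intro exI[of _ "us @ [snd (q (t, s))]"] exI[of _ "fst (q (t, s))"]) simp
  qed
  show ?thesis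
  proof (rule that[of Y])
    show "finite Y" using finite_T finite_S by (simp add: Y_def)
    show Y\<Delta>: "Y \<subseteq> \<Delta>" using q by (auto simp: Y_def)
    fix ws assume ws: "set ws \<subseteq> S" "mprod ws \<in> \<Delta>"
    obtain us t where us: "set us \<subseteq> Y" "length us = length ws" "t \<in> T" "mprod ws = mprod us ** t"
      using step[OF ws(1)] by blast
    have u\<Delta>: "mprod us \<in> \<Delta>" using mprod_in[OF \<Delta>] us(1) Y\<Delta> by blast
    have "t = adj2 (mprod us) ** mprod ws" unfolding us(4) using adj2_cancel(1)[OF \<Delta>_closed(1)[OF u\<Delta>], of t] by simp
    hence "t \<in> \<Delta>" using u\<Delta> ws(2) \<Delta>_closed(3,4) by simp
    hence "t \<in> Y" using us(3) by (simp add: Y_def)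
    thus "\<exists>us. set us \<subseteq> Y \<and> length us = Suc (length ws) \<and> mprod us = mprod ws"
      using us by (intro exI[of _ "us @ [t]"]) (simp add: mprod_append)
  qed
qed

end

section \<open>The systole of congruence coverings\<close>

lemma trace_square: "det A = 1 \<Longrightarrow> trace (A ** A) = (trace A)\<^sup>2 - 2" for A :: "real^2^2"
  by (simp add: trace2 mult2_nth det_2 power2_eq_square algebra_simps)

lemma trace_conj:
  assumes "det B = 1" shows "trace (B ** A ** adj2 B) = trace (A :: real^2^2)"
proof -
  have "trace (B ** A ** adj2 B) = trace (adj2 B ** (B ** A))" by (rule trace_mul_sym)
  also have "adj2 B ** (B ** A) = A" using adj2_mult(1)[OF assms] by (simp add: matrix_mul_assoc)
  finally show ?thesis .
qed

lemma two_plus_hypQ_le_exp: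
  assumes "z \<in> \<H>" "w \<in> \<H>"
  shows "2 + hypQ z w \<le> 2 * exp (hyp_dist z w)"
proof -
  have l0: "0 \<le> hyp_dist z w"
    unfolding hyp_dist_hypQ using hypQ_nonneg[OF assms] by (intro arcosh_nonneg_real) simp
  have "cosh (hyp_dist z w) \<le> exp (hyp_dist z w)"
    using l0 unfolding cosh_def by simp
  thus ?thesis using hyp_dist_cosh[OF assms] by simp
qed

context square_closed_subgroup
begin

text \<open>A conjugate of \<open>A\<close> that acts near the compact region is spelled and its
  word doubled. This gives an element of \<Delta> with the right trace and squares the bound on
  \<open>2 ^ length\<close>.\<close>

lemma word_of_square:
  assumes A: "A \<in> G" and z: "z \<in> \<H>"
  obtains ws where "set ws \<subseteq> S" "mprod ws \<in> \<Delta>" "trace (mprod ws) = trace (A ** A)"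
    "2 ^ length ws \<le> (16 * (2 + hypQ z (mobius A z)))\<^sup>2"
proof -
  obtain B where B: "B \<in> G" "mobius B z \<in> Reg r" "B ** A ** adj2 B \<in> G"
    "hypQ (mobius B z) (mobius (B ** A ** adj2 B) (mobius B z)) = hypQ z (mobius A z)"
    using conjugate_into_Reg[OF A z] .
  define A' where "A' = B ** A ** adj2 B"
  have A': "A' \<in> G" and Q: "hypQ (mobius B z) (mobius A' (mobius B z)) = hypQ z (mobius A z)"
    using B by (simp_all add: A'_def)
  obtain ws where ws: "set ws \<subseteq> S" "mprod ws = A'" "2 ^ length ws \<le> 16 * (2 + hypQ z (mobius A z))"
    using word_of_displacement[OF A' B(2)] Q by metis
  show ?thesis
  proof (rule that[of "ws @ ws"])
    show "set (ws @ ws) \<subseteq> S" using ws by simp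
    have m: "mprod (ws @ ws) = A' ** A'" by (simp add: mprod_append ws(2))
    show "mprod (ws @ ws) \<in> \<Delta>" unfolding m by (rule square[OF A'])
    show "trace (mprod (ws @ ws)) = trace (A ** A)"
      unfolding m using trace_conj[of B A] A A' B(1) by (simp add: trace_square A'_def[symmetric])
    have "(2::real) ^ length (ws @ ws) = (2 ^ length ws)\<^sup>2"
      by (simp add: power_add power2_eq_square)
    also have "\<dots> \<le> (16 * (2 + hypQ z (mobius A z)))\<^sup>2" using ws(3) by (intro power_mono) auto
    finally show "2 ^ length (ws @ ws) \<le> (16 * (2 + hypQ z (mobius A z)))\<^sup>2" .
  qed
qed

lemma trace_square_ne_2:
  assumes "A \<in> G" "A \<noteq> mat 1" "A \<noteq> - mat 1"
  shows "trace (A ** A) \<noteq> 2"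
proof -
  have "2\<^sup>2 < \<bar>trace A\<bar>\<^sup>2" using trace_gt_2[OF assms] by (intro power_strict_mono) auto
  thus ?thesis using trace_square[of A] assms by simp
qed

lemma size_trace_bound:
  assumes "quat_data K B \<alpha> \<beta> \<OO> \<xi>" and sub: "\<Delta> \<subseteq> \<xi> ` {x. \<forall>i. x$i \<in> K}"
  obtains C :: real and p :: nat where "1 \<le> C" "1 \<le> p"
    "\<And>A z. A \<in> G \<Longrightarrow> z \<in> \<H> \<Longrightarrow>
      number_basis.size B (trace (A ** A) - 2) \<le> C * exp (2 * real p * hyp_dist z (mobius A z))"
proof -
  interpret quat_data K B \<alpha> \<beta> \<OO> \<xi> by fact
  obtain Y where Y: "finite Y" "Y \<subseteq> \<Delta>"
    "\<And>ws. set ws \<subseteq> S \<Longrightarrow> mprod ws \<in> \<Delta> \<Longrightarrow>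
      \<exists>us. set us \<subseteq> Y \<and> length us = Suc (length ws) \<and> mprod us = mprod ws"
    using schreier by metis
  have "Y \<subseteq> \<xi> ` V" using Y(2) sub by blast
  then obtain E where E: "1 \<le> E" "\<And>ws. set ws \<subseteq> Y \<Longrightarrow> trace (mprod ws) \<in> K"
    "\<And>ws. set ws \<subseteq> Y \<Longrightarrow> size (trace (mprod ws)) \<le> E ^ Suc (length ws)"
    using trace_word_bound[OF Y(1)] by metis
  \<comment> \<open>With \<open>E \<le> 2 ^ p\<close>, the power \<open>E ^ k\<close> is at most
    \<open>(2 ^ k) ^ p\<close>, so the bound on \<open>2 ^ length\<close> becomes a power of
    \<open>exp l\<close> with exponent \<open>2 p\<close>.\<close>
  obtain p0 where p0: "E < 2 ^ p0" using real_arch_pow[of 2 E] by auto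
  define p where "p = Suc p0"
  have "(2::real) ^ p0 \<le> 2 ^ p" by (rule power_increasing) (auto simp: p_def)
  hence "E \<le> 2 ^ p" using p0 by linarith
  moreover have "1 \<le> p" by (simp add: p_def)
  ultimately have p: "E \<le> 2 ^ p" "1 \<le> p" by blast+
  have two_K: "2 \<in> K" using of_nat_K[OF one_K, of 2] by simp
  define C where "C = (E\<^sup>2 + size 2) * 32 ^ (2 * p)"
  have E2: "1 \<le> E\<^sup>2" using E(1) by (rule one_le_power)
  have C1: "1 \<le> C"
    unfolding C_def using E2 size_nonneg[of 2] mult_mono[of 1 "E\<^sup>2 + size 2" 1 "32 ^ (2 * p)"]
    by (simp add: one_le_power)
  show ?thesis
  proof (rule that[OF C1 p(2)])
    fix A z assume A: "A \<in> G" and z: "z \<in> \<H>"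
    define l where "l = hyp_dist z (mobius A z)"
    have wH: "mobius A z \<in> \<H>" using A z by (auto intro: mobius_in_H)
    have l0: "0 \<le> l" unfolding l_def hyp_dist_hypQ using hypQ_nonneg[OF z wH] by (intro arcosh_nonneg_real) simp
    obtain ws where ws: "set ws \<subseteq> S" "mprod ws \<in> \<Delta>" "trace (mprod ws) = trace (A ** A)"
      "2 ^ length ws \<le> (16 * (2 + hypQ z (mobius A z)))\<^sup>2"
      using word_of_square[OF A z] by metis
    obtain us where us: "set us \<subseteq> Y" "length us = Suc (length ws)" "mprod us = mprod ws" using Y(3)[OF ws(1,2)] by blast
    have tK: "trace (A ** A) \<in> K" using E(2)[OF us(1)] us(3) ws(3) by simp
    have "16 * (2 + hypQ z (mobius A z)) \<le> 32 * exp l"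
      using two_plus_hypQ_le_exp[OF z wH] by (simp add: l_def)
    hence "(16 * (2 + hypQ z (mobius A z)))\<^sup>2 \<le> (32 * exp l)\<^sup>2"
      using hypQ_nonneg[OF z wH] by (intro power_mono) auto
    hence w2: "2 ^ length ws \<le> (32 * exp l)\<^sup>2" using ws(4) by linarith
    \<comment> \<open>One factor beyond the length comes from the additional Schreier letter, the
      other from \<open>trace_word_bound\<close>.\<close>
    have "size (trace (A ** A)) \<le> E ^ Suc (Suc (length ws))"
      using E(3)[OF us(1)] us(2,3) ws(3) by simp
    also have "\<dots> = E\<^sup>2 * E ^ length ws" by (simp add: power2_eq_square)
    also have "E ^ length ws \<le> (2 ^ p) ^ length ws" using p E(1) by (intro power_mono) auto
    also have "(2 ^ p) ^ length ws = ((2::real) ^ length ws) ^ p" by (simp add: mult.commute flip: power_mult)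
    also have "\<dots> \<le> ((32 * exp l)\<^sup>2) ^ p" using w2 by (intro power_mono) auto
    also have "((32 * exp l)\<^sup>2) ^ p = 32 ^ (2 * p) * exp (2 * real p * l)"
    proof -
      have "((32 * exp l)\<^sup>2) ^ p = 32 ^ (2 * p) * exp l ^ (2 * p)"
        by (simp only: power_mult[symmetric] power_mult_distrib)
      moreover have "exp (2 * real p * l) = exp l ^ (2 * p)" using exp_of_nat_mult[of "2 * p" l] by simp
      ultimately show ?thesis by (simp only:)
    qed
    finally have t: "size (trace (A ** A)) \<le> E\<^sup>2 * (32 ^ (2 * p) * exp (2 * real p * l))"
      using E2 by (simp add: mult_left_mono)
    have "1 \<le> 32 ^ (2 * p) * exp (2 * real p * l)"
      using l0 mult_mono[of 1 "32 ^ (2 * p)" 1 "exp (2 * real p * l)"] by (simp add: one_le_power)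
    hence s: "size 2 \<le> size 2 * (32 ^ (2 * p) * exp (2 * real p * l))"
      using mult_left_mono[OF _ size_nonneg[of 2], of 1] by simp
    have "size (trace (A ** A) - 2) \<le> size (trace (A ** A)) + size 2"
      using size_add[OF tK uminus_K[OF two_K]] size_uminus[OF two_K] by simp
    also have "\<dots> \<le> C * exp (2 * real p * l)" using t s by (simp add: C_def algebra_simps)
    finally show "size (trace (A ** A) - 2) \<le> C * exp (2 * real p * hyp_dist z (mobius A z))"
      by (simp add: l_def)
  qed
qed

end

lemma congruence_dataD:
  assumes cd: "congruence_data \<Gamma> \<alpha> \<beta> \<OO> \<xi>" and B: "number_basis (invariant_trace_field \<Gamma>) B"
    and G: "matgroup (preim \<Gamma>)" and \<Delta>: "matgroup (preim (square_subgroup \<Gamma>))"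
    and sub: "preim (square_subgroup \<Gamma>) \<subseteq> preim \<Gamma>"
    and sq: "\<And>A. A \<in> preim \<Gamma> \<Longrightarrow> A ** A \<in> preim (square_subgroup \<Gamma>)"
  shows "congruence_groups (invariant_trace_field \<Gamma>) B \<alpha> \<beta> \<OO> \<xi> (preim \<Gamma>) (preim (square_subgroup \<Gamma>))"
  using assms unfolding congruence_groups_def congruence_groups_axioms_def quat_data_def quat_data_axioms_def
    congruence_data_def maximal_order_def Let_def by blast

theorem theorem1p4:
  fixes \<Gamma> :: "(real^2^2) set set"
  assumes "closed_surface_group \<Gamma>" and "semi_arithmetic \<Gamma>"
  shows "\<exists>\<kappa> c :: real. \<kappa> > 0 \<and>
    (\<forall>\<alpha> \<beta> \<OO> \<xi>. congruence_data \<Gamma> \<alpha> \<beta> \<OO> \<xi> \<longrightarrow>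
      (\<exists>\<aa> :: nat \<Rightarrow> real set.
        (\<forall>i. nonzero_ideal (invariant_trace_field \<Gamma>) (\<aa> i)) \<and>
        (\<forall>N. \<exists>i. N \<le> covering_degree (congruence_subgroup \<Gamma> \<alpha> \<beta> \<OO> \<xi> (\<aa> i)) \<Gamma>) \<and>
        (\<forall>i. systole (congruence_subgroup \<Gamma> \<alpha> \<beta> \<OO> \<xi> (\<aa> i))
               \<ge> \<kappa> * ln (enn2real (area (congruence_subgroup \<Gamma> \<alpha> \<beta> \<OO> \<xi> (\<aa> i)))) - c)))"
proof (cases "\<exists>\<alpha> \<beta> \<OO> \<xi>. congruence_data \<Gamma> \<alpha> \<beta> \<OO> \<xi>")
  \<comment> \<open>Without any data the claim is vacuous. In the other case one choice of data
    serves as a reference, so that \<open>C\<close> and \<open>p\<close> are available before the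
    data are quantified.\<close>
  case False
  thus ?thesis by (intro exI[of _ 1] exI[of _ 0]) auto
next
  case True
  then obtain \<alpha>0 \<beta>0 \<OO>0 \<xi>0 where data0: "congruence_data \<Gamma> \<alpha>0 \<beta>0 \<OO>0 \<xi>0" by blast
  define G \<Delta> K where "G = preim \<Gamma>" and "\<Delta> = preim (square_subgroup \<Gamma>)" and "K = invariant_trace_field \<Gamma>"
  have sg: "subgroup \<Gamma> PSL2R" and disc: "discrete G"
    using assms(1) by (auto simp: closed_surface_group_def fuchsian_def G_def)
  have \<Gamma>c: "\<Gamma> \<subseteq> carrier PSL2R" using sg by (rule subgroup.subset)
  have projG: "proj ` G = \<Gamma>" unfolding G_def by (rule proj_preim[OF \<Gamma>c])
  have mG: "matgroup G" unfolding G_def by (rule matgroup_preim[OF sg])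
  have cpt: "compact_space (surface_topology (proj ` G))"
    using assms(1) by (simp add: closed_surface_group_def projG)
  obtain r where r: "1 \<le> r" "\<forall>z\<in>\<H>. \<exists>A\<in>G. mobius A z \<in> Reg r" using cocompact_region[OF mG cpt] by blast
  define gens where "gens = {\<gamma> \<otimes>\<^bsub>PSL2R\<^esub> \<gamma> | \<gamma>. \<gamma> \<in> \<Gamma>}"
  have gens: "gens \<subseteq> \<Gamma>" using subgroup.m_closed[OF sg] by (auto simp: gens_def)
  have sq: "square_subgroup \<Gamma> = generate PSL2R gens" by (simp add: square_subgroup_def gens_def)
  have sgD: "subgroup (square_subgroup \<Gamma>) PSL2R"
    unfolding sq using gens \<Gamma>c by (intro group.generate_is_subgroup[OF group_PSL2R]) auto
  have sqsub: "square_subgroup \<Gamma> \<subseteq> \<Gamma>"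
    unfolding sq using gens sg by (rule group.generate_subgroup_incl[OF group_PSL2R])
  have m\<Delta>: "matgroup \<Delta>" unfolding \<Delta>_def by (rule matgroup_preim[OF sgD])
  have \<Delta>G: "\<Delta> \<subseteq> G" using sqsub by (auto simp: \<Delta>_def G_def preim_def)
  have square: "A ** A \<in> \<Delta>" if A: "A \<in> G" for A
  proof -
    have "proj A \<otimes>\<^bsub>PSL2R\<^esub> proj A \<in> gens" using A by (auto simp: gens_def G_def preim_def)
    hence "proj (A ** A) \<in> square_subgroup \<Gamma>" unfolding sq proj_mult by (rule generate.incl)
    thus ?thesis using matgroupD(1)[OF mG A] by (simp add: \<Delta>_def preim_def det_mul)
  qed
  interpret square_closed_subgroup G r \<Delta>
  proof unfold_locales
    show "matgroup G" "discrete G" "1 \<le> r" "matgroup \<Delta>" "\<Delta> \<subseteq> G" by fact+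
    show "\<exists>A\<in>G. mobius A z \<in> Reg r" if "z \<in> \<H>" for z using r that by blast
    show "A ** A \<in> \<Delta>" if "A \<in> G" for A using square[OF that] .
    show "A = mat 1 \<or> A = - mat 1" if "A \<in> G" "z \<in> \<H>" "mobius A z = z" for A z
    proof -
      have "proj A \<in> \<Gamma>" "act (proj A) z = z" using that projG by (auto simp: act_proj)
      hence "proj A = proj (mat 1)" using assms(1) that(2)
        unfolding closed_surface_group_def one_PSL2R by blast
      thus ?thesis by (simp add: proj_eq_iff)
    qed
  qed
  obtain B where B: "number_basis K B"
    using number_field_basis assms(2) unfolding semi_arithmetic_def K_def by metis
  have data: "congruence_groups K B \<alpha> \<beta> \<OO> \<xi> G \<Delta>" if "congruence_data \<Gamma> \<alpha> \<beta> \<OO> \<xi>" for \<alpha> \<beta> \<OO> \<xi>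
    using congruence_dataD[OF that B[unfolded K_def]] mG m\<Delta> \<Delta>G square unfolding G_def \<Delta>_def K_def by blast
  interpret ref: congruence_groups K B \<alpha>0 \<beta>0 \<OO>0 \<xi>0 G \<Delta> by (rule data[OF data0])
  have "\<Delta> \<subseteq> \<xi>0 ` {x. \<forall>i. x$i \<in> K}" using ref.\<Delta>_\<xi> ref.norm_one_V by blast
  then obtain C p where C: "1 \<le> C" "1 \<le> p"
    "\<And>A z. A \<in> G \<Longrightarrow> z \<in> \<H> \<Longrightarrow>
      ref.size (trace (A ** A) - 2) \<le> C * exp (2 * real p * hyp_dist z (mobius A z))"
    using size_trace_bound[OF ref.quat_data_axioms] by metis
  define n where "n = card B"
  have n: "1 \<le> n" using ref.B_nonempty ref.finite_B by (simp add: n_def Suc_le_eq card_gt_0_iff)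
  define a where "a = enn2real (emeasure hyp_measure (Reg r))"
  have a: "emeasure hyp_measure (Reg r) = ennreal a" "0 \<le> a"
    using hyp_measure_Reg_finite[OF r(1)] by (auto simp: a_def)
  \<comment> \<open>The summand 1 makes \<open>ln CA\<close> nonnegative.\<close>
  define CA where "CA = 1 + real (card T) * a"
  have CA: "1 \<le> CA" using a(2) by (simp add: CA_def)
  \<comment> \<open>The area is at most \<open>CA * m^(8 n)\<close> and the systole at least
    \<open>ln m / (4 p)\<close> up to a constant; this value makes
    \<open>8 n \<kappa> = 1 / (4 p)\<close>. All quantities involved come from the group and the
    reference data.\<close>
  define \<kappa> where "\<kappa> = 1 / (32 * real n * real p)"
  define c where "c = \<kappa> * ln CA + ln C / (2 * real p)"
  have \<kappa>: "0 < \<kappa>" using n C(2) by (simp add: \<kappa>_def)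
  have "\<exists>\<aa> :: nat \<Rightarrow> real set. (\<forall>i. nonzero_ideal (invariant_trace_field \<Gamma>) (\<aa> i)) \<and>
      (\<forall>N. \<exists>i. N \<le> covering_degree (congruence_subgroup \<Gamma> \<alpha> \<beta> \<OO> \<xi> (\<aa> i)) \<Gamma>) \<and>
      (\<forall>i. systole (congruence_subgroup \<Gamma> \<alpha> \<beta> \<OO> \<xi> (\<aa> i))
             \<ge> \<kappa> * ln (enn2real (area (congruence_subgroup \<Gamma> \<alpha> \<beta> \<OO> \<xi> (\<aa> i)))) - c)"
    if cd: "congruence_data \<Gamma> \<alpha> \<beta> \<OO> \<xi>" for \<alpha> \<beta> \<OO> \<xi>
  proof -
    interpret cg: congruence_groups K B \<alpha> \<beta> \<OO> \<xi> G \<Delta> by (rule data[OF cd])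
    have sub_eq: "congruence_subgroup \<Gamma> \<alpha> \<beta> \<OO> \<xi> (ref.level m) = proj ` cg.H m" for m
    proof -
      have "congruence_subgroup \<Gamma> \<alpha> \<beta> \<OO> \<xi> (ref.level m) = proj ` (G \<inter> \<xi> ` cg.PC m)"
        by (simp only: congruence_subgroup_def G_def)
      thus ?thesis by (simp only: cg.proj_H cg.H0_def)
    qed
    obtain M where M: "0 < M" "\<And>m. 0 < m \<Longrightarrow> \<exists>R. R \<subseteq> \<Delta> \<and> finite R \<and> card R \<le> (m * M) ^ (4 * card B) \<and>
        (\<forall>A\<in>\<Delta>. \<exists>A'\<in>R. A ** adj2 A' \<in> cg.H m)"
      using cg.index_bound by metis
    \<comment> \<open>The size depends only on the basis of \<open>K\<close>, so this lower bound
      for the present data can be compared with the upper bound from the reference data.\<close>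
    obtain \<delta> where \<delta>: "0 < \<delta>"
      "\<And>m A. A \<in> cg.H m \<Longrightarrow> trace (A ** A) \<noteq> 2 \<Longrightarrow> of_nat m * \<delta> \<le> ref.size (trace (A ** A) - 2)"
      using cg.trace_H by metis
    \<comment> \<open>Beyond this value \<open>sqrt m * \<delta> \<ge> 1\<close>, which replaces
      \<open>m \<delta>\<close> by \<open>sqrt m\<close> and removes the dependence on
      \<open>\<delta>\<close>.\<close>
    obtain m1 :: nat where m1: "1 / \<delta>\<^sup>2 < real m1" using reals_Archimedean2 by blast
    define m0 where "m0 = max M m1"
    define L where "L m = ln (real m) / (4 * real p) - ln C / (2 * real p)" for m :: nat
    have disp: "L m \<le> hyp_dist z (mobius A z)"
      if m: "m0 \<le> m" and A: "A \<in> cg.H m" "A \<noteq> mat 1" "A \<noteq> - mat 1" and z: "z \<in> \<H>" for m A z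
    proof -
      define l where "l = hyp_dist z (mobius A z)"
      have AG: "A \<in> G" using A(1) cg.H_G by blast
      have mpos: "0 < real m" "1 / \<delta>\<^sup>2 < real m" using m M(1) m1 by (auto simp: m0_def)
      have "sqrt (1 / \<delta>\<^sup>2) < sqrt (real m)" using mpos(2) by simp
      hence "1 / \<delta> < sqrt (real m)" using \<delta>(1) by (simp add: real_sqrt_divide)
      hence "1 \<le> sqrt (real m) * \<delta>" using \<delta>(1) by (simp add: field_simps)
      hence "sqrt (real m) * 1 \<le> sqrt (real m) * (sqrt (real m) * \<delta>)" by (intro mult_left_mono) auto
      also have "\<dots> = real m * \<delta>" by (simp flip: mult.assoc)
      also have "\<dots> \<le> ref.size (trace (A ** A) - 2)"
        by (rule \<delta>(2)[OF A(1) trace_square_ne_2[OF AG A(2,3)]])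
      also have "\<dots> \<le> C * exp (2 * real p * l)" unfolding l_def by (rule C(3)[OF AG z])
      finally have le: "sqrt (real m) \<le> C * exp (2 * real p * l)" by simp
      have "ln (sqrt (real m)) \<le> ln (C * exp (2 * real p * l))"
        by (rule ln_mono) (use le mpos in auto)
      also have "\<dots> = ln C + 2 * real p * l" using C(1) by (simp add: ln_mult)
      finally have "ln (real m) / 2 \<le> ln C + 2 * real p * l" using mpos by (simp add: ln_sqrt)
      hence "(ln (real m) / 2 - ln C) / (2 * real p) \<le> l" using C(2) by (simp add: field_simps)
      moreover have "(ln (real m) / 2 - ln C) / (2 * real p) = L m" by (simp add: L_def diff_divide_distrib)
      ultimately show ?thesis by (simp add: l_def)
    qed
    \<comment> \<open>Representatives of \<Delta> modulo the congruence subgroup are multiplied by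
      representatives of \<open>G\<close> modulo \<Delta>.\<close>
    have reps: "\<exists>T'. finite T' \<and> T' \<subseteq> G \<and> card T' \<le> (m * M) ^ (4 * n) * card T \<and>
        (\<forall>A\<in>G. \<exists>B\<in>T'. \<exists>C\<in>cg.H m. A = C ** B)" if m: "0 < m" for m
    proof -
      obtain R where R: "R \<subseteq> \<Delta>" "finite R" "card R \<le> (m * M) ^ (4 * n)"
        "\<forall>A\<in>\<Delta>. \<exists>A'\<in>R. A ** adj2 A' \<in> cg.H m" using M(2)[OF m] by (auto simp: n_def)
      define T' where "T' = (\<lambda>(A, B). A ** B) ` (R \<times> T)"
      have "finite T'" using R finite_T by (simp add: T'_def)
      moreover have "T' \<subseteq> G" using R(1) \<Delta>_G T_G by (auto simp: T'_def intro!: G_closed(3))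
      moreover have "card T' \<le> (m * M) ^ (4 * n) * card T"
      proof -
        have "card T' \<le> card (R \<times> T)" unfolding T'_def using R finite_T by (intro card_image_le) auto
        also have "\<dots> = card R * card T" by (rule card_cartesian_product)
        also have "\<dots> \<le> (m * M) ^ (4 * n) * card T" using R(3) by (rule mult_le_mono1)
        finally show ?thesis .
      qed
      moreover have "\<exists>B\<in>T'. \<exists>C\<in>cg.H m. A = C ** B" if A: "A \<in> G" for A
      proof -
        obtain B D where B: "B \<in> T" "D \<in> \<Delta>" "A = D ** B" using T_cover[OF A] by (auto simp: equiv_def)
        obtain A' where A': "A' \<in> R" "D ** adj2 A' \<in> cg.H m" using R(4) B(2) by blast
        have dA': "det A' = 1" using A' R \<Delta>_closed(1) by blast
        have "A = (D ** adj2 A') ** (A' ** B)"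
          using adj2_mult(1)[OF dA'] unfolding B(3)
          by (metis matrix_mul_assoc matrix_mul_rid)
        moreover have "A' ** B \<in> T'" unfolding T'_def using A' B by force
        ultimately show ?thesis using A'(2) by blast
      qed
      ultimately show ?thesis by blast
    qed
    have pos: "0 < m" if "m0 \<le> m" for m using that M(1) by (simp add: m0_def)
    have area: "ln (enn2real (area (proj ` cg.H m))) \<le> ln CA + 8 * real n * ln (real m)" if m: "m0 \<le> m" for m
    proof -
      have mp: "0 < m" "M \<le> m" using pos[OF m] m by (auto simp: m0_def)
      obtain T' where T': "finite T'" "T' \<subseteq> G" "card T' \<le> (m * M) ^ (4 * n) * card T"
        "\<forall>A\<in>G. \<exists>B\<in>T'. \<exists>C\<in>cg.H m. A = C ** B" using reps[OF mp(1)] by blast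
      have "area (proj ` cg.H m) \<le> of_nat (card T') * ennreal a"
        using area_le_index[OF cg.matgroup_H cg.H_G T'(1,2)] T'(4) a(1) by metis
      also have "\<dots> = ennreal (real (card T') * a)"
        using a(2) by (simp add: ennreal_mult ennreal_of_nat_eq_real_of_nat)
      finally have 1: "enn2real (area (proj ` cg.H m)) \<le> real (card T') * a"
        using a(2) by (intro enn2real_leI) auto
      have "(m * M) ^ (4 * n) \<le> (m * m) ^ (4 * n)" using mp by (intro power_mono) auto
      also have "(m * m) ^ (4 * n) = m ^ (8 * n)" by (simp add: power_mult flip: power2_eq_square)
      finally have "card T' \<le> m ^ (8 * n) * card T" using T'(3) by (meson le_trans mult_le_mono1)
      hence "real (card T') \<le> real (m ^ (8 * n) * card T)" by (rule of_nat_mono)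
      hence "real (card T') * a \<le> real m ^ (8 * n) * (real (card T) * a)"
        using mult_right_mono[OF _ a(2)] by (simp add: mult.assoc[symmetric])
      also have "\<dots> \<le> real m ^ (8 * n) * CA" by (intro mult_left_mono) (auto simp: CA_def)
      finally have 2: "enn2real (area (proj ` cg.H m)) \<le> CA * real m ^ (8 * n)" using 1 by (simp add: mult.commute)
      have m1: "1 \<le> real m" using mp by simp
      have rhs: "ln (CA * real m ^ (8 * n)) = ln CA + 8 * real n * ln (real m)"
        using CA m1 by (simp add: ln_mult ln_realpow)
      show ?thesis
      proof (cases "0 < enn2real (area (proj ` cg.H m))")
        case True
        hence "ln (enn2real (area (proj ` cg.H m))) \<le> ln (CA * real m ^ (8 * n))" using 2 by simp
        thus ?thesis using rhs by simp
      next
        case False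
        \<comment> \<open>Here \<open>ln 0\<close> is 0 by convention, and the right side is
          nonnegative.\<close>
        hence "enn2real (area (proj ` cg.H m)) = 0" using enn2real_nonneg[of "area (proj ` cg.H m)"] by linarith
        thus ?thesis using CA m1 by simp
      qed
    qed
    \<comment> \<open>Finitely many cosets fill the infinite group \<open>G\<close>, so the
      congruence subgroup is infinite and contains elements other than 1 and -1.\<close>
    have hyper: "\<exists>A\<in>cg.H m. 2 < \<bar>trace A\<bar>" if m: "m0 \<le> m" for m
    proof -
      obtain T' where T': "finite T'" "T' \<subseteq> G" "\<forall>A\<in>G. \<exists>B\<in>T'. \<exists>C\<in>cg.H m. A = C ** B"
        using reps[OF pos[OF m]] by blast
      have "G \<subseteq> (\<lambda>(C, B). C ** B) ` (cg.H m \<times> T')" using T'(3) by force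
      hence "infinite (cg.H m)" using infinite_G T'(1) finite_subset by blast
      hence "infinite (cg.H m - {mat 1, - mat 1})" by simp
      then obtain A where "A \<in> cg.H m - {mat 1, - mat 1}" by (metis ex_in_conv finite.emptyI)
      thus ?thesis using trace_gt_2[of A] cg.H_G by blast
    qed
    have sys: "systole (proj ` cg.H m) \<ge> \<kappa> * ln (enn2real (area (proj ` cg.H m))) - c" if m: "m0 \<le> m" for m
    proof -
      obtain A where A: "A \<in> cg.H m" "2 < \<bar>trace A\<bar>" using hyper[OF m] by blast
      have "\<kappa> * ln (enn2real (area (proj ` cg.H m))) \<le> \<kappa> * (ln CA + 8 * real n * ln (real m))"
        using area[OF m] \<kappa> by (intro mult_left_mono) auto
      also have "\<dots> = \<kappa> * ln CA + ln (real m) / (4 * real p)"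
        using n C(2) by (simp add: \<kappa>_def distrib_left)
      finally have "\<kappa> * ln (enn2real (area (proj ` cg.H m))) - c \<le> L m" by (simp add: c_def L_def)
      also have "L m \<le> systole (proj ` cg.H m)"
        by (rule systole_ge[OF cg.matgroup_H A]) (rule disp[OF m])
      finally show ?thesis .
    qed
    \<comment> \<open>Any \<open>N\<close> elements of \<open>G\<close> that differ in PSL(2,R) have
      finitely many quotients. Once the displacement bound \<open>L\<close> exceeds all their
      displacements at \<i>, no nontrivial quotient lies in the congruence subgroup, so the elements
      represent \<open>N\<close> distinct cosets.\<close>
    have deg: "\<exists>i. N \<le> covering_degree (proj ` cg.H (m0 + i)) (proj ` G)" for N
    proof -
      have "G \<subseteq> \<Union>(proj ` G)" by (auto simp: proj_eq)
      moreover have "finite (proj A)" for A by (simp add: proj_eq)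
      ultimately have "infinite (proj ` G)" using infinite_G by (metis finite_Union finite_subset imageE)
      then obtain P where P: "P \<subseteq> proj ` G" "finite P" "card P = N" using infinite_arbitrarily_large by metis
      define f where "f = inv_into G proj"
      have f: "f p \<in> G" "proj (f p) = p" if "p \<in> P" for p
        using that P(1) by (auto simp: f_def inv_into_into f_inv_into_f)
      define Y where "Y = f ` P"
      have "inj_on f P" using f(2) by (metis inj_onI)
      hence cY: "card Y = N" using P(3) by (simp add: Y_def card_image)
      have YG: "Y \<subseteq> G" using f by (auto simp: Y_def)
      define Q where "Q = (\<lambda>(A, B). hyp_dist \<i> (mobius (A ** adj2 B) \<i>)) ` (Y \<times> Y)"
      have "finite Q" using P(2) by (simp add: Q_def Y_def)
      then obtain q where q: "\<And>x. x \<in> Q \<Longrightarrow> x \<le> q" by (metis bdd_above.E bdd_above_finite)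
      \<comment> \<open>Solves \<open>q < L (m0 + i)\<close> for the level.\<close>
      obtain i :: nat where i: "exp (4 * real p * (q + ln C / (2 * real p))) < real i" using reals_Archimedean2 by blast
      have ip: "exp (4 * real p * (q + ln C / (2 * real p))) < real (m0 + i)" using i by simp
      have "ln (exp (4 * real p * (q + ln C / (2 * real p)))) < ln (real (m0 + i))"
        using ip by (subst ln_less_cancel_iff) (auto intro: less_trans[OF exp_gt_zero])
      hence "q + ln C / (2 * real p) < ln (real (m0 + i)) / (4 * real p)"
        using C(2) by (simp add: less_divide_eq mult_ac)
      hence Lq: "q < L (m0 + i)" by (simp add: L_def)
      obtain T' where T': "finite T'" "T' \<subseteq> G" "\<forall>A\<in>G. \<exists>B\<in>T'. \<exists>C\<in>cg.H (m0 + i). A = C ** B"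
        using reps[OF pos[of "m0 + i"]] by auto
      have sep: "A = B" if AB: "A \<in> Y" "B \<in> Y" "A ** adj2 B \<in> cg.H (m0 + i)" for A B
      proof -
        have "hyp_dist \<i> (mobius (A ** adj2 B) \<i>) \<in> Q" using AB unfolding Q_def by force
        hence "hyp_dist \<i> (mobius (A ** adj2 B) \<i>) < L (m0 + i)" using q Lq by (meson le_less_trans)
        hence pm: "A ** adj2 B = mat 1 \<or> A ** adj2 B = - mat 1"
          using disp[of "m0 + i" "A ** adj2 B" \<i>] AB(3) ii_in_H by fastforce
        have "det B = 1" using AB YG by auto
        hence "A = (A ** adj2 B) ** B" using adj2_mult(1)[of B] by (simp flip: matrix_mul_assoc)
        hence "A = B \<or> A = - B" using pm by (metis matrix_mul_lid minus_mult2(1))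
        hence "proj A = proj B" by (simp add: proj_eq_iff)
        thus "A = B" using AB f(2) by (auto simp: Y_def)
      qed
      have "card Y \<le> covering_degree (proj ` cg.H (m0 + i)) (proj ` G)"
        using T' sep by (intro covering_degree_ge[OF cg.matgroup_H cg.H_G T'(1,2) _ YG]) auto
      thus ?thesis using cY by blast
    qed
    show ?thesis
    proof (rule exI[of _ "\<lambda>i. ref.level (m0 + i)"], intro conjI allI)
      show "nonzero_ideal (invariant_trace_field \<Gamma>) (ref.level (m0 + i))" for i
        using cg.nonzero_ideal_level[OF pos[of "m0 + i"]] by (simp add: K_def)
      show "\<exists>i. N \<le> covering_degree (congruence_subgroup \<Gamma> \<alpha> \<beta> \<OO> \<xi> (ref.level (m0 + i))) \<Gamma>" for N
        using deg[of N] unfolding sub_eq projG .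
      show "systole (congruence_subgroup \<Gamma> \<alpha> \<beta> \<OO> \<xi> (ref.level (m0 + i))) \<ge>
          \<kappa> * ln (enn2real (area (congruence_subgroup \<Gamma> \<alpha> \<beta> \<OO> \<xi> (ref.level (m0 + i))))) - c" for i
        unfolding sub_eq by (rule sys) simp
    qed
  qed
  thus ?thesis using \<kappa> by blast
qed

end
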